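(* Let $d\in\mathbb N$ and let $\Delta g(i)=\frac1{2d}\sum_{j\in\mathbb Z^d:\,|j-i|=1}(g(j)-g(i))$ be the discrete Laplacian on $\mathbb Z^d$ (where $|j-i|=1$ means that $i,j$ are nearest neighbours). Suppose $\sigma:\mathbb R_+\to\mathbb R_+$ is continuous, $\sigma(0)=0$, $\sigma(x)>0$ for $x>0$, and there exist constants $C\ge1$ and $\theta\in(0,1)$ such that $\sigma(x)\le C(x^\theta+x)$ for all $x\ge0$. Let $X=(X_t)_{t\ge0}$ be a continuous $\ell^1_+$-valued solution to $$dX_t(i)=\Delta X_t(i)\,dt+\sigma(X_t(i))\,dB_t(i),\qquad i\in\mathbb Z^d,$$ with non-zero initial condition $X_0$, and let $\eta:=\inf\{t\ge0:X_t(i)=0\ \ \forall i\in\mathbb Z^d\}$. Then with probability one, $\eta>0$ and $$\{t\ge0:\mathrm{supp}(X_t)\text{ is unbounded}\}$$ is a dense, uncountable subset of $[0,\eta]$ (read as $[0,\infty)$ if $\eta=\infty$).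
   Context: $\mathbb R_+=[0,\infty)$. $\ell^1(\mathbb Z^d)$ is the space of absolutely summable real functions on $\mathbb Z^d$ with its usual norm, and $\ell^1_+(\mathbb Z^d)$ is the set of its elements with non-negative entries. $\mathrm{supp}(x)=\{i\in\mathbb Z^d:x(i)\ne0\}$. $\inf\emptyset=\infty$. Solution: on a filtered probability space $(\Omega,\mathscr F,(\mathscr F_t)_{t\ge0},\mathbb P)$ carrying a family $\{(B_t(i))_{t\ge0}:i\in\mathbb Z^d\}$ of independent $(\mathscr F_t)$-Brownian motions, a continuous $\ell^1_+$-valued solution is an $\ell^1_+(\mathbb Z^d)$-valued process $X$ with $t\mapsto X_t$ a.s. continuous in $\ell^1$, such that for each $i$, $(X_t(i))_{t\ge0}$ is continuous, non-negative, $(\mathscr F_t)$-adapted and a.s. satisfies $X_t(i)=X_0(i)+\int_0^t\Delta X_s(i)\,ds+\int_0^t\sigma(X_s(i))\,dB_s(i)$ for all $t\ge0$. *)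

theory Defs
  imports "HOL-Probability.Probability"
begin

section \<open>The lattice\<close>

text \<open>The lattice is the type \<^typ>\<open>int ^ 'd\<close>, with dimension \<open>CARD('d)\<close>. Distances and
  boundedness are those of the ambient Euclidean space.\<close>

definition embed :: "int ^ 'd \<Rightarrow> real ^ 'd"
  where "embed i = (\<chi> k. real_of_int (i $ k))"

definition neighbours :: "int ^ 'd \<Rightarrow> (int ^ 'd) set"
  where "neighbours i = {j. dist (embed j) (embed i) = 1}"

definition laplace :: "(int ^ 'd \<Rightarrow> real) \<Rightarrow> int ^ 'd \<Rightarrow> real"
  where "laplace g i = (\<Sum>j\<in>neighbours i. g j - g i) / (2 * real CARD('d))"

definition lattice_bounded :: "(int ^ 'd) set \<Rightarrow> bool"
  where "lattice_bounded S \<longleftrightarrow> bounded (embed ` S)"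

definition supp :: "('i \<Rightarrow> real) \<Rightarrow> 'i set"
  where "supp x = {i. x i \<noteq> 0}"

text \<open>The sum in the Laplacian is not the default value of a sum over an infinite set.\<close>

lemma finite_neighbours: "finite (neighbours (i :: int ^ 'd))"
proof -
  have "neighbours i \<subseteq> vec_lambda ` (UNIV \<rightarrow>\<^sub>E (\<Union>k. {i $ k - 1..i $ k + 1}))"
  proof
    fix j assume j: "j \<in> neighbours i"
    have "j $ k \<in> {i $ k - 1..i $ k + 1}" for k
    proof -
      have "\<bar>(embed j - embed i) $ k\<bar> \<le> norm (embed j - embed i)"
        by (rule component_le_norm_cart)
      also have "\<dots> = 1"
        using j by (simp add: neighbours_def dist_norm)
      finally have "\<bar>real_of_int (j $ k) - real_of_int (i $ k)\<bar> \<le> 1"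
        by (simp add: embed_def)
      then show ?thesis
        by auto
    qed
    then have "vec_nth j \<in> UNIV \<rightarrow>\<^sub>E (\<Union>k. {i $ k - 1..i $ k + 1})"
      by blast
    then show "j \<in> vec_lambda ` (UNIV \<rightarrow>\<^sub>E (\<Union>k. {i $ k - 1..i $ k + 1}))"
      by (metis (no_types, lifting) image_eqI vec_nth_inverse)
  qed
  moreover have "finite (vec_lambda ` (UNIV \<rightarrow>\<^sub>E (\<Union>k. {i $ k - 1..i $ k + 1})))"
    by (intro finite_imageI finite_PiE) auto
  ultimately show ?thesis
    by (rule finite_subset)
qed

section \<open>The sequence space\<close>

definition l1_norm :: "('i \<Rightarrow> real) \<Rightarrow> real"
  where "l1_norm x = (\<Sum>\<^sub>\<infinity>i. \<bar>x i\<bar>)"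

definition l1_plus :: "('i \<Rightarrow> real) set"
  where "l1_plus = {x. (\<lambda>i. \<bar>x i\<bar>) summable_on UNIV \<and> (\<forall>i. 0 \<le> x i)}"

definition l1_continuous_on :: "real set \<Rightarrow> (real \<Rightarrow> 'i \<Rightarrow> real) \<Rightarrow> bool"
  where "l1_continuous_on T f \<longleftrightarrow>
    (\<forall>t\<in>T. ((\<lambda>s. l1_norm (\<lambda>i. f s i - f t i)) \<longlongrightarrow> 0) (at t within T))"

section \<open>Filtrations and Brownian motions\<close>

text \<open>Time is \<open>[0, \<infinity>)\<close>; nothing is required at negative indices. The filtration need be neither
  complete nor right-continuous.\<close>

locale filtered_prob_space = prob_space M
  for M :: "'a measure" +
  fixes F :: "real \<Rightarrow> 'a measure"
  assumes subalgebra_F: "0 \<le> t \<Longrightarrow> subalgebra M (F t)"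
    and F_mono: "0 \<le> s \<Longrightarrow> s \<le> t \<Longrightarrow> sets (F s) \<subseteq> sets (F t)"

definition adapted :: "(real \<Rightarrow> 'a measure) \<Rightarrow> (real \<Rightarrow> 'a \<Rightarrow> real) \<Rightarrow> bool"
  where "adapted F Y \<longleftrightarrow> (\<forall>t\<ge>0. Y t \<in> borel_measurable (F t))"

definition progressively_measurable :: "(real \<Rightarrow> 'a measure) \<Rightarrow> (real \<Rightarrow> 'a \<Rightarrow> real) \<Rightarrow> bool"
  where "progressively_measurable F H \<longleftrightarrow>
    (\<forall>t\<ge>0. (\<lambda>(s, \<omega>). H s \<omega>) \<in> borel_measurable (restrict_space borel {0..t} \<Otimes>\<^sub>M F t))"

definition brownian_motion ::
  "'a measure \<Rightarrow> (real \<Rightarrow> 'a measure) \<Rightarrow> (real \<Rightarrow> 'a \<Rightarrow> real) \<Rightarrow> bool"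
  where "brownian_motion M F W \<longleftrightarrow>
    adapted F W \<and>
    (AE \<omega> in M. W 0 \<omega> = 0) \<and>
    (AE \<omega> in M. continuous_on {0..} (\<lambda>t. W t \<omega>)) \<and>
    (\<forall>s t. 0 \<le> s \<and> s < t \<longrightarrow>
      distributed M lborel (\<lambda>\<omega>. W t \<omega> - W s \<omega>) (normal_density 0 (sqrt (t - s))) \<and>
      prob_space.indep_set M (sets (F s))
        {(\<lambda>\<omega>. W t \<omega> - W s \<omega>) -` A \<inter> space M | A. A \<in> sets borel})"

text \<open>Independence of the family is that of the paths, as random elements of the product space
  indexed by \<open>[0, \<infinity>)\<close>.\<close>

definition independent_brownian_motions ::
  "'a measure \<Rightarrow> (real \<Rightarrow> 'a measure) \<Rightarrow> ('i \<Rightarrow> real \<Rightarrow> 'a \<Rightarrow> real) \<Rightarrow> bool"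
  where "independent_brownian_motions M F B \<longleftrightarrow>
    (\<forall>i. brownian_motion M F (B i)) \<and>
    prob_space.indep_vars M (\<lambda>i. PiM {0..} (\<lambda>t. borel))
      (\<lambda>i \<omega>. \<lambda>t\<in>{0..}. B i t \<omega>) UNIV"

section \<open>The stochastic integral\<close>

text \<open>A simple process is \<open>\<Sum>k<m. \<xi> k * indicator {\<tau> k <.. \<tau> (Suc k)}\<close> with deterministic times and
  bounded coefficients \<open>\<xi> k\<close> known at time \<open>\<tau> k\<close>.\<close>

definition simple_process ::
  "(real \<Rightarrow> 'a measure) \<Rightarrow> nat \<Rightarrow> (nat \<Rightarrow> real) \<Rightarrow> (nat \<Rightarrow> 'a \<Rightarrow> real) \<Rightarrow> bool"
  where "simple_process F m \<tau> \<xi> \<longleftrightarrow>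
    0 \<le> \<tau> 0 \<and>
    (\<forall>k<m. \<tau> k \<le> \<tau> (Suc k) \<and> \<xi> k \<in> borel_measurable (F (\<tau> k)) \<and>
      (\<exists>c. \<forall>\<omega>\<in>space (F (\<tau> k)). \<bar>\<xi> k \<omega>\<bar> \<le> c))"

definition simple_value ::
  "nat \<Rightarrow> (nat \<Rightarrow> real) \<Rightarrow> (nat \<Rightarrow> 'a \<Rightarrow> real) \<Rightarrow> real \<Rightarrow> 'a \<Rightarrow> real"
  where "simple_value m \<tau> \<xi> s \<omega> = (\<Sum>k<m. \<xi> k \<omega> * indicator {\<tau> k <.. \<tau> (Suc k)} s)"

definition simple_integral ::
  "nat \<Rightarrow> (nat \<Rightarrow> real) \<Rightarrow> (nat \<Rightarrow> 'a \<Rightarrow> real) \<Rightarrow> (real \<Rightarrow> 'a \<Rightarrow> real) \<Rightarrow> real \<Rightarrow> 'a \<Rightarrow> real"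
  where "simple_integral m \<tau> \<xi> W t \<omega> =
    (\<Sum>k<m. \<xi> k \<omega> * (W (min t (\<tau> (Suc k))) \<omega> - W (min t (\<tau> k)) \<omega>))"

text \<open>\<open>I\<close> is a continuous version of the stochastic integral of \<open>H\<close> against \<open>W\<close>: simple processes
  approximate \<open>H\<close> in \<open>L\<^sup>2[0, t]\<close>, in probability, and their integrals converge to \<open>I t\<close> in
  probability. By the isometry and localization, for a Brownian motion \<open>W\<close> this determines \<open>I\<close>
  up to indistinguishability, and such an \<open>I\<close> exists if \<open>H\<close> is progressively measurable and
  almost surely locally square integrable. The integral is a relation because it is only
  defined up to null sets.\<close>

definition ito_integral ::
  "'a measure \<Rightarrow> (real \<Rightarrow> 'a measure) \<Rightarrow> (real \<Rightarrow> 'a \<Rightarrow> real) \<Rightarrow> (real \<Rightarrow> 'a \<Rightarrow> real) \<Rightarrow>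
    (real \<Rightarrow> 'a \<Rightarrow> real) \<Rightarrow> bool"
  where "ito_integral M F W H I \<longleftrightarrow>
    progressively_measurable F H \<and>
    (\<forall>t\<ge>0. I t \<in> borel_measurable M) \<and>
    (AE \<omega> in M. continuous_on {0..} (\<lambda>t. I t \<omega>)) \<and>
    (\<exists>m \<tau> \<xi>. (\<forall>n. simple_process F (m n) (\<tau> n) (\<xi> n)) \<and>
      (\<forall>t\<ge>0. \<forall>\<epsilon>>0.
        (\<lambda>n. measure M {\<omega> \<in> space M. ennreal \<epsilon> <
            (\<integral>\<^sup>+s\<in>{0..t}. ennreal ((simple_value (m n) (\<tau> n) (\<xi> n) s \<omega> - H s \<omega>)\<^sup>2) \<partial>lborel)})
          \<longlonglongrightarrow> 0 \<and>
        (\<lambda>n. measure M {\<omega> \<in> space M.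
            \<epsilon> < \<bar>simple_integral (m n) (\<tau> n) (\<xi> n) W t \<omega> - I t \<omega>\<bar>})
          \<longlonglongrightarrow> 0))"

section \<open>Solutions\<close>

definition continuous_l1_solution ::
  "'a measure \<Rightarrow> (real \<Rightarrow> 'a measure) \<Rightarrow> (int ^ 'd \<Rightarrow> real \<Rightarrow> 'a \<Rightarrow> real) \<Rightarrow> (real \<Rightarrow> real) \<Rightarrow>
    (real \<Rightarrow> 'a \<Rightarrow> int ^ 'd \<Rightarrow> real) \<Rightarrow> bool"
  where "continuous_l1_solution M F B \<sigma> X \<longleftrightarrow>
    (\<forall>t\<ge>0. \<forall>\<omega>\<in>space M. X t \<omega> \<in> l1_plus) \<and>
    (AE \<omega> in M. l1_continuous_on {0..} (\<lambda>t. X t \<omega>)) \<and>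
    (\<forall>i.
      (\<forall>\<omega>\<in>space M. continuous_on {0..} (\<lambda>t. X t \<omega> i)) \<and>
      adapted F (\<lambda>t \<omega>. X t \<omega> i) \<and>
      (\<exists>I. ito_integral M F (B i) (\<lambda>s \<omega>. \<sigma> (X s \<omega> i)) I \<and>
        (AE \<omega> in M. \<forall>t\<ge>0.
          X t \<omega> i = X 0 \<omega> i + (LINT s:{0..t}|lborel. laplace (X s \<omega>) i) + I t \<omega>)))"

definition extinction_time :: "(real \<Rightarrow> 'a \<Rightarrow> 'i \<Rightarrow> real) \<Rightarrow> 'a \<Rightarrow> ereal"
  where "extinction_time X \<omega> = Inf (ereal ` {t. 0 \<le> t \<and> (\<forall>i. X t \<omega> i = 0)})"

end

theory Submission
  imports Defs
begin

text \<open>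
  If \<open>X(i)\<close> vanishes on a time interval, then \<open>\<sigma>(X(i))\<close> does too, so the stochastic integral is
  constant there and the equation at \<open>i\<close> reduces to \<open>\<integral> \<Delta>X\<^sub>s(i) ds = 0\<close>. Hence \<open>X\<close> vanishes at the
  neighbours of \<open>i\<close> as well. A solution supported in a bounded set throughout a time interval would
  therefore be zero on it, which is impossible before \<open>\<eta>\<close>. So for each \<open>n\<close> the times at which some
  site at distance more than \<open>n\<close> is occupied form an open dense subset of \<open>[0, \<eta>]\<close>, and Baire's
  theorem applies to their intersection.

  Conversely, the total mass is a nonnegative supermartingale, so zero is absorbing and the support
  is empty after \<open>\<eta>\<close>. Since \<open>\<sigma>\<close> is unbounded, this needs a localization: the mass in a finite set of
  sites is stopped at the first point of a fixed time grid where the solution is large or too much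
  mass flows in. Only Ito integrals at the grid times enter, so that convergence in probability at
  fixed times suffices.
\<close>

section \<open>Elementary stochastic integrals\<close>

text \<open>\<open>ito_integral\<close> says only that integrals of some simple processes converge
  in probability at each fixed time. It offers neither an isometry for the limit nor stopping at
  random times, and the integrand has no known moments. Everything about the limit is therefore
  drawn from one device, \<open>ito_integral_step_approx\<close>: on an event \<open>A\<close> where
  the integrand is bounded, increments of the integral are limits in probability of centred
  variables \<open>Z n\<close> whose second moments are bounded on the whole space. Such variables
  exist because an elementary integral can be switched off just before its quadratic variation
  becomes too large, and this decision uses only what is known at the time. The event
  \<open>A\<close> may depend on the whole path. With bound 0 the device gives locality, and with a
  bound on the stopped solution it gives the supermartingale estimate. In the latter the limits come
  in a fixed order: approximants, grid, truncation level \<open>L\<close>, finite set of sites,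
  allowed inflow \<delta>.\<close>

lemma integrable_mult_bounded:
  fixes f g :: "'a \<Rightarrow> real"
  assumes "integrable M f" "g \<in> borel_measurable M" "\<And>\<omega>. \<omega> \<in> space M \<Longrightarrow> \<bar>g \<omega>\<bar> \<le> c"
  shows "integrable M (\<lambda>\<omega>. f \<omega> * g \<omega>)"
proof (rule Bochner_Integration.integrable_bound[of _ "\<lambda>\<omega>. c * f \<omega>"])
  show "AE \<omega> in M. norm (f \<omega> * g \<omega>) \<le> norm (c * f \<omega>)"
  proof (rule AE_I2)
    fix \<omega> assume "\<omega> \<in> space M"
    then have "\<bar>g \<omega>\<bar> \<le> \<bar>c\<bar>" using assms(3) by fastforce
    then show "norm (f \<omega> * g \<omega>) \<le> norm (c * f \<omega>)"
      by (simp add: abs_mult mult.commute[of "\<bar>c\<bar>"] mult_left_mono)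
  qed
qed (use assms in auto)

text \<open>Each step carries its own endpoints, unlike in \<open>simple_integral\<close>: the
  common refinement of two grids produces gaps and empty steps.\<close>

definition elementary_integral ::
  "nat \<Rightarrow> (nat \<Rightarrow> real) \<Rightarrow> (nat \<Rightarrow> real) \<Rightarrow> (nat \<Rightarrow> 'a \<Rightarrow> real) \<Rightarrow> (real \<Rightarrow> 'a \<Rightarrow> real) \<Rightarrow> 'a \<Rightarrow> real"
  where "elementary_integral N s e \<zeta> W \<omega> = (\<Sum>p<N. \<zeta> p \<omega> * (W (e p) \<omega> - W (s p) \<omega>))"

definition quadratic_variation ::
  "nat \<Rightarrow> (nat \<Rightarrow> real) \<Rightarrow> (nat \<Rightarrow> real) \<Rightarrow> (nat \<Rightarrow> 'a \<Rightarrow> real) \<Rightarrow> 'a \<Rightarrow> real"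
  where "quadratic_variation N s e \<zeta> \<omega> = (\<Sum>p<N. (\<zeta> p \<omega>)\<^sup>2 * (e p - s p))"

context filtered_prob_space
begin

lemma space_F: "0 \<le> t \<Longrightarrow> space (F t) = space M"
  using subalgebra_F by (simp add: subalgebra_def)

lemma sets_F_subset: "0 \<le> t \<Longrightarrow> A \<in> sets (F t) \<Longrightarrow> A \<in> sets M"
  using subalgebra_F by (auto simp: subalgebra_def)

lemma measurable_F_imp: "0 \<le> t \<Longrightarrow> f \<in> measurable (F t) N \<Longrightarrow> f \<in> measurable M N"
  using measurable_from_subalg[OF subalgebra_F] by blast

lemma measurable_F_mono:
  assumes "0 \<le> s" "s \<le> t" "f \<in> measurable (F s) N"
  shows "f \<in> measurable (F t) N"
proof -
  have "subalgebra (F t) (F s)"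
    using assms F_mono space_F by (simp add: subalgebra_def)
  then show ?thesis
    using assms(3) by (rule measurable_from_subalg)
qed

text \<open>\<open>Y\<close> is known at time \<open>s\<close> and the increment is independent of
  that sigma-algebra, so the expectations factor into those of \<open>Y\<close> and of a centred
  normal variable with variance \<open>t - s\<close>.\<close>

lemma brownian_increment_moments:
  assumes W: "brownian_motion M F W" and st: "0 \<le> s" "s \<le> t"
    and Y: "Y \<in> borel_measurable (F s)" "integrable M Y"
  shows "integrable M (\<lambda>\<omega>. Y \<omega> * (W t \<omega> - W s \<omega>))"
    and "expectation (\<lambda>\<omega>. Y \<omega> * (W t \<omega> - W s \<omega>)) = 0"
    and "integrable M (\<lambda>\<omega>. Y \<omega> * (W t \<omega> - W s \<omega>)\<^sup>2)"
    and "expectation (\<lambda>\<omega>. Y \<omega> * (W t \<omega> - W s \<omega>)\<^sup>2) = expectation Y * (t - s)"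
proof -
  let ?D = "\<lambda>\<omega>. W t \<omega> - W s \<omega>"
  have *: "integrable M (\<lambda>\<omega>. Y \<omega> * ?D \<omega>) \<and> expectation (\<lambda>\<omega>. Y \<omega> * ?D \<omega>) = 0 \<and>
     integrable M (\<lambda>\<omega>. Y \<omega> * (?D \<omega>)\<^sup>2) \<and>
     expectation (\<lambda>\<omega>. Y \<omega> * (?D \<omega>)\<^sup>2) = expectation Y * (t - s)"
  \<comment> \<open>\<open>brownian_motion\<close> describes increments for \<open>s < t\<close>
    only; for \<open>s = t\<close> the increment is identically 0.\<close>
  proof (cases "s = t")
    case False
    then have "s < t" using st by simp
    then have dist: "distributed M lborel ?D (normal_density 0 (sqrt (t - s)))"
      and ind: "indep_set (sets (F s)) {?D -` A \<inter> space M | A. A \<in> sets borel}"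
      using W st unfolding brownian_motion_def by auto
    have pos: "0 < sqrt (t - s)" using \<open>s < t\<close> by simp
    have D[measurable]: "?D \<in> borel_measurable M"
      using distributed_measurable[OF dist] by simp
    have Ym: "Y \<in> borel_measurable M"
      using Y(1) st(1) measurable_F_imp by blast
    have iv: "indep_var borel Y borel ?D"
      unfolding indep_var_eq
    proof (intro conjI indep_set_sigma_sets)
      \<comment> \<open>Preimages under \<open>Y\<close> lie in \<open>F s\<close>. As both families
        are closed under intersection, independence passes to the sigma-algebras they
        generate.\<close>
      show "indep_set {Y -` A \<inter> space M |A. A \<in> sets borel} {?D -` A \<inter> space M |A. A \<in> sets borel}"
        unfolding indep_sets2_eq
      proof (intro conjI ballI)
        show "{Y -` A \<inter> space M |A. A \<in> sets borel} \<subseteq> events" using Ym by auto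
        show "{?D -` A \<inter> space M |A. A \<in> sets borel} \<subseteq> events" using D by auto
        fix a b assume "a \<in> {Y -` A \<inter> space M |A. A \<in> sets borel}"
          and b: "b \<in> {?D -` A \<inter> space M |A. A \<in> sets borel}"
        then have "a \<in> sets (F s)"
          using Y(1) measurable_sets[OF Y(1)] space_F[OF st(1)] by auto
        then show "prob (a \<inter> b) = prob a * prob b"
          using indep_setD[OF ind _ b] by blast
      qed
      show "Int_stable {Y -` A \<inter> space M |A. A \<in> sets borel}"
        unfolding Int_stable_def
        by safe (metis sets.Int vimage_Int inf_sup_distrib1 inf.assoc inf.commute inf.idem inf.left_commute)
      show "Int_stable {?D -` A \<inter> space M |A. A \<in> sets borel}"
        unfolding Int_stable_def
        by safe (metis (no_types, lifting) sets.Int vimage_Int inf.assoc inf.commute inf.idem inf.left_commute)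
    qed (use Ym D in auto)
    have iv2: "indep_var borel Y borel (\<lambda>\<omega>. (?D \<omega>)\<^sup>2)"
      using indep_var_compose[OF iv, of id borel "\<lambda>x. x\<^sup>2" borel] by (simp add: comp_def id_def)
    have iD: "integrable M ?D"
      using distributed_integrable[OF dist, of "\<lambda>x. x"] integrable_normal_moment[OF pos, of 0 1]
      by simp
    have iD2: "integrable M (\<lambda>\<omega>. (?D \<omega>)\<^sup>2)"
      using distributed_integrable[OF dist, of "\<lambda>x. x\<^sup>2"] integrable_normal_moment[OF pos, of 0 2]
      by simp
    have ED: "expectation ?D = 0"
      by (rule normal_distributed_expectation[OF pos dist])
    have ED2: "expectation (\<lambda>\<omega>. (?D \<omega>)\<^sup>2) = t - s"
      using normal_distributed_variance[OF pos dist] ED \<open>s < t\<close> by simp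
    show ?thesis
      using indep_var_integrable[OF iv Y(2) iD] indep_var_lebesgue_integral[OF iv Y(2) iD]
        indep_var_integrable[OF iv2 Y(2) iD2] indep_var_lebesgue_integral[OF iv2 Y(2) iD2] ED ED2
      by simp
  qed simp
  from * show "integrable M (\<lambda>\<omega>. Y \<omega> * (W t \<omega> - W s \<omega>))"
    and "expectation (\<lambda>\<omega>. Y \<omega> * (W t \<omega> - W s \<omega>)) = 0"
    and "integrable M (\<lambda>\<omega>. Y \<omega> * (W t \<omega> - W s \<omega>)\<^sup>2)"
    and "expectation (\<lambda>\<omega>. Y \<omega> * (W t \<omega> - W s \<omega>)\<^sup>2) = expectation Y * (t - s)"
    by blast+
qed

text \<open>The last clause orders the steps in time, so that everything before a step is known at
  its start. Empty steps are allowed.\<close>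

definition elementary_integrand :: "nat \<Rightarrow> (nat \<Rightarrow> real) \<Rightarrow> (nat \<Rightarrow> real) \<Rightarrow> (nat \<Rightarrow> 'a \<Rightarrow> real) \<Rightarrow> bool"
  where "elementary_integrand N s e \<zeta> \<longleftrightarrow>
    (\<forall>p<N. 0 \<le> s p \<and> s p \<le> e p \<and> \<zeta> p \<in> borel_measurable (F (s p)) \<and>
      (\<exists>c. \<forall>\<omega>\<in>space M. \<bar>\<zeta> p \<omega>\<bar> \<le> c)) \<and>
    (\<forall>p q. p < q \<longrightarrow> q < N \<longrightarrow> e p \<le> s q)"

lemma elementary_integrandD:
  assumes "elementary_integrand N s e \<zeta>" "p < N"
  shows "0 \<le> s p" "s p \<le> e p" "\<zeta> p \<in> borel_measurable (F (s p))"
    "\<exists>c. \<forall>\<omega>\<in>space M. \<bar>\<zeta> p \<omega>\<bar> \<le> c"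
  using assms by (auto simp: elementary_integrand_def)

lemma elementary_integrand_le: "elementary_integrand N s e \<zeta> \<Longrightarrow> n \<le> N \<Longrightarrow> elementary_integrand n s e \<zeta>"
  by (auto simp: elementary_integrand_def)

lemma elementary_integral_measurable:
  assumes W: "brownian_motion M F W" and E: "elementary_integrand N s e \<zeta>"
    and r: "0 \<le> r" "\<And>p. p < N \<Longrightarrow> e p \<le> r"
  shows "elementary_integral N s e \<zeta> W \<in> borel_measurable (F r)"
  unfolding elementary_integral_def
proof (intro borel_measurable_sum borel_measurable_times borel_measurable_diff)
  fix p assume "p \<in> {..<N}"
  then have p: "p < N" "0 \<le> s p" "s p \<le> e p" "\<zeta> p \<in> borel_measurable (F (s p))" "e p \<le> r"
    using E r by (auto simp: elementary_integrand_def)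
  show "\<zeta> p \<in> borel_measurable (F r)" using p by (intro measurable_F_mono[OF _ _ p(4)]) auto
  have "adapted F W" using W by (simp add: brownian_motion_def)
  then have "W (e p) \<in> borel_measurable (F (e p))" "W (s p) \<in> borel_measurable (F (s p))"
    using p by (auto simp: adapted_def)
  then show "W (e p) \<in> borel_measurable (F r)" "W (s p) \<in> borel_measurable (F r)"
    using p by (auto intro: measurable_F_mono[rotated 2])
qed

text \<open>Ito isometry by induction on the number of steps: the earlier part and the last
  coefficient are known at \<open>s N\<close>, so their product with the last increment is centred
  and the cross term drops out.\<close>

lemma elementary_integral_moments:
  assumes W: "brownian_motion M F W"
  shows "elementary_integrand N s e \<zeta> \<Longrightarrow>
    integrable M (elementary_integral N s e \<zeta> W) \<and>
    expectation (elementary_integral N s e \<zeta> W) = 0 \<and>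
    integrable M (\<lambda>\<omega>. (elementary_integral N s e \<zeta> W \<omega>)\<^sup>2) \<and>
    integrable M (quadratic_variation N s e \<zeta>) \<and>
    expectation (\<lambda>\<omega>. (elementary_integral N s e \<zeta> W \<omega>)\<^sup>2) = expectation (quadratic_variation N s e \<zeta>)"
proof (induction N)
  case 0
  show ?case
    by (simp add: elementary_integral_def quadratic_variation_def)
next
  case (Suc N)
  let ?Z = "elementary_integral N s e \<zeta> W" and ?D = "\<lambda>\<omega>. W (e N) \<omega> - W (s N) \<omega>"
  have E: "elementary_integrand N s e \<zeta>" using Suc.prems elementary_integrand_le by (meson le_SucI order_refl)
  note IH = Suc.IH[OF E]
  have before: "\<And>p. p < N \<Longrightarrow> e p \<le> s N"
    using Suc.prems by (auto simp: elementary_integrand_def)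
  obtain c where N: "0 \<le> s N" "s N \<le> e N" "\<zeta> N \<in> borel_measurable (F (s N))"
      "\<And>\<omega>. \<omega> \<in> space M \<Longrightarrow> \<bar>\<zeta> N \<omega>\<bar> \<le> c"
    using elementary_integrandD[OF Suc.prems lessI] by metis
  have \<zeta>M: "\<zeta> N \<in> borel_measurable M" using N measurable_F_imp by blast
  have ZF: "?Z \<in> borel_measurable (F (s N))"
    by (rule elementary_integral_measurable[OF W E N(1) before])
  have i\<zeta>: "integrable M (\<zeta> N)"
    using integrable_mult_bounded[of M "\<lambda>_. 1", OF _ \<zeta>M N(4)] by simp
  have i\<zeta>2: "integrable M (\<lambda>\<omega>. (\<zeta> N \<omega>)\<^sup>2)"
    using integrable_mult_bounded[OF i\<zeta> \<zeta>M N(4)] by (simp add: power2_eq_square)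
  have iZ\<zeta>: "integrable M (\<lambda>\<omega>. ?Z \<omega> * \<zeta> N \<omega>)"
    using integrable_mult_bounded[of M ?Z, OF _ \<zeta>M N(4)] IH by blast
  note m1 = brownian_increment_moments[OF W N(1,2,3) i\<zeta>]
  have "(\<lambda>\<omega>. (\<zeta> N \<omega>)\<^sup>2) \<in> borel_measurable (F (s N))" using N(3) by measurable
  note m2 = brownian_increment_moments[OF W N(1,2) this i\<zeta>2]
  have "(\<lambda>\<omega>. ?Z \<omega> * \<zeta> N \<omega>) \<in> borel_measurable (F (s N))" using N(3) ZF by measurable
  note m3 = brownian_increment_moments[OF W N(1,2) this iZ\<zeta>]
  have Z_Suc: "elementary_integral (Suc N) s e \<zeta> W = (\<lambda>\<omega>. ?Z \<omega> + \<zeta> N \<omega> * ?D \<omega>)"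
    by (auto simp: elementary_integral_def)
  have Z2_Suc: "(\<lambda>\<omega>. (elementary_integral (Suc N) s e \<zeta> W \<omega>)\<^sup>2) =
      (\<lambda>\<omega>. (?Z \<omega>)\<^sup>2 + 2 * (?Z \<omega> * \<zeta> N \<omega> * ?D \<omega>) + (\<zeta> N \<omega>)\<^sup>2 * (?D \<omega>)\<^sup>2)"
    by (auto simp: Z_Suc power2_eq_square algebra_simps)
  have Q_Suc: "quadratic_variation (Suc N) s e \<zeta> =
      (\<lambda>\<omega>. quadratic_variation N s e \<zeta> \<omega> + (\<zeta> N \<omega>)\<^sup>2 * (e N - s N))"
    by (auto simp: quadratic_variation_def)
  show ?case
    unfolding Z2_Suc Q_Suc unfolding Z_Suc
    using IH m1 m2 m3 i\<zeta>2 by simp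
qed

text \<open>A step is dropped when the quadratic variation up to and including it exceeds \<kappa>.
  That number involves only coefficients known when the step starts, so the integrand stays adapted
  and no stopping time is needed. The second moment is then at most \<kappa>, and nothing changes
  wherever the original quadratic variation is within the level.\<close>

lemma elementary_integral_truncate:
  assumes W: "brownian_motion M F W" and E: "elementary_integrand N s e \<zeta>" and \<kappa>: "0 \<le> \<kappa>"
  shows "\<exists>Z. integrable M Z \<and> expectation Z = 0 \<and>
    integrable M (\<lambda>\<omega>. (Z \<omega>)\<^sup>2) \<and> expectation (\<lambda>\<omega>. (Z \<omega>)\<^sup>2) \<le> \<kappa> \<and>
    (\<forall>\<omega>. quadratic_variation N s e \<zeta> \<omega> \<le> \<kappa> \<longrightarrow> Z \<omega> = elementary_integral N s e \<zeta> W \<omega>)"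
proof -
  define q where "q p = quadratic_variation (Suc p) s e \<zeta>" for p
  define \<zeta>' where "\<zeta>' p \<omega> = (if q p \<omega> \<le> \<kappa> then \<zeta> p \<omega> else 0)" for p \<omega>
  have inc: "s p \<le> e p" if "p < N" for p using E that by (auto simp: elementary_integrand_def)
  have q_mono: "quadratic_variation n s e \<zeta> \<omega> \<le> quadratic_variation m s e \<zeta> \<omega>" if "n \<le> m" "m \<le> N" for n m \<omega>
    unfolding quadratic_variation_def using that inc
    by (intro sum_mono2) auto
  have E': "elementary_integrand N s e \<zeta>'"
    unfolding elementary_integrand_def
  proof (intro conjI allI impI)
    fix p assume p: "p < N"
    show "0 \<le> s p" "s p \<le> e p" using E p by (auto simp: elementary_integrand_def)
    have m: "\<zeta> k \<in> borel_measurable (F (s p))" if "k \<le> p" for k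
    proof -
      have k: "0 \<le> s k" "s k \<le> e k" "\<zeta> k \<in> borel_measurable (F (s k))"
        using E p that by (auto simp: elementary_integrand_def)
      moreover have "s k \<le> s p"
      proof (cases "k = p")
        case False
        then have "e k \<le> s p" using E p that by (auto simp: elementary_integrand_def)
        then show ?thesis using k by simp
      qed simp
      ultimately show ?thesis by (intro measurable_F_mono[OF _ _ k(3)])
    qed
    have "q p \<in> borel_measurable (F (s p))"
      unfolding q_def quadratic_variation_def
      by (intro borel_measurable_sum borel_measurable_times borel_measurable_power m) auto
    then show "\<zeta>' p \<in> borel_measurable (F (s p))"
      using m[of p] unfolding \<zeta>'_def by measurable
    obtain c where "\<And>\<omega>. \<omega> \<in> space M \<Longrightarrow> \<bar>\<zeta> p \<omega>\<bar> \<le> c"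
      using elementary_integrandD[OF E p] by metis
    then have "\<forall>\<omega>\<in>space M. \<bar>\<zeta>' p \<omega>\<bar> \<le> \<bar>c\<bar>" unfolding \<zeta>'_def by fastforce
    then show "\<exists>c. \<forall>\<omega>\<in>space M. \<bar>\<zeta>' p \<omega>\<bar> \<le> c" by blast
  next
    fix p r assume "p < r" "r < N"
    then show "e p \<le> s r" using E by (auto simp: elementary_integrand_def)
  qed
  \<comment> \<open>A kept step leaves a sum bounded by \<open>q n\<close>; a dropped step adds
    nothing.\<close>
  have Q'_le: "quadratic_variation n s e \<zeta>' \<omega> \<le> \<kappa>" if "n \<le> N" for n \<omega>
    using that
  proof (induction n)
    case 0 then show ?case using \<kappa> by (simp add: quadratic_variation_def)
  next
    case (Suc n)
    show ?case
    proof (cases "q n \<omega> \<le> \<kappa>")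
      case True
      have "quadratic_variation (Suc n) s e \<zeta>' \<omega> \<le> q n \<omega>"
        unfolding q_def quadratic_variation_def
        using Suc.prems inc by (intro sum_mono mult_right_mono) (auto simp: \<zeta>'_def)
      then show ?thesis using True by simp
    next
      case False
      then have "quadratic_variation (Suc n) s e \<zeta>' \<omega> = quadratic_variation n s e \<zeta>' \<omega>"
        by (simp add: quadratic_variation_def \<zeta>'_def)
      then show ?thesis using Suc by simp
    qed
  qed
  note mom = elementary_integral_moments[OF W E']
  show ?thesis
  proof (intro exI[of _ "elementary_integral N s e \<zeta>' W"] conjI allI impI)
    have "expectation (quadratic_variation N s e \<zeta>') \<le> expectation (\<lambda>_. \<kappa>)"
      using mom Q'_le by (intro integral_mono) auto
    then show "expectation (\<lambda>\<omega>. (elementary_integral N s e \<zeta>' W \<omega>)\<^sup>2) \<le> \<kappa>"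
      using mom by (simp add: prob_space)
    fix \<omega> assume "quadratic_variation N s e \<zeta> \<omega> \<le> \<kappa>"
    then have "q p \<omega> \<le> \<kappa>" if "p < N" for p
      unfolding q_def using q_mono[of "Suc p" N \<omega>] that by simp
    then show "elementary_integral N s e \<zeta>' W \<omega> = elementary_integral N s e \<zeta> W \<omega>"
      by (simp add: elementary_integral_def \<zeta>'_def)
  qed (use mom in auto)
qed

end

section \<open>Approximation of stopped Ito integrals\<close>

text \<open>Used to number the pairs of a cell \<open>j\<close> and a step \<open>k\<close> by
  \<open>p = j * n + k\<close>, the order in which the steps of a common refinement follow each
  other in time.\<close>

lemma sum_div_mod:
  fixes g :: "nat \<Rightarrow> nat \<Rightarrow> 'b::comm_monoid_add"
  shows "(\<Sum>p<m * n. g (p div n) (p mod n)) = (\<Sum>j<m. \<Sum>k<n. g j k)"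
proof -
  have "(\<Sum>p<m * n. g (p div n) (p mod n)) = (\<Sum>j<m. \<Sum>p = j * n..<j * n + n. g (p div n) (p mod n))"
    by (rule sum.nat_group[symmetric])
  also have "\<dots> = (\<Sum>j<m. \<Sum>k<n. g j k)"
  proof (rule sum.cong[OF refl])
    fix j
    have "(\<Sum>p = j * n..<j * n + n. g (p div n) (p mod n)) =
        (\<Sum>k = 0..<n. g ((k + j * n) div n) ((k + j * n) mod n))"
      using sum.shift_bounds_nat_ivl[of "\<lambda>p. g (p div n) (p mod n)" 0 "j * n" n]
      by (simp add: add.commute)
    also have "\<dots> = (\<Sum>k<n. g j k)"
      by (intro sum.cong) auto
    finally show "(\<Sum>p = j * n..<j * n + n. g (p div n) (p mod n)) = (\<Sum>k<n. g j k)" .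
  qed
  finally show ?thesis .
qed

lemma interval_mono:
  fixes \<tau> :: "nat \<Rightarrow> real"
  assumes "\<And>k. k < m \<Longrightarrow> \<tau> k \<le> \<tau> (Suc k)" "i \<le> j" "j \<le> m"
  shows "\<tau> i \<le> \<tau> j"
  using assms(2,3)
proof (induction j rule: dec_induct)
  case (step n)
  then show ?case using assms(1)[of n] by simp
qed simp

text \<open>The half-open intervals are disjoint, so at each \<open>u\<close> at most one term of
  the step function is nonzero. This is how an \<open>L\<^sup>2\<close> error in time controls a
  quadratic variation.\<close>

lemma elementary_square_bound:
  fixes h :: "real \<Rightarrow> real" and z :: "nat \<Rightarrow> real"
  assumes disj: "\<And>p q. p < q \<Longrightarrow> q < N \<Longrightarrow> e p \<le> s q"
    and se: "\<And>p. p < N \<Longrightarrow> s p \<le> e p"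
    and bd: "\<And>p u. p < N \<Longrightarrow> u \<in> {s p<..e p} \<Longrightarrow> ennreal ((z p)\<^sup>2) \<le> f u"
  shows "ennreal (\<Sum>p<N. (z p)\<^sup>2 * (e p - s p)) \<le> (\<integral>\<^sup>+u. f u \<partial>lborel)"
proof -
  have "ennreal (\<Sum>p<N. (z p)\<^sup>2 * (e p - s p)) = (\<Sum>p<N. \<integral>\<^sup>+u. ennreal ((z p)\<^sup>2) * indicator {s p<..e p} u \<partial>lborel)"
    using se by (subst sum_ennreal[symmetric]) (auto simp: nn_integral_cmult_indicator ennreal_mult intro!: sum.cong)
  also have "\<dots> = (\<integral>\<^sup>+u. (\<Sum>p<N. ennreal ((z p)\<^sup>2) * indicator {s p<..e p} u) \<partial>lborel)"
    by (rule nn_integral_sum[symmetric]) auto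
  also have "\<dots> \<le> (\<integral>\<^sup>+u. f u \<partial>lborel)"
  proof (rule nn_integral_mono)
    fix u
    show "(\<Sum>p<N. ennreal ((z p)\<^sup>2) * indicator {s p<..e p} u) \<le> f u"
    proof (cases "\<exists>p<N. u \<in> {s p<..e p}")
      case True
      then obtain p where p: "p < N" "u \<in> {s p<..e p}" by blast
      have "u \<notin> {s q<..e q}" if "q < N" "q \<noteq> p" for q
      proof (cases "q < p")
        case True
        then show ?thesis using disj[of q p] p by force
      next
        case False
        then show ?thesis using disj[of p q] p that by force
      qed
      then have "(\<Sum>q<N. ennreal ((z q)\<^sup>2) * indicator {s q<..e q} u) =
          (\<Sum>q<N. if q = p then ennreal ((z p)\<^sup>2) else 0)"
        using p by (intro sum.cong) (auto simp: indicator_def)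
      also have "\<dots> = ennreal ((z p)\<^sup>2)"
        using p by simp
      finally show ?thesis using bd[OF p] by (rule ord_eq_le_trans)
    qed (auto simp: sum.neutral)
  qed
  finally show ?thesis .
qed

context filtered_prob_space
begin

text \<open>Progressive measurability speaks of \<open>[0, T]\<close> only. Clamping time to this
  interval gives a function jointly measurable on the whole line, as Tonelli's theorem for Lebesgue
  measure requires.\<close>

lemma progressively_measurable_clamp:
  assumes "progressively_measurable F H" "0 \<le> T"
  shows "(\<lambda>(u, \<omega>). H (max 0 (min T u)) \<omega>) \<in> borel_measurable (borel \<Otimes>\<^sub>M M)"
proof -
  have H: "(\<lambda>(s, \<omega>). H s \<omega>) \<in> borel_measurable (restrict_space borel {0..T} \<Otimes>\<^sub>M F T)"
    using assms by (simp add: progressively_measurable_def)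
  have "(\<lambda>(u::real). max 0 (min T u)) \<in> measurable borel (restrict_space borel {0..T})"
    by (rule measurable_restrict_space2) (use assms in auto)
  moreover have "(\<lambda>\<omega>. \<omega>) \<in> measurable M (F T)"
    using measurable_F_imp[OF assms(2), of "\<lambda>\<omega>. \<omega>" "F T"] by simp
  ultimately have "(\<lambda>x. (max 0 (min T (fst x)), snd x)) \<in> measurable (borel \<Otimes>\<^sub>M M) (restrict_space borel {0..T} \<Otimes>\<^sub>M F T)"
    by (intro measurable_Pair measurable_compose[OF measurable_fst] measurable_compose[OF measurable_snd])
  from measurable_compose[OF this H] show ?thesis by (simp add: case_prod_unfold)
qed

text \<open>Both grids are cut along each other. Step \<open>p = j * n + k\<close> is the part of
  the \<open>k\<close>-th interval of the simple process inside the cell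
  \<open>{t j<..t (Suc j)}\<close>, and \<open>\<phi> j\<close> switches the whole cell. The last
  clause is what turns a bound on the integrand in active cells into a bound on the quadratic
  variation.\<close>

lemma simple_process_refinement:
  assumes sp: "simple_process F n \<tau> \<xi>" and W: "brownian_motion M F W"
    and t0: "0 \<le> t 0" and t: "\<And>j. j < m \<Longrightarrow> t j \<le> t (Suc j)"
    and \<phi>: "\<And>j. j < m \<Longrightarrow> \<phi> j \<in> borel_measurable (F (t j))"
      "\<And>j \<omega>. j < m \<Longrightarrow> \<phi> j \<omega> \<in> {0, 1::real}"
  shows "\<exists>N s e \<zeta>. elementary_integrand N s e \<zeta> \<and>
    (\<forall>\<omega>. elementary_integral N s e \<zeta> W \<omega> =
      (\<Sum>j<m. \<phi> j \<omega> * (simple_integral n \<tau> \<xi> W (t (Suc j)) \<omega> - simple_integral n \<tau> \<xi> W (t j) \<omega>))) \<and>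
    (\<forall>p<N. \<forall>u\<in>{s p<..e p}. \<forall>\<omega>. \<zeta> p \<omega> = 0 \<or>
      (\<exists>j<m. \<phi> j \<omega> = 1 \<and> u \<in> {t j<..t (Suc j)} \<and> \<zeta> p \<omega> = simple_value n \<tau> \<xi> u \<omega>))"
proof -
  define cl where "cl j x = max (t j) (min (t (Suc j)) x)" for j x
  define s where "s p = cl (p div n) (\<tau> (p mod n))" for p
  define e where "e p = cl (p div n) (\<tau> (Suc (p mod n)))" for p
  \<comment> \<open>If \<open>\<tau> k\<close> lies beyond the cell, the step is empty and starts at
    \<open>t (Suc j)\<close>, when \<open>\<xi> k\<close> need not be known yet; the coefficient 0
    keeps the integrand adapted.\<close>
  define \<zeta> where "\<zeta> p \<omega> = (if \<tau> (p mod n) \<le> s p then \<phi> (p div n) \<omega> * \<xi> (p mod n) \<omega> else 0)" for p \<omega>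
  have \<tau>: "\<tau> k \<le> \<tau> (Suc k)" "\<xi> k \<in> borel_measurable (F (\<tau> k))" "\<exists>c. \<forall>\<omega>\<in>space (F (\<tau> k)). \<bar>\<xi> k \<omega>\<bar> \<le> c"
    if "k < n" for k using sp that by (auto simp: simple_process_def)
  have \<tau>0: "0 \<le> \<tau> 0" using sp by (simp add: simple_process_def)
  have \<tau>_mono: "\<tau> i \<le> \<tau> j" if "i \<le> j" "j \<le> n" for i j
    using interval_mono[of n \<tau>] \<tau>(1) that by blast
  have \<tau>_nonneg: "0 \<le> \<tau> k" if "k \<le> n" for k using \<tau>_mono[of 0 k] \<tau>0 that by simp
  have t_mono: "t i \<le> t j" if "i \<le> j" "j \<le> m" for i j
    using interval_mono[of m t] t that by blast
  have t_nonneg: "0 \<le> t j" if "j \<le> m" for j using t_mono[of 0 j] t0 that by simp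
  have cl_mono: "cl j x \<le> cl j y" if "x \<le> y" for j x y using that by (auto simp: cl_def)
  have divmod: "p div n < m" "p mod n < n" if "p < m * n" for p
    using that by (auto simp: less_mult_imp_div_less) (metis mod_less_divisor mult_0_right not_gr_zero not_less_zero)
  have elem: "elementary_integrand (m * n) s e \<zeta>"
    unfolding elementary_integrand_def
  proof (intro conjI allI impI)
    fix p assume p: "p < m * n"
    define j k where "j = p div n" and "k = p mod n"
    have jk: "j < m" "k < n" using divmod[OF p] by (auto simp: j_def k_def)
    have sj: "t j \<le> s p" by (simp add: s_def cl_def j_def)
    then show "0 \<le> s p" using t_nonneg[of j] jk by simp
    show "s p \<le> e p" unfolding s_def e_def using \<tau>(1)[OF jk(2)] cl_mono by (simp add: k_def)
    have "\<phi> j \<in> borel_measurable (F (s p))"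
      using measurable_F_mono[OF _ sj \<phi>(1)] t_nonneg[of j] jk by simp
    moreover have "\<xi> k \<in> borel_measurable (F (s p))" if "\<tau> k \<le> s p"
      using measurable_F_mono[OF _ that \<tau>(2)] \<tau>_nonneg[of k] jk by simp
    ultimately show "\<zeta> p \<in> borel_measurable (F (s p))"
      unfolding \<zeta>_def by (cases "\<tau> k \<le> s p") (auto simp: j_def k_def)
    obtain c where c: "\<And>\<omega>. \<omega> \<in> space M \<Longrightarrow> \<bar>\<xi> k \<omega>\<bar> \<le> c"
      using \<tau>(3)[OF jk(2)] space_F[OF \<tau>_nonneg[of k]] jk by auto
    have "\<bar>\<zeta> p \<omega>\<bar> \<le> \<bar>c\<bar>" if "\<omega> \<in> space M" for \<omega>
      using c[OF that] \<phi>(2)[OF jk(1), of \<omega>] by (auto simp: \<zeta>_def j_def k_def)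
    then show "\<exists>c. \<forall>\<omega>\<in>space M. \<bar>\<zeta> p \<omega>\<bar> \<le> c" by blast
  next
    fix p q assume pq: "p < q" "q < m * n"
    note d = divmod[OF pq(2)] divmod[OF less_trans[OF pq]]
    show "e p \<le> s q"
    proof (cases "p div n = q div n")
      case True
      then have "p mod n < q mod n" using pq by (metis div_mult_mod_eq nat_add_left_cancel_less)
      then have "\<tau> (Suc (p mod n)) \<le> \<tau> (q mod n)" using d by (intro \<tau>_mono) auto
      then show ?thesis unfolding s_def e_def True by (rule cl_mono)
    next
      case False
      then have "p div n < q div n" using pq by (meson div_le_mono le_neq_implies_less less_imp_le)
      then have "t (Suc (p div n)) \<le> t (q div n)" using d by (intro t_mono) auto
      then show ?thesis using t[OF d(3)] by (auto simp: s_def e_def cl_def)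
    qed
  qed
  have int: "elementary_integral (m * n) s e \<zeta> W \<omega> =
      (\<Sum>j<m. \<phi> j \<omega> * (simple_integral n \<tau> \<xi> W (t (Suc j)) \<omega> - simple_integral n \<tau> \<xi> W (t j) \<omega>))" for \<omega>
  proof -
    have "elementary_integral (m * n) s e \<zeta> W \<omega> = (\<Sum>j<m. \<Sum>k<n.
        (if \<tau> k \<le> cl j (\<tau> k) then \<phi> j \<omega> * \<xi> k \<omega> else 0) * (W (cl j (\<tau> (Suc k))) \<omega> - W (cl j (\<tau> k)) \<omega>))"
      unfolding elementary_integral_def s_def e_def \<zeta>_def by (subst sum_div_mod[symmetric]) simp
    also have "\<dots> = (\<Sum>j<m. \<Sum>k<n. \<phi> j \<omega> * (\<xi> k \<omega> * (W (min (t (Suc j)) (\<tau> (Suc k))) \<omega> - W (min (t (Suc j)) (\<tau> k)) \<omega>)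
         - \<xi> k \<omega> * (W (min (t j) (\<tau> (Suc k))) \<omega> - W (min (t j) (\<tau> k)) \<omega>)))"
    proof (intro sum.cong refl)
      fix j k assume jk: "j \<in> {..<m}" "k \<in> {..<n}"
      \<comment> \<open>Clamping to a cell is stopping at its end minus stopping at its beginning,
        up to the constant \<open>W (t j) \<omega>\<close>, which cancels in increments.\<close>
      have cl_W: "W (cl j x) \<omega> = W (min (t (Suc j)) x) \<omega> - W (min (t j) x) \<omega> + W (t j) \<omega>" for x
        using t[of j] jk by (auto simp: cl_def min_def max_def)
      have z: "W (cl j (\<tau> (Suc k))) \<omega> - W (cl j (\<tau> k)) \<omega> = 0" if "\<not> \<tau> k \<le> cl j (\<tau> k)"
        using that t[of j] \<tau>(1)[of k] jk by (auto simp: cl_def min_def max_def)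
      have "(if \<tau> k \<le> cl j (\<tau> k) then \<phi> j \<omega> * \<xi> k \<omega> else 0) * (W (cl j (\<tau> (Suc k))) \<omega> - W (cl j (\<tau> k)) \<omega>)
         = \<phi> j \<omega> * \<xi> k \<omega> * (W (cl j (\<tau> (Suc k))) \<omega> - W (cl j (\<tau> k)) \<omega>)"
        using z by auto
      then show "(if \<tau> k \<le> cl j (\<tau> k) then \<phi> j \<omega> * \<xi> k \<omega> else 0) * (W (cl j (\<tau> (Suc k))) \<omega> - W (cl j (\<tau> k)) \<omega>)
         = \<phi> j \<omega> * (\<xi> k \<omega> * (W (min (t (Suc j)) (\<tau> (Suc k))) \<omega> - W (min (t (Suc j)) (\<tau> k)) \<omega>)
         - \<xi> k \<omega> * (W (min (t j) (\<tau> (Suc k))) \<omega> - W (min (t j) (\<tau> k)) \<omega>))"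
        unfolding cl_W by (simp add: algebra_simps)
    qed
    also have "\<dots> = (\<Sum>j<m. \<phi> j \<omega> * (simple_integral n \<tau> \<xi> W (t (Suc j)) \<omega> - simple_integral n \<tau> \<xi> W (t j) \<omega>))"
      by (simp add: simple_integral_def sum_distrib_left sum_subtractf right_diff_distrib)
    finally show ?thesis .
  qed
  have val: "\<zeta> p \<omega> = 0 \<or> (\<exists>j<m. \<phi> j \<omega> = 1 \<and> u \<in> {t j<..t (Suc j)} \<and> \<zeta> p \<omega> = simple_value n \<tau> \<xi> u \<omega>)"
    if p: "p < m * n" and u: "u \<in> {s p<..e p}" for p u \<omega>
  proof (cases "\<zeta> p \<omega> = 0")
    case False
    define j k where "j = p div n" and "k = p mod n"
    have jk: "j < m" "k < n" using divmod[OF p] by (auto simp: j_def k_def)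
    have \<phi>1: "\<phi> j \<omega> = 1" using False \<phi>(2)[OF jk(1), of \<omega>] by (auto simp: \<zeta>_def j_def split: if_splits)
    with False have z: "\<zeta> p \<omega> = \<xi> k \<omega>" by (auto simp: \<zeta>_def j_def k_def split: if_splits)
    have uj: "u \<in> {t j<..t (Suc j)}" "u \<in> {\<tau> k<..\<tau> (Suc k)}"
      using u t[OF jk(1)] unfolding s_def e_def cl_def j_def[symmetric] k_def[symmetric] by auto
    have "u \<notin> {\<tau> i<..\<tau> (Suc i)}" if "i < n" "i \<noteq> k" for i
      using \<tau>_mono[of "Suc i" k] \<tau>_mono[of "Suc k" i] that jk uj by (cases "i < k") auto
    then have "simple_value n \<tau> \<xi> u \<omega> = (\<Sum>i\<in>{k}. \<xi> i \<omega> * indicator {\<tau> i<..\<tau> (Suc i)} u)"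
      unfolding simple_value_def using jk by (intro sum.mono_neutral_right) (auto simp: indicator_def)
    also have "\<dots> = \<zeta> p \<omega>" using uj z by simp
    finally show ?thesis using jk \<phi>1 uj by auto
  qed simp
  from elem int val show ?thesis by blast
qed

text \<open>\<open>Z n\<close> is the truncated elementary integral of the \<open>n\<close>-th
  simple process, switched by \<phi>. On \<open>A\<close> its quadratic variation is within the
  truncation level as soon as the \<open>L\<^sup>2\<close> error is at most \<epsilon>, which fails
  with vanishing probability. Otherwise the truncation does nothing, and convergence of the simple
  integrals at the grid points finishes the proof. The moments are global although the integrand is
  bounded only on \<open>A\<close>, and \<open>A\<close> may look into the future.\<close>

lemma ito_integral_step_approx:
  assumes W: "brownian_motion M F W" and ito: "ito_integral M F W H I"
    and t0: "0 \<le> t 0" and t: "\<And>j. j < m \<Longrightarrow> t j \<le> t (Suc j)"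
    and \<phi>: "\<And>j. j < m \<Longrightarrow> \<phi> j \<in> borel_measurable (F (t j))"
      "\<And>j \<omega>. j < m \<Longrightarrow> \<phi> j \<omega> \<in> {0, 1::real}"
    and A: "A \<in> sets M" and K: "0 \<le> K"
      "\<And>\<omega> j u. \<omega> \<in> A \<Longrightarrow> j < m \<Longrightarrow> u \<in> {t j..t (Suc j)} \<Longrightarrow> \<phi> j \<omega> = 1 \<Longrightarrow> (H u \<omega>)\<^sup>2 \<le> K"
    and \<epsilon>: "0 < \<epsilon>"
  obtains Z where "\<And>n. integrable M (Z n)" "\<And>n. expectation (Z n) = 0"
    "\<And>n. integrable M (\<lambda>\<omega>. (Z n \<omega>)\<^sup>2)"
    "\<And>n. expectation (\<lambda>\<omega>. (Z n \<omega>)\<^sup>2) \<le> 2 * K * (t m - t 0) + 2 * \<epsilon>"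
    "\<And>r. 0 < r \<Longrightarrow> (\<lambda>n. prob (A \<inter> {\<omega> \<in> space M.
       r < \<bar>Z n \<omega> - (\<Sum>j<m. \<phi> j \<omega> * (I (t (Suc j)) \<omega> - I (t j) \<omega>))\<bar>})) \<longlonglongrightarrow> 0"
proof -
  define T where "T = t m"
  have t_mono: "t i \<le> t j" if "i \<le> j" "j \<le> m" for i j
    using interval_mono[of m t] t that by blast
  have T: "0 \<le> T" "t 0 \<le> T" using t_mono[of 0 m] t0 by (auto simp: T_def)
  have t_nonneg: "0 \<le> t j" if "j \<le> m" for j using t_mono[of 0 j] t0 that by simp
  have Hp: "progressively_measurable F H" and Im: "\<And>t. 0 \<le> t \<Longrightarrow> I t \<in> borel_measurable M"
    using ito by (auto simp: ito_integral_def)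
  from ito obtain N \<tau> \<xi> where sp: "\<And>n. simple_process F (N n) (\<tau> n) (\<xi> n)"
    and conv1: "\<And>t \<epsilon>. 0 \<le> t \<Longrightarrow> 0 < \<epsilon> \<Longrightarrow> (\<lambda>n. prob {\<omega> \<in> space M. ennreal \<epsilon> <
            (\<integral>\<^sup>+s\<in>{0..t}. ennreal ((simple_value (N n) (\<tau> n) (\<xi> n) s \<omega> - H s \<omega>)\<^sup>2) \<partial>lborel)}) \<longlonglongrightarrow> 0"
    and conv2: "\<And>t \<epsilon>. 0 \<le> t \<Longrightarrow> 0 < \<epsilon> \<Longrightarrow> (\<lambda>n. prob {\<omega> \<in> space M.
            \<epsilon> < \<bar>simple_integral (N n) (\<tau> n) (\<xi> n) W t \<omega> - I t \<omega>\<bar>}) \<longlonglongrightarrow> 0"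
    unfolding ito_integral_def by blast
  have \<tau>: "0 \<le> \<tau> n k" "\<xi> n k \<in> borel_measurable M" if "k < N n" for n k
  proof -
    have "0 \<le> \<tau> n 0" "\<And>k. k < N n \<Longrightarrow> \<tau> n k \<le> \<tau> n (Suc k)" using sp[of n] by (auto simp: simple_process_def)
    then show "0 \<le> \<tau> n k" using interval_mono[of "N n" "\<tau> n" 0 k] that by force
    then show "\<xi> n k \<in> borel_measurable M"
      using sp[of n] that measurable_F_imp by (auto simp: simple_process_def)
  qed
  have \<tau>S: "0 \<le> \<tau> n (Suc k)" if "k < N n" for n k
    using \<tau>(1)[OF that] sp[of n] that by (force simp: simple_process_def)
  let ?sv = "\<lambda>n. simple_value (N n) (\<tau> n) (\<xi> n)" and ?SI = "\<lambda>n. simple_integral (N n) (\<tau> n) (\<xi> n) W"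
  have WM: "W u \<in> borel_measurable M" if "0 \<le> u" for u
    using W that measurable_F_imp by (auto simp: brownian_motion_def adapted_def)
  have SIm: "?SI n u \<in> borel_measurable M" if "0 \<le> u" for n u
    unfolding simple_integral_def using that \<tau> \<tau>S
    by (intro borel_measurable_sum borel_measurable_times borel_measurable_diff WM) auto
  define g where "g n u \<omega> = ennreal ((?sv n u \<omega> - H u \<omega>)\<^sup>2) * indicator {0..T} u" for n u \<omega>
  have g_joint: "(\<lambda>(u, \<omega>). g n u \<omega>) \<in> borel_measurable (lborel \<Otimes>\<^sub>M M)" for n
  proof -
    have *: "(\<lambda>x. ?sv n (fst x) (snd x)) \<in> borel_measurable (borel \<Otimes>\<^sub>M M)"
      unfolding simple_value_def
      by (intro borel_measurable_sum borel_measurable_times measurable_compose[OF measurable_snd \<tau>(2)]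
          measurable_compose[OF measurable_fst borel_measurable_indicator]) auto
    have **: "(\<lambda>x. H (max 0 (min T (fst x))) (snd x)) \<in> borel_measurable (borel \<Otimes>\<^sub>M M)"
      using progressively_measurable_clamp[OF Hp T(1)] by (simp add: case_prod_unfold)
    have "(\<lambda>(u, \<omega>). ennreal ((?sv n u \<omega> - H (max 0 (min T u)) \<omega>)\<^sup>2) * indicator {0..T} u) \<in> borel_measurable (borel \<Otimes>\<^sub>M M)"
      unfolding case_prod_unfold
      by (intro borel_measurable_times_ennreal measurable_compose[OF _ measurable_ennreal]
          borel_measurable_power borel_measurable_diff
          measurable_compose[OF measurable_fst borel_measurable_indicator]) (use * ** in auto)
    \<comment> \<open>Inside \<open>{0..T}\<close> the clamp is the identity; outside, both sides
      vanish.\<close>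
    moreover have "(\<lambda>(u, \<omega>). ennreal ((?sv n u \<omega> - H (max 0 (min T u)) \<omega>)\<^sup>2) * indicator {0..T} u) = (\<lambda>(u, \<omega>). g n u \<omega>)"
      unfolding g_def by (auto simp: fun_eq_iff indicator_def)
    ultimately have "(\<lambda>(u, \<omega>). g n u \<omega>) \<in> borel_measurable (borel \<Otimes>\<^sub>M M)"
      by simp
    then show ?thesis
      using measurable_cong_sets[OF sets_pair_measure_cong[OF sets_lborel refl] refl] by blast
  qed
  have g_sec: "(\<lambda>u. g n u \<omega>) \<in> borel_measurable lborel" if "\<omega> \<in> space M" for n \<omega>
    using measurable_Pair_compose_split[OF g_joint measurable_ident measurable_const[OF that]] by simp
  have g_int: "(\<lambda>\<omega>. \<integral>\<^sup>+u. g n u \<omega> \<partial>lborel) \<in> borel_measurable M" for n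
  proof (rule lborel.borel_measurable_nn_integral)
    have "(\<lambda>x. (snd x, fst x)) \<in> measurable (M \<Otimes>\<^sub>M lborel) (lborel \<Otimes>\<^sub>M M)" by measurable
    from measurable_compose[OF this g_joint]
    show "(\<lambda>(\<omega>, u). g n u \<omega>) \<in> borel_measurable (M \<Otimes>\<^sub>M lborel)" by (simp add: case_prod_unfold)
  qed
  \<comment> \<open>The factors 2 come from
    \<open>a\<^sup>2 \<le> 2 * b\<^sup>2 + 2 * (a - b)\<^sup>2\<close>, where \<open>b\<close> is
    the integrand, bounded by \<open>K\<close> over a time \<open>T - t 0\<close>, and
    \<open>a - b\<close> is the error.\<close>
  define \<kappa> where "\<kappa> = 2 * K * (T - t 0) + 2 * \<epsilon>"
  have \<kappa>: "0 \<le> \<kappa>" using K T \<epsilon> by (simp add: \<kappa>_def)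
  define S where "S n \<omega> = (\<Sum>j<m. \<phi> j \<omega> * (?SI n (t (Suc j)) \<omega> - ?SI n (t j) \<omega>))" for n \<omega>
  have "\<exists>Z. integrable M Z \<and> expectation Z = 0 \<and> integrable M (\<lambda>\<omega>. (Z \<omega>)\<^sup>2) \<and>
    expectation (\<lambda>\<omega>. (Z \<omega>)\<^sup>2) \<le> \<kappa> \<and>
    (\<forall>\<omega>\<in>A. (\<integral>\<^sup>+u. g n u \<omega> \<partial>lborel) \<le> ennreal \<epsilon> \<longrightarrow> Z \<omega> = S n \<omega>)" for n
  proof -
    obtain P s e \<zeta> where el: "elementary_integrand P s e \<zeta>"
      and eq: "\<And>\<omega>. elementary_integral P s e \<zeta> W \<omega> = S n \<omega>"
      and val: "\<And>p u \<omega>. p < P \<Longrightarrow> u \<in> {s p<..e p} \<Longrightarrow>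
      \<zeta> p \<omega> = 0 \<or> (\<exists>j<m. \<phi> j \<omega> = 1 \<and> u \<in> {t j<..t (Suc j)} \<and> \<zeta> p \<omega> = ?sv n u \<omega>)"
      using simple_process_refinement[where t = t and m = m and \<phi> = \<phi>, OF sp[of n] W t0 t \<phi>, folded S_def]
      by blast
    obtain Z where Z: "integrable M Z" "expectation Z = 0"
      "integrable M (\<lambda>\<omega>. (Z \<omega>)\<^sup>2)" "expectation (\<lambda>\<omega>. (Z \<omega>)\<^sup>2) \<le> \<kappa>"
      "\<And>\<omega>. quadratic_variation P s e \<zeta> \<omega> \<le> \<kappa> \<Longrightarrow> Z \<omega> = elementary_integral P s e \<zeta> W \<omega>"
      using elementary_integral_truncate[OF W el \<kappa>] by blast
    have "Z \<omega> = S n \<omega>" if \<omega>: "\<omega> \<in> A" and small: "(\<integral>\<^sup>+u. g n u \<omega> \<partial>lborel) \<le> ennreal \<epsilon>" for \<omega>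
    proof -
      have \<omega>M: "\<omega> \<in> space M" using A \<omega> sets.sets_into_space by blast
      have "ennreal (quadratic_variation P s e \<zeta> \<omega>) \<le>
          (\<integral>\<^sup>+u. ennreal (2 * K) * indicator {t 0..T} u + 2 * g n u \<omega> \<partial>lborel)"
        unfolding quadratic_variation_def
      proof (rule elementary_square_bound)
        fix p u assume p: "p < P" and u: "u \<in> {s p<..e p}"
        show "ennreal ((\<zeta> p \<omega>)\<^sup>2) \<le> ennreal (2 * K) * indicator {t 0..T} u + 2 * g n u \<omega>"
        proof (cases "\<zeta> p \<omega> = 0")
          case False
          then obtain j where j: "j < m" "\<phi> j \<omega> = 1" "u \<in> {t j<..t (Suc j)}" "\<zeta> p \<omega> = ?sv n u \<omega>"
            using val[OF p u, of \<omega>] by auto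
          have uT: "u \<in> {t 0..T}" "u \<in> {0..T}"
            using j t_mono[of 0 j] t_mono[of "Suc j" m] t0 by (auto simp: T_def)
          \<comment> \<open>The right side exceeds the left by
            \<open>(?sv n u \<omega> - 2 * H u \<omega>)\<^sup>2\<close>.\<close>
          have "(\<zeta> p \<omega>)\<^sup>2 \<le> 2 * (H u \<omega>)\<^sup>2 + 2 * (?sv n u \<omega> - H u \<omega>)\<^sup>2"
            unfolding j(4) using sum_squares_ge_zero[of "?sv n u \<omega> - 2 * H u \<omega>" 0]
            by (simp add: power2_eq_square algebra_simps)
          also have "\<dots> \<le> 2 * K + 2 * (?sv n u \<omega> - H u \<omega>)\<^sup>2"
            using K(2)[OF \<omega> j(1) _ j(2), of u] j(3) by simp
          finally have "ennreal ((\<zeta> p \<omega>)\<^sup>2) \<le> ennreal (2 * K + 2 * (?sv n u \<omega> - H u \<omega>)\<^sup>2)"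
            by (rule ennreal_leI)
          also have "\<dots> = ennreal (2 * K) * indicator {t 0..T} u + 2 * g n u \<omega>"
            using uT K(1) by (simp add: g_def ennreal_plus ennreal_mult)
          finally show ?thesis .
        qed simp
      qed (use el in \<open>auto simp: elementary_integrand_def\<close>)
      also have "\<dots> = ennreal (2 * K * (T - t 0)) + 2 * (\<integral>\<^sup>+u. g n u \<omega> \<partial>lborel)"
        using g_sec[OF \<omega>M, of n] T K
        by (simp add: nn_integral_add nn_integral_cmult nn_integral_cmult_indicator ennreal_mult)
      also have "\<dots> \<le> ennreal (2 * K * (T - t 0)) + 2 * ennreal \<epsilon>"
        using small by (intro add_left_mono mult_left_mono) auto
      also have "\<dots> = ennreal \<kappa>"
        using K T \<epsilon> by (simp add: \<kappa>_def ennreal_plus ennreal_mult)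
      finally show ?thesis using Z(5) eq \<kappa> by simp
    qed
    then show ?thesis using Z by blast
  qed
  then obtain Z where Z: "\<And>n. integrable M (Z n)" "\<And>n. expectation (Z n) = 0"
    "\<And>n. integrable M (\<lambda>\<omega>. (Z n \<omega>)\<^sup>2)" "\<And>n. expectation (\<lambda>\<omega>. (Z n \<omega>)\<^sup>2) \<le> \<kappa>"
    and ZS: "\<And>n \<omega>. \<omega> \<in> A \<Longrightarrow> (\<integral>\<^sup>+u. g n u \<omega> \<partial>lborel) \<le> ennreal \<epsilon> \<Longrightarrow> Z n \<omega> = S n \<omega>"
    by metis
  show thesis
  proof (rule that[of Z])
    fix r :: real assume r: "0 < r"
    \<comment> \<open>Each of the \<open>m\<close> cells has an error at both ends, hence
      \<open>2 * m\<close>; the added 1 covers \<open>m = 0\<close>.\<close>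
    define r' where "r' = r / (2 * m + 1)"
    have r': "0 < r'" "2 * m * r' \<le> r" using r by (auto simp: r'_def field_simps)
    let ?G = "\<lambda>n. {\<omega> \<in> space M. ennreal \<epsilon> < (\<integral>\<^sup>+u. g n u \<omega> \<partial>lborel)}"
    let ?D = "\<lambda>n j. {\<omega> \<in> space M. r' < \<bar>?SI n (t j) \<omega> - I (t j) \<omega>\<bar>}"
    let ?E = "\<lambda>n. A \<inter> {\<omega> \<in> space M. r < \<bar>Z n \<omega> - (\<Sum>j<m. \<phi> j \<omega> * (I (t (Suc j)) \<omega> - I (t j) \<omega>))\<bar>}"
    have Gm: "?G n \<in> sets M" for n using g_int[of n] by measurable
    have Dm: "?D n j \<in> sets M" if "j \<le> m" for n j
    proof -
      have [measurable]: "?SI n (t j) \<in> borel_measurable M" "I (t j) \<in> borel_measurable M"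
        using SIm Im t_nonneg[OF that] by auto
      show ?thesis by measurable
    qed
    \<comment> \<open>A deviation above \<open>r\<close> needs either a large
      \<open>L\<^sup>2\<close> error or an error above \<open>r'\<close> at one of the grid
      points.\<close>
    have sub: "?E n \<subseteq> ?G n \<union> (\<Union>j\<in>{..m}. ?D n j)" for n
    proof (rule subsetI, rule ccontr)
      fix \<omega> assume \<omega>: "\<omega> \<in> ?E n" and no: "\<omega> \<notin> ?G n \<union> (\<Union>j\<in>{..m}. ?D n j)"
      then have "Z n \<omega> = S n \<omega>" using ZS[of \<omega> n] by auto
      have near: "\<bar>?SI n (t j) \<omega> - I (t j) \<omega>\<bar> \<le> r'" if "j \<le> m" for j
        using \<omega> no that by (auto simp: not_less)
      have "\<bar>Z n \<omega> - (\<Sum>j<m. \<phi> j \<omega> * (I (t (Suc j)) \<omega> - I (t j) \<omega>))\<bar> =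
         \<bar>\<Sum>j<m. \<phi> j \<omega> * ((?SI n (t (Suc j)) \<omega> - I (t (Suc j)) \<omega>) - (?SI n (t j) \<omega> - I (t j) \<omega>))\<bar>"
        unfolding \<open>Z n \<omega> = S n \<omega>\<close> S_def by (subst sum_subtractf[symmetric]) (simp add: algebra_simps)
      also have "\<dots> \<le> (\<Sum>j<m. \<bar>\<phi> j \<omega> * ((?SI n (t (Suc j)) \<omega> - I (t (Suc j)) \<omega>) - (?SI n (t j) \<omega> - I (t j) \<omega>))\<bar>)"
        by (rule sum_abs)
      also have "\<dots> \<le> (\<Sum>j<m. 2 * r')"
      proof (rule sum_mono)
        fix j assume "j \<in> {..<m}"
        then show "\<bar>\<phi> j \<omega> * ((?SI n (t (Suc j)) \<omega> - I (t (Suc j)) \<omega>) - (?SI n (t j) \<omega> - I (t j) \<omega>))\<bar> \<le> 2 * r'"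
          using near[of j] near[of "Suc j"] \<phi>(2)[of j \<omega>] r' by auto
      qed
      also have "\<dots> \<le> r" using r' by (simp add: mult.commute mult.left_commute)
      finally show False using \<omega> by auto
    qed
    have le: "prob (?E n) \<le> prob (?G n) + (\<Sum>j\<in>{..m}. prob (?D n j))" for n
    proof -
      have "prob (?E n) \<le> prob (?G n \<union> (\<Union>j\<in>{..m}. ?D n j))"
        using sub Gm Dm by (intro finite_measure_mono) (auto intro!: sets.Un sets.finite_UN)
      also have "\<dots> \<le> prob (?G n) + prob (\<Union>j\<in>{..m}. ?D n j)"
        using Gm Dm by (intro measure_Un_le) (auto intro!: sets.finite_UN)
      also have "\<dots> \<le> prob (?G n) + (\<Sum>j\<in>{..m}. prob (?D n j))"
        using Dm by (intro add_left_mono finite_measure_subadditive_finite) auto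
      finally show ?thesis .
    qed
    have "(\<lambda>n. prob (?G n) + (\<Sum>j\<in>{..m}. prob (?D n j))) \<longlonglongrightarrow> 0 + (\<Sum>j\<in>{..m}. 0)"
      using conv1[OF T(1) \<epsilon>] conv2[OF t_nonneg r'(1)] unfolding g_def
      by (intro tendsto_add tendsto_sum) auto
    then have "(\<lambda>n. prob (?G n) + (\<Sum>j\<in>{..m}. prob (?D n j))) \<longlonglongrightarrow> 0" by simp
    then show "(\<lambda>n. prob (?E n)) \<longlonglongrightarrow> 0"
      by (rule tendsto_sandwich[OF always_eventually always_eventually tendsto_const, rotated 2]) (use le in auto)
  qed (use Z in \<open>auto simp: \<kappa>_def T_def\<close>)
qed

end

section \<open>Locality\<close>

text \<open>A strict excess at \<open>u\<close> persists on a neighbourhood, and this meets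
  \<open>{a..b}\<close> in a rational since \<open>a < b\<close>; a single irrational point would
  contain none.\<close>

lemma continuous_le_if_rationals_le:
  fixes g :: "real \<Rightarrow> real"
  assumes "a < b" and g: "continuous_on {a..b} g"
    and le: "\<And>u. u \<in> \<rat> \<Longrightarrow> u \<in> {a..b} \<Longrightarrow> g u \<le> c" and u: "u \<in> {a..b}"
  shows "g u \<le> c"
proof (rule ccontr)
  assume "\<not> g u \<le> c"
  then obtain d where d: "0 < d" "\<And>v. v \<in> {a..b} \<Longrightarrow> dist v u < d \<Longrightarrow> dist (g v) (g u) < g u - c"
    using g u unfolding continuous_on_iff by (meson diff_gt_0_iff_gt not_le)
  have "max a (u - d) < min b (u + d)" using \<open>a < b\<close> u d by auto
  then obtain v where v: "v \<in> \<rat>" "max a (u - d) < v" "v < min b (u + d)"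
    using Rats_dense_in_real by blast
  then have "v \<in> {a..b}" "dist v u < d" by (auto simp: dist_real_def)
  then show False using d(2) le[OF v(1)] by (fastforce simp: dist_real_def)
qed

context filtered_prob_space
begin

text \<open>Continuity reduces the uncountable intersection over times to the rationals. It is asked
  at every point of the space, since \<open>M\<close> need not be complete.\<close>

lemma sets_path_bounded:
  assumes ab: "0 \<le> a" "a < b"
    and g: "\<And>u::real. a \<le> u \<Longrightarrow> u \<le> b \<Longrightarrow> g u \<in> borel_measurable M"
    and cont: "\<And>\<omega>. \<omega> \<in> space M \<Longrightarrow> continuous_on {a..b} (\<lambda>u. g u \<omega>)"
  shows "{\<omega> \<in> space M. \<forall>u\<in>{a..b}. g u \<omega> \<le> (c::real)} \<in> sets M"
proof -
  have "{\<omega> \<in> space M. \<forall>u\<in>{a..b}. g u \<omega> \<le> c} = {\<omega> \<in> space M. \<forall>u\<in>\<rat> \<inter> {a..b}. g u \<omega> \<le> c}"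
    using continuous_le_if_rationals_le[OF ab(2) cont] by blast
  also have "\<dots> = (\<Inter>u\<in>\<rat> \<inter> {a..b}. {\<omega> \<in> space M. g u \<omega> \<le> c}) \<inter> space M" by auto
  also have "\<dots> \<in> sets M"
  proof (cases "\<rat> \<inter> {a..b} = {}")
    case False
    then show ?thesis
      using g countable_rat by (intro sets.Int sets.countable_INT') auto
  qed simp
  finally show ?thesis .
qed

lemma prob_diff_tendsto_0:
  assumes E: "E \<in> events" and B: "\<And>n. B n \<in> events"
    and ev: "AE \<omega> in M. \<omega> \<in> E \<longrightarrow> (\<forall>\<^sub>F n in sequentially. \<omega> \<in> B n)"
  shows "(\<lambda>n. prob (E - B n)) \<longlonglongrightarrow> 0"
proof -
  have "(\<lambda>n. integral\<^sup>L M (indicator (E - B n) :: 'a \<Rightarrow> real)) \<longlonglongrightarrow> integral\<^sup>L M (\<lambda>_. 0)"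
  proof (rule integral_dominated_convergence[where w = "\<lambda>_. 1"])
    show "AE \<omega> in M. (\<lambda>n. indicator (E - B n) \<omega> :: real) \<longlonglongrightarrow> 0"
      using ev
    proof eventually_elim
      case (elim \<omega>)
      have "\<forall>\<^sub>F n in sequentially. indicator (E - B n) \<omega> = (0::real)"
      proof (cases "\<omega> \<in> E")
        case True
        with elim have "\<forall>\<^sub>F n in sequentially. \<omega> \<in> B n" by blast
        then show ?thesis by eventually_elim auto
      qed auto
      then show ?case by (rule tendsto_eventually)
    qed
    show "\<And>n. AE \<omega> in M. norm (indicator (E - B n) \<omega> :: real) \<le> 1"
      by (auto simp: indicator_def)
  qed (use E B in auto)
  then show ?thesis using E B by simp
qed

text \<open>With \<open>K = 0\<close> on a single cell, \<open>ito_integral_step_approx\<close>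
  gives second moments at most \<open>2 * \<epsilon>\<close> for any \<epsilon>, so Chebyshev's
  inequality forces the increment to be 0 on \<open>A\<close>. Later \<open>A\<close> is a condition
  on the path over the whole interval, known only at time \<open>b\<close>.\<close>

lemma ito_integral_locality:
  assumes W: "brownian_motion M F W" and ito: "ito_integral M F W H I"
    and ab: "0 \<le> a" "a \<le> b" and A: "A \<in> events"
    and zero: "\<And>\<omega> u. \<omega> \<in> A \<Longrightarrow> u \<in> {a..b} \<Longrightarrow> H u \<omega> = 0"
  shows "AE \<omega> in M. \<omega> \<in> A \<longrightarrow> I b \<omega> = I a \<omega>"
proof -
  have Im[measurable]: "I a \<in> borel_measurable M" "I b \<in> borel_measurable M"
    using ito ab by (auto simp: ito_integral_def)
  let ?D = "\<lambda>\<omega>. I b \<omega> - I a \<omega>"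
  have small: "prob (A \<inter> {\<omega> \<in> space M. 2 * r < \<bar>?D \<omega>\<bar>}) = 0" if r: "0 < r" for r
  proof -
    have le: "prob (A \<inter> {\<omega> \<in> space M. 2 * r < \<bar>?D \<omega>\<bar>}) \<le> 2 * \<epsilon> / r\<^sup>2" if \<epsilon>: "0 < \<epsilon>" for \<epsilon>
    proof -
      define t where "t j = (if j = 0 then a else b)" for j :: nat
      obtain Z where Z: "\<And>n. integrable M (Z n)" "\<And>n. expectation (Z n) = 0"
        "\<And>n. integrable M (\<lambda>\<omega>. (Z n \<omega>)\<^sup>2)"
        "\<And>n. expectation (\<lambda>\<omega>. (Z n \<omega>)\<^sup>2) \<le> 2 * 0 * (t 1 - t 0) + 2 * \<epsilon>"
        "\<And>r. 0 < r \<Longrightarrow> (\<lambda>n. prob (A \<inter> {\<omega> \<in> space M.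
           r < \<bar>Z n \<omega> - (\<Sum>j<1. 1 * (I (t (Suc j)) \<omega> - I (t j) \<omega>))\<bar>})) \<longlonglongrightarrow> 0"
        by (rule ito_integral_step_approx[OF W ito, where t = t and m = 1 and \<phi> = "\<lambda>_ _. 1" and A = A and K = 0 and \<epsilon> = \<epsilon>])
          (use ab A zero \<epsilon> in \<open>auto simp: t_def\<close>)
      let ?p = "\<lambda>n. prob (A \<inter> {\<omega> \<in> space M. r < \<bar>Z n \<omega> - ?D \<omega>\<bar>})"
      have lim: "?p \<longlonglongrightarrow> 0"
        using Z(5)[OF r] by (simp add: t_def)
      have "prob (A \<inter> {\<omega> \<in> space M. 2 * r < \<bar>?D \<omega>\<bar>}) \<le> ?p n + 2 * \<epsilon> / r\<^sup>2" for n
      proof -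
        have [measurable]: "Z n \<in> borel_measurable M" using Z(1) by blast
        \<comment> \<open>If \<open>?D\<close> exceeds \<open>2 * r\<close> in size, either
          \<open>Z n\<close> misses it by more than \<open>r\<close> or \<open>Z n\<close> itself
          has size at least \<open>r\<close>.\<close>
        have "prob (A \<inter> {\<omega> \<in> space M. 2 * r < \<bar>?D \<omega>\<bar>}) \<le>
            prob ((A \<inter> {\<omega> \<in> space M. r < \<bar>Z n \<omega> - ?D \<omega>\<bar>}) \<union> {\<omega> \<in> space M. r \<le> \<bar>Z n \<omega>\<bar>})"
          using A by (intro finite_measure_mono) auto
        also have "\<dots> \<le> ?p n + prob {\<omega> \<in> space M. r \<le> \<bar>Z n \<omega>\<bar>}"
          using A by (intro measure_Un_le) auto
        also have "prob {\<omega> \<in> space M. r \<le> \<bar>Z n \<omega>\<bar>} \<le> expectation (\<lambda>\<omega>. (Z n \<omega>)\<^sup>2) / r\<^sup>2"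
          using second_moment_method[OF _ Z(3) r] by simp
        also have "\<dots> \<le> 2 * \<epsilon> / r\<^sup>2"
          using Z(4)[of n] by (intro divide_right_mono) auto
        finally show ?thesis by simp
      qed
      then show ?thesis
        using tendsto_add[OF lim tendsto_const[of "2 * \<epsilon> / r\<^sup>2"]]
        by (intro LIMSEQ_le_const[of "\<lambda>n. ?p n + 2 * \<epsilon> / r\<^sup>2"]) auto
    qed
    have "prob (A \<inter> {\<omega> \<in> space M. 2 * r < \<bar>?D \<omega>\<bar>}) \<le> 0"
    proof (rule field_le_epsilon)
      fix e :: real assume "0 < e"
      then show "prob (A \<inter> {\<omega> \<in> space M. 2 * r < \<bar>?D \<omega>\<bar>}) \<le> 0 + e"
        using le[of "e * r\<^sup>2 / 2"] r by simp
    qed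
    then show ?thesis using measure_nonneg[of M] by (intro antisym) auto
  qed
  have "AE \<omega> in M. \<forall>k. \<omega> \<notin> A \<inter> {\<omega> \<in> space M. 2 * inverse (real (Suc k)) < \<bar>?D \<omega>\<bar>}"
    unfolding AE_all_countable
  proof
    fix k
    have "A \<inter> {\<omega> \<in> space M. 2 * inverse (real (Suc k)) < \<bar>?D \<omega>\<bar>} \<in> null_sets M"
      using small[of "inverse (real (Suc k))"] A by (intro null_setsI) (auto simp: emeasure_eq_measure)
    then show "AE \<omega> in M. \<omega> \<notin> A \<inter> {\<omega> \<in> space M. 2 * inverse (real (Suc k)) < \<bar>?D \<omega>\<bar>}"
      by (rule AE_not_in)
  qed
  then show ?thesis
  proof (rule AE_mp, intro AE_I2 impI)
    fix \<omega> assume \<omega>: "\<omega> \<in> space M" "\<omega> \<in> A"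
      and *: "\<forall>k. \<omega> \<notin> A \<inter> {\<omega> \<in> space M. 2 * inverse (real (Suc k)) < \<bar>?D \<omega>\<bar>}"
    show "I b \<omega> = I a \<omega>"
    proof (rule ccontr)
      assume "I b \<omega> \<noteq> I a \<omega>"
      then have "0 < \<bar>?D \<omega>\<bar> / 2" by simp
      then obtain k where "inverse (real (Suc k)) < \<bar>?D \<omega>\<bar> / 2" using reals_Archimedean by blast
      then have "2 * inverse (real (Suc k)) < \<bar>?D \<omega>\<bar>" by (metis less_divide_eq_numeral1(1) mult.commute)
      then show False using * \<omega> by blast
    qed
  qed
qed

end

section \<open>Stopped sums of Ito integrals\<close>

text \<open>\<open>f\<close> is the indicator of not having stopped, so the sum telescopes to the
  value of \<open>Y\<close> at the first index where \<open>f\<close> is 0, or at \<open>n\<close>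
  if that comes earlier.\<close>

lemma stopped_sum_nonneg:
  fixes Y :: "nat \<Rightarrow> real"
  assumes "\<And>k. 0 \<le> Y k" and "\<And>k. f k \<in> {0, 1}" and "\<And>k. f k = 0 \<Longrightarrow> f (Suc k) = 0"
  shows "0 \<le> Y 0 + (\<Sum>k<n. f k * (Y (Suc k) - Y k))"
    and "f n = 1 \<Longrightarrow> Y 0 + (\<Sum>k<n. f k * (Y (Suc k) - Y k)) = Y n"
proof -
  have *: "0 \<le> Y 0 + (\<Sum>k<n. f k * (Y (Suc k) - Y k)) \<and>
    (f n = 1 \<longrightarrow> Y 0 + (\<Sum>k<n. f k * (Y (Suc k) - Y k)) = Y n)"
  proof (induction n)
    case 0
    then show ?case using assms(1) by simp
  next
    case (Suc n)
    show ?case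
    proof (cases "f n = 1")
      case True
      with Suc have "Y 0 + (\<Sum>k<Suc n. f k * (Y (Suc k) - Y k)) = Y (Suc n)" by simp
      then show ?thesis using assms(1) by simp
    next
      case False
      then have "f n = 0" using assms(2)[of n] by auto
      then show ?thesis using Suc assms(3)[of n] by auto
    qed
  qed
  then show "0 \<le> Y 0 + (\<Sum>k<n. f k * (Y (Suc k) - Y k))"
    and "f n = 1 \<Longrightarrow> Y 0 + (\<Sum>k<n. f k * (Y (Suc k) - Y k)) = Y n" by auto
qed

context filtered_prob_space
begin

text \<open>The clamped value of \<open>z\<close> is at most \<open>z + z\<^sup>2 / L\<close>, so bounded second moments take the place of
  uniform integrability.\<close>

lemma expectation_clamp_limit_le:
  assumes A: "A \<in> events" and D: "D \<in> borel_measurable M"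
    and Z: "\<And>n. integrable M (Z n)" "\<And>n. expectation (Z n) = 0"
      "\<And>n. integrable M (\<lambda>\<omega>. (Z n \<omega>)\<^sup>2)" "\<And>n. expectation (\<lambda>\<omega>. (Z n \<omega>)\<^sup>2) \<le> \<kappa>"
    and lim: "\<And>r. 0 < r \<Longrightarrow> (\<lambda>n. prob (A \<inter> {\<omega> \<in> space M. r < \<bar>Z n \<omega> - D \<omega>\<bar>})) \<longlonglongrightarrow> 0"
    and L: "0 < L" "0 \<le> l"
  shows "expectation (\<lambda>\<omega>. indicator A \<omega> * max (- L) (min l (D \<omega>))) \<le> \<kappa> / L + L * prob (space M - A)"
proof (rule field_le_epsilon)
  fix r :: real assume r: "0 < r"
  note [measurable] = A D
  let ?E = "\<lambda>n. A \<inter> {\<omega> \<in> space M. r < \<bar>Z n \<omega> - D \<omega>\<bar>}"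
  let ?g = "\<lambda>z. max (- L) (min l z)"
  have bound: "expectation (\<lambda>\<omega>. indicator A \<omega> * ?g (D \<omega>)) \<le>
      \<kappa> / L + L * prob (space M - A) + r + (L + l) * prob (?E n)" for n
  proof -
    have [measurable]: "Z n \<in> borel_measurable M" using Z(1) by blast
    \<comment> \<open>The terms in turn: the bound for the clamp of \<open>Z n\<close>; a
      compensation off \<open>A\<close>, where that bound is still at least \<open>- L\<close>; the
      loss \<open>r\<close> when \<open>Z n\<close> is close to \<open>D\<close>, the clamp being
      1-Lipschitz; the width \<open>L + l\<close> of the range of the clamp when it is not.\<close>
    let ?R = "\<lambda>\<omega>. Z n \<omega> + (Z n \<omega>)\<^sup>2 / L + L * indicator (space M - A) \<omega> + r + (L + l) * indicator (?E n) \<omega>"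
    have ind: "integrable M (indicator (space M - A) :: 'a \<Rightarrow> real)" "integrable M (indicator (?E n) :: 'a \<Rightarrow> real)"
      by (intro integrable_real_indicator; simp add: emeasure_eq_measure)+
    have iR: "integrable M ?R"
      using Z ind by (intro Bochner_Integration.integrable_add integrable_mult_right) auto
    have "expectation (\<lambda>\<omega>. indicator A \<omega> * ?g (D \<omega>)) \<le> expectation ?R"
    proof (rule integral_mono)
      show "integrable M (\<lambda>\<omega>. indicator A \<omega> * ?g (D \<omega>))"
      proof (rule integrable_const_bound[where B = "L + l"])
        show "AE \<omega> in M. norm (indicator A \<omega> * ?g (D \<omega>)) \<le> L + l"
          using L by (auto simp: indicator_def)
      qed measurable
      show "integrable M ?R" by (rule iR)
      fix \<omega> assume \<omega>: "\<omega> \<in> space M"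
      let ?z = "Z n \<omega>"
      have sq: "- L \<le> ?z + ?z\<^sup>2 / L" "?g ?z \<le> ?z + ?z\<^sup>2 / L"
      proof -
        \<comment> \<open>Completing the square proves the claim
          \<open>- L \<le> ?z + ?z\<^sup>2 / L\<close> after multiplication by
          \<open>L\<close>.\<close>
        have "?z\<^sup>2 + ?z * L + L\<^sup>2 = (?z + L / 2)\<^sup>2 + 3 * L\<^sup>2 / 4"
          by (simp add: power2_eq_square field_simps)
        then have "0 \<le> ?z\<^sup>2 + ?z * L + L\<^sup>2" by simp
        then have "0 \<le> (?z\<^sup>2 + ?z * L + L\<^sup>2) / L" using L by simp
        then show 1: "- L \<le> ?z + ?z\<^sup>2 / L" using L by (simp add: power2_eq_square field_simps)
        have "0 \<le> ?z\<^sup>2 / L" using L by simp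
        then show "?g ?z \<le> ?z + ?z\<^sup>2 / L" using 1 by linarith
      qed
      show "indicator A \<omega> * ?g (D \<omega>) \<le> ?R \<omega>"
      proof (cases "\<omega> \<in> A")
        case False
        then show ?thesis using \<omega> sq r L by (auto simp: indicator_def)
      next
        case inA: True
        show ?thesis
        proof (cases "\<bar>?z - D \<omega>\<bar> \<le> r")
          case True
          then have "?g (D \<omega>) \<le> ?g ?z + r" by linarith
          then show ?thesis using inA sq(2) True by (auto simp: indicator_def)
        next
          case False
          moreover have "?g (D \<omega>) \<le> ?g ?z + (L + l)" using L by linarith
          ultimately show ?thesis using inA \<omega> sq(2) r by (auto simp: indicator_def)
        qed
      qed
    qed
    also have "\<dots> = expectation (Z n) + expectation (\<lambda>\<omega>. (Z n \<omega>)\<^sup>2) / L + L * prob (space M - A) + r + (L + l) * prob (?E n)"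
      using Z ind by (simp add: prob_space)
    also have "\<dots> \<le> \<kappa> / L + L * prob (space M - A) + r + (L + l) * prob (?E n)"
      using Z(2)[of n] divide_right_mono[OF Z(4)[of n], of L] L by simp
    finally show ?thesis .
  qed
  have "(\<lambda>n. \<kappa> / L + L * prob (space M - A) + r + (L + l) * prob (?E n)) \<longlonglongrightarrow>
      \<kappa> / L + L * prob (space M - A) + r + (L + l) * 0"
    by (intro tendsto_intros lim r)
  then show "expectation (\<lambda>\<omega>. indicator A \<omega> * ?g (D \<omega>)) \<le> \<kappa> / L + L * prob (space M - A) + r"
    using LIMSEQ_le_const[of _ _ "expectation (\<lambda>\<omega>. indicator A \<omega> * ?g (D \<omega>))"] bound by auto
qed


text \<open>Each site is approximated with \<epsilon> = 1, the source of \<open>+ 2\<close>. Second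
  moments are combined by the Cauchy-Schwarz inequality, hence the square of the cardinality. The
  resulting constant depends on the grid only through \<open>t m - t 0\<close>.\<close>

lemma ito_integral_sum_step_approx:
  fixes H :: "'i \<Rightarrow> real \<Rightarrow> 'a \<Rightarrow> real"
  assumes fin: "finite \<Lambda>"
    and W: "\<And>i. i \<in> \<Lambda> \<Longrightarrow> brownian_motion M F (W i)"
    and ito: "\<And>i. i \<in> \<Lambda> \<Longrightarrow> ito_integral M F (W i) (H i) (I i)"
    and t0: "0 \<le> t 0" and t: "\<And>j. j < m \<Longrightarrow> t j \<le> t (Suc j)"
    and \<phi>: "\<And>j. j < m \<Longrightarrow> \<phi> j \<in> borel_measurable (F (t j))"
      "\<And>j \<omega>. j < m \<Longrightarrow> \<phi> j \<omega> \<in> {0, 1::real}"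
    and A: "A \<in> events" and K: "0 \<le> K"
      "\<And>i \<omega> j u. i \<in> \<Lambda> \<Longrightarrow> \<omega> \<in> A \<Longrightarrow> j < m \<Longrightarrow> u \<in> {t j..t (Suc j)} \<Longrightarrow> \<phi> j \<omega> = 1 \<Longrightarrow> (H i u \<omega>)\<^sup>2 \<le> K"
  shows "\<exists>Z. \<forall>n. integrable M (Z n) \<and> expectation (Z n) = 0 \<and> integrable M (\<lambda>\<omega>. (Z n \<omega>)\<^sup>2) \<and>
    expectation (\<lambda>\<omega>. (Z n \<omega>)\<^sup>2) \<le> (real (card \<Lambda>))\<^sup>2 * (2 * K * (t m - t 0) + 2) \<and>
    (\<forall>r>0. (\<lambda>n. prob (A \<inter> {\<omega> \<in> space M.
       r < \<bar>Z n \<omega> - (\<Sum>i\<in>\<Lambda>. \<Sum>j<m. \<phi> j \<omega> * (I i (t (Suc j)) \<omega> - I i (t j) \<omega>))\<bar>})) \<longlonglongrightarrow> 0)"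
proof -
  let ?D = "\<lambda>i \<omega>. \<Sum>j<m. \<phi> j \<omega> * (I i (t (Suc j)) \<omega> - I i (t j) \<omega>)"
  let ?\<kappa> = "2 * K * (t m - t 0) + 2"
  have t_nonneg: "0 \<le> t j" if "j \<le> m" for j
    using interval_mono[of m t 0 j] t t0 that by force
  have Dm: "?D i \<in> borel_measurable M" if i: "i \<in> \<Lambda>" for i
  proof (intro borel_measurable_sum borel_measurable_times borel_measurable_diff)
    fix j assume "j \<in> {..<m}"
    then have j: "j < m" "0 \<le> t j" "0 \<le> t (Suc j)" using t_nonneg by auto
    then show "\<phi> j \<in> borel_measurable M" using measurable_F_imp \<phi>(1) by blast
    show "I i (t (Suc j)) \<in> borel_measurable M" "I i (t j) \<in> borel_measurable M"
      using ito[OF i] j by (auto simp: ito_integral_def)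
  qed
  have "\<forall>i\<in>\<Lambda>. \<exists>Z. (\<forall>n. integrable M (Z n) \<and> expectation (Z n) = 0 \<and>
    integrable M (\<lambda>\<omega>. (Z n \<omega>)\<^sup>2) \<and> expectation (\<lambda>\<omega>. (Z n \<omega>)\<^sup>2) \<le> ?\<kappa>) \<and>
    (\<forall>r>0. (\<lambda>n. prob (A \<inter> {\<omega> \<in> space M. r < \<bar>Z n \<omega> - ?D i \<omega>\<bar>})) \<longlonglongrightarrow> 0)"
  proof
    fix i assume i: "i \<in> \<Lambda>"
    obtain Z where "\<And>n. integrable M (Z n)" "\<And>n. expectation (Z n) = 0"
      "\<And>n. integrable M (\<lambda>\<omega>. (Z n \<omega>)\<^sup>2)"
      "\<And>n. expectation (\<lambda>\<omega>. (Z n \<omega>)\<^sup>2) \<le> 2 * K * (t m - t 0) + 2 * 1"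
      "\<And>r. 0 < r \<Longrightarrow> (\<lambda>n. prob (A \<inter> {\<omega> \<in> space M. r < \<bar>Z n \<omega> - ?D i \<omega>\<bar>})) \<longlonglongrightarrow> 0"
      by (rule ito_integral_step_approx[OF W[OF i] ito[OF i], where t = t and m = m and \<phi> = \<phi> and A = A and K = K and \<epsilon> = 1])
        (use t0 t \<phi> A K i in auto)
    then show "\<exists>Z. (\<forall>n. integrable M (Z n) \<and> expectation (Z n) = 0 \<and>
        integrable M (\<lambda>\<omega>. (Z n \<omega>)\<^sup>2) \<and> expectation (\<lambda>\<omega>. (Z n \<omega>)\<^sup>2) \<le> ?\<kappa>) \<and>
        (\<forall>r>0. (\<lambda>n. prob (A \<inter> {\<omega> \<in> space M. r < \<bar>Z n \<omega> - ?D i \<omega>\<bar>})) \<longlonglongrightarrow> 0)"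
      by (intro exI[of _ Z]) simp
  qed
  from bchoice[OF this] obtain Z where
    Z: "\<And>i n. i \<in> \<Lambda> \<Longrightarrow> integrable M (Z i n)" "\<And>i n. i \<in> \<Lambda> \<Longrightarrow> expectation (Z i n) = 0"
      "\<And>i n. i \<in> \<Lambda> \<Longrightarrow> integrable M (\<lambda>\<omega>. (Z i n \<omega>)\<^sup>2)"
      "\<And>i n. i \<in> \<Lambda> \<Longrightarrow> expectation (\<lambda>\<omega>. (Z i n \<omega>)\<^sup>2) \<le> ?\<kappa>"
    and lim: "\<And>i r. i \<in> \<Lambda> \<Longrightarrow> 0 < r \<Longrightarrow> (\<lambda>n. prob (A \<inter> {\<omega> \<in> space M. r < \<bar>Z i n \<omega> - ?D i \<omega>\<bar>})) \<longlonglongrightarrow> 0"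
    by blast
  define N where "N = real (card \<Lambda>)"
  define S where "S n \<omega> = (\<Sum>i\<in>\<Lambda>. Z i n \<omega>)" for n \<omega>
  have Zm: "Z i n \<in> borel_measurable M" if "i \<in> \<Lambda>" for i n using Z(1)[OF that] by blast
  have S2: "(S n \<omega>)\<^sup>2 \<le> N * (\<Sum>i\<in>\<Lambda>. (Z i n \<omega>)\<^sup>2)" for n \<omega>
    unfolding S_def N_def using sum_squared_le_sum_of_squares[of "\<lambda>i. Z i n \<omega>" \<Lambda>] by (simp add: mult.commute)
  have iS: "integrable M (S n)" "expectation (S n) = 0" for n
    unfolding S_def using Z by auto
  have iB: "integrable M (\<lambda>\<omega>. N * (\<Sum>i\<in>\<Lambda>. (Z i n \<omega>)\<^sup>2))" for n using Z by auto
  have iS2: "integrable M (\<lambda>\<omega>. (S n \<omega>)\<^sup>2)" for n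
  proof (rule Bochner_Integration.integrable_bound[OF iB])
    show "(\<lambda>\<omega>. (S n \<omega>)\<^sup>2) \<in> borel_measurable M" using iS(1)[of n] by measurable
    show "AE \<omega> in M. norm ((S n \<omega>)\<^sup>2) \<le> norm (N * (\<Sum>i\<in>\<Lambda>. (Z i n \<omega>)\<^sup>2))"
      using S2[of n] by (intro AE_I2) (simp add: order_trans[OF _ abs_ge_self])
  qed
  have eS2: "expectation (\<lambda>\<omega>. (S n \<omega>)\<^sup>2) \<le> N\<^sup>2 * ?\<kappa>" for n
  proof -
    have "expectation (\<lambda>\<omega>. (S n \<omega>)\<^sup>2) \<le> expectation (\<lambda>\<omega>. N * (\<Sum>i\<in>\<Lambda>. (Z i n \<omega>)\<^sup>2))"
      by (rule integral_mono[OF iS2 iB S2])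
    also have "\<dots> = N * (\<Sum>i\<in>\<Lambda>. expectation (\<lambda>\<omega>. (Z i n \<omega>)\<^sup>2))"
      using Z(3) by simp
    also have "\<dots> \<le> N * (\<Sum>i\<in>\<Lambda>. ?\<kappa>)"
      using Z(4) by (intro mult_left_mono sum_mono) (auto simp: N_def)
    also have "\<dots> = N\<^sup>2 * ?\<kappa>" by (simp add: N_def power2_eq_square)
    finally show ?thesis .
  qed
  have conv: "(\<lambda>n. prob (A \<inter> {\<omega> \<in> space M. r < \<bar>S n \<omega> - (\<Sum>i\<in>\<Lambda>. ?D i \<omega>)\<bar>})) \<longlonglongrightarrow> 0" if r: "0 < r" for r
  proof -
    define r' where "r' = r / (N + 1)"
    have N: "0 \<le> N" by (simp add: N_def)
    then have r': "0 < r'" "N * r' \<le> r" using r by (auto simp: r'_def field_simps)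
    let ?E = "\<lambda>i n. A \<inter> {\<omega> \<in> space M. r' < \<bar>Z i n \<omega> - ?D i \<omega>\<bar>}"
    have Em: "?E i n \<in> events" if "i \<in> \<Lambda>" for i n
    proof -
      note [measurable] = Zm[OF that] Dm[OF that] A
      show ?thesis by measurable
    qed
    have le: "prob (A \<inter> {\<omega> \<in> space M. r < \<bar>S n \<omega> - (\<Sum>i\<in>\<Lambda>. ?D i \<omega>)\<bar>}) \<le> (\<Sum>i\<in>\<Lambda>. prob (?E i n))" for n
    proof -
      have "A \<inter> {\<omega> \<in> space M. r < \<bar>S n \<omega> - (\<Sum>i\<in>\<Lambda>. ?D i \<omega>)\<bar>} \<subseteq> (\<Union>i\<in>\<Lambda>. ?E i n)"
      proof (rule subsetI, rule ccontr)
        fix \<omega> assume \<omega>: "\<omega> \<in> A \<inter> {\<omega> \<in> space M. r < \<bar>S n \<omega> - (\<Sum>i\<in>\<Lambda>. ?D i \<omega>)\<bar>}"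
          and no: "\<omega> \<notin> (\<Union>i\<in>\<Lambda>. ?E i n)"
        have "\<bar>S n \<omega> - (\<Sum>i\<in>\<Lambda>. ?D i \<omega>)\<bar> \<le> (\<Sum>i\<in>\<Lambda>. \<bar>Z i n \<omega> - ?D i \<omega>\<bar>)"
          unfolding S_def sum_subtractf[symmetric] by (rule sum_abs)
        also have "\<dots> \<le> (\<Sum>i\<in>\<Lambda>. r')"
        proof (rule sum_mono)
          fix i assume "i \<in> \<Lambda>"
          then have "\<omega> \<notin> ?E i n" using no by blast
          then show "\<bar>Z i n \<omega> - ?D i \<omega>\<bar> \<le> r'" using \<omega> by (simp add: not_less)
        qed
        also have "\<dots> \<le> r" using r' by (simp add: N_def)
        finally show False using \<omega> by auto
      qed
      then have "prob (A \<inter> {\<omega> \<in> space M. r < \<bar>S n \<omega> - (\<Sum>i\<in>\<Lambda>. ?D i \<omega>)\<bar>}) \<le> prob (\<Union>i\<in>\<Lambda>. ?E i n)"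
        by (rule finite_measure_mono[OF _ sets.finite_UN[OF fin Em]])
      also have "\<dots> \<le> (\<Sum>i\<in>\<Lambda>. prob (?E i n))"
        using Em fin by (intro finite_measure_subadditive_finite) auto
      finally show ?thesis .
    qed
    have "(\<lambda>n. \<Sum>i\<in>\<Lambda>. prob (?E i n)) \<longlonglongrightarrow> (\<Sum>i\<in>\<Lambda>. 0)"
      using lim r' by (intro tendsto_sum) auto
    then have "(\<lambda>n. \<Sum>i\<in>\<Lambda>. prob (?E i n)) \<longlonglongrightarrow> 0" by simp
    then show ?thesis
      by (rule tendsto_sandwich[OF always_eventually always_eventually tendsto_const, rotated 2]) (use le in auto)
  qed
  show ?thesis
    using iS iS2 eS2 conv by (intro exI[of _ S]) (auto simp: N_def)
qed

text \<open>On \<open>A m\<close> the grid with \<open>m\<close> intervals is fine enough that nothing exceeds its threshold by much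
  before stopping. The constant \<open>\<kappa>\<close> does not depend on \<open>m\<close>, so \<open>m \<rightarrow> \<infinity>\<close> comes before \<open>L \<rightarrow> \<infinity>\<close>.\<close>

lemma stopped_sum_estimate:
  fixes x :: "'i \<Rightarrow> real \<Rightarrow> 'a \<Rightarrow> real"
  assumes fin: "finite \<Lambda>"
    and x_nonneg: "\<And>i u \<omega>. i \<in> \<Lambda> \<Longrightarrow> 0 \<le> u \<Longrightarrow> \<omega> \<in> space M \<Longrightarrow> 0 \<le> x i u \<omega>"
    and x_adapted: "\<And>i. i \<in> \<Lambda> \<Longrightarrow> adapted F (x i)"
    and x_cont: "\<And>i \<omega>. i \<in> \<Lambda> \<Longrightarrow> \<omega> \<in> space M \<Longrightarrow> continuous_on {0..} (\<lambda>u. x i u \<omega>)"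
    and W: "\<And>i. i \<in> \<Lambda> \<Longrightarrow> brownian_motion M F (W i)"
    and ito: "\<And>i. i \<in> \<Lambda> \<Longrightarrow> ito_integral M F (W i) (\<lambda>u \<omega>. \<sigma> (x i u \<omega>)) (I i)"
    and \<sigma>: "continuous_on {0..} \<sigma>"
    and f_adapted: "adapted F f"
    and f_cont: "\<And>\<omega>. \<omega> \<in> space M \<Longrightarrow> continuous_on {0..} (\<lambda>u. f u \<omega>)"
    and drift: "AE \<omega> in M. \<forall>a b c. 0 \<le> a \<longrightarrow> a \<le> b \<longrightarrow> (\<forall>u\<in>{a..b}. f u \<omega> \<le> c) \<longrightarrow>
      (\<Sum>i\<in>\<Lambda>. x i b \<omega>) - (\<Sum>i\<in>\<Lambda>. x i a \<omega>) \<le> c * (b - a) + (\<Sum>i\<in>\<Lambda>. I i b \<omega> - I i a \<omega>)"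
    and st: "0 \<le> s" "s < t"
    and G: "G \<in> sets (F s)" "\<And>\<omega>. \<omega> \<in> G \<Longrightarrow> (\<Sum>i\<in>\<Lambda>. x i s \<omega>) \<le> \<epsilon>"
    and S: "S \<in> events" "\<And>\<omega> u i. \<omega> \<in> S \<Longrightarrow> u \<in> {s..t} \<Longrightarrow> i \<in> \<Lambda> \<Longrightarrow> x i u \<omega> \<le> R"
      "\<And>\<omega> u. \<omega> \<in> S \<Longrightarrow> u \<in> {s..t} \<Longrightarrow> f u \<omega> \<le> \<delta>"
    and pos: "0 < \<delta>" "0 < l" "0 \<le> \<epsilon>"
  shows "l * prob (G \<inter> S \<inter> {\<omega> \<in> space M. l < (\<Sum>i\<in>\<Lambda>. x i t \<omega>)}) \<le> (\<epsilon> + 2 * \<delta> * (t - s)) * prob G"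
proof -
  define Y where "Y u \<omega> = (\<Sum>i\<in>\<Lambda>. x i u \<omega>)" for u \<omega>
  define E where "E = G \<inter> S \<inter> {\<omega> \<in> space M. l < Y t \<omega>}"
  define c where "c = \<epsilon> + 2 * \<delta> * (t - s)"
  have c: "0 \<le> c" using pos st by (simp add: c_def)
  have xF: "x i u \<in> borel_measurable (F u)" if "i \<in> \<Lambda>" "0 \<le> u" for i u
    using x_adapted[OF that(1)] that(2) by (simp add: adapted_def)
  have fF: "f u \<in> borel_measurable (F u)" if "0 \<le> u" for u
    using f_adapted that by (simp add: adapted_def)
  have xM: "x i u \<in> borel_measurable M" if "i \<in> \<Lambda>" "0 \<le> u" for i u
    using measurable_F_imp[OF that(2) xF[OF that]] .
  have fM: "f u \<in> borel_measurable M" if "0 \<le> u" for u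
    using measurable_F_imp[OF that fF[OF that]] .
  have GM: "G \<in> events" using sets_F_subset[OF st(1) G(1)] .
  have YM: "Y t \<in> borel_measurable M" unfolding Y_def using xM st by (intro borel_measurable_sum) auto
  have EM: "E \<in> events" using GM S(1) YM unfolding E_def by measurable
  have cont_ab: "continuous_on {a..b} (\<lambda>u. x i u \<omega>)"
    if "0 \<le> a" "i \<in> \<Lambda>" "\<omega> \<in> space M" for a b i \<omega>
    using x_cont[OF that(2,3)] that(1) by (auto elim: continuous_on_subset)
  have f_cont_ab: "continuous_on {a..b} (\<lambda>u. f u \<omega>)"
    if "0 \<le> a" "\<omega> \<in> space M" for a b \<omega>
    using f_cont[OF that(2)] that(1) by (auto elim: continuous_on_subset)
  \<comment> \<open>\<open>R + 1\<close> and not \<open>R\<close>: the solution is compared with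
    \<open>R\<close> at grid points only, and on \<open>A m\<close> it grows by at most 1 until the
    next one.\<close>
  obtain K where K: "0 \<le> K" "\<And>y. 0 \<le> y \<Longrightarrow> y \<le> R + 1 \<Longrightarrow> (\<sigma> y)\<^sup>2 \<le> K"
  proof -
    have "continuous_on {0..R + 1} (\<lambda>y. (\<sigma> y)\<^sup>2)"
      using \<sigma> by (intro continuous_intros) (auto elim: continuous_on_subset)
    then have "bounded ((\<lambda>y. (\<sigma> y)\<^sup>2) ` {0..R + 1})"
      by (intro compact_imp_bounded compact_continuous_image) auto
    then obtain K where K: "\<And>y. y \<in> {0..R + 1} \<Longrightarrow> norm ((\<sigma> y)\<^sup>2) \<le> K"
      unfolding bounded_iff by blast
    show thesis by (rule that[of "\<bar>K\<bar>"]) (use K in \<open>auto intro: order_trans[OF _ abs_ge_self]\<close>)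
  qed
  \<comment> \<open>For \<open>m = 0\<close> division by zero makes every \<open>tt m k\<close>
    equal to \<open>s\<close>; hence the conditions \<open>0 < m\<close> below and the index
    \<open>Suc n\<close> in the limit.\<close>
  define tt where "tt m k = s + (t - s) * real k / real m" for m k :: nat
  have tt_mono: "tt m j \<le> tt m k" if "j \<le> k" for m j k
    using that st by (auto simp: tt_def intro!: divide_right_mono mult_left_mono)
  have tt0: "tt m 0 = s" for m by (simp add: tt_def)
  have ttm: "tt m m = t" if "0 < m" for m using that by (simp add: tt_def)
  have tt_nonneg: "0 \<le> tt m k" for m k using tt_mono[of 0 k m] tt0[of m] st by simp
  have tt_less: "tt m k < tt m (Suc k)" if "0 < m" for m k
    using that st by (simp add: tt_def divide_strict_right_mono)
  have tt_in: "{tt m k..tt m (Suc k)} \<subseteq> {s..t}" if "k < m" for m k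
    using tt_mono[of 0 k m] tt_mono[of "Suc k" m m] that tt0[of m] ttm[of m] by auto
  define in_region where "in_region m k \<omega> \<longleftrightarrow> (\<forall>i\<in>\<Lambda>. x i (tt m k) \<omega> \<le> R) \<and> f (tt m k) \<omega> \<le> \<delta>" for m k \<omega>
  \<comment> \<open>This stays 1 until the first grid point outside the region and looks at no point
    after \<open>tt m k\<close>, so it is known at that time.\<close>
  define \<phi> where "\<phi> m k \<omega> = (of_bool (\<omega> \<in> G \<and> (\<forall>j\<le>k. in_region m j \<omega>)) :: real)" for m k \<omega>
  define A where "A m = {\<omega> \<in> space M. \<forall>k<m. (\<forall>i\<in>\<Lambda>. \<forall>u\<in>{tt m k..tt m (Suc k)}. x i u \<omega> - x i (tt m k) \<omega> \<le> 1) \<and>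
     (\<forall>u\<in>{tt m k..tt m (Suc k)}. f u \<omega> - f (tt m k) \<omega> \<le> \<delta>)}" for m
  have AM: "A m \<in> events" for m
  proof -
    have "{\<omega> \<in> space M. \<forall>u\<in>{tt m k..tt m (Suc k)}. x i u \<omega> - x i (tt m k) \<omega> \<le> 1} \<in> events"
      if "k < m" "i \<in> \<Lambda>" for k i
      using that tt_nonneg tt_less[of m k] tt_mono[of 0 k m] tt0[of m] st
      by (intro sets_path_bounded continuous_intros cont_ab borel_measurable_diff xM)
        (auto intro: order_trans[OF tt_nonneg])
    moreover have "{\<omega> \<in> space M. \<forall>u\<in>{tt m k..tt m (Suc k)}. f u \<omega> - f (tt m k) \<omega> \<le> \<delta>} \<in> events"
      if "k < m" for k
      using that tt_nonneg tt_less[of m k]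
      by (intro sets_path_bounded continuous_intros f_cont_ab borel_measurable_diff fM)
        (auto intro: order_trans[OF tt_nonneg])
    moreover have "A m = {\<omega> \<in> space M. \<forall>k\<in>{..<m}. (\<forall>i\<in>\<Lambda>. \<forall>u\<in>{tt m k..tt m (Suc k)}. x i u \<omega> - x i (tt m k) \<omega> \<le> 1) \<and>
     (\<forall>u\<in>{tt m k..tt m (Suc k)}. f u \<omega> - f (tt m k) \<omega> \<le> \<delta>)}" by (auto simp: A_def)
    ultimately show ?thesis
      using fin by (auto intro!: sets.sets_Collect_conj sets.sets_Collect_finite_All)
  qed
  have \<phi>01: "\<phi> m k \<omega> \<in> {0, 1}" for m k \<omega> by (auto simp: \<phi>_def of_bool_def)
  have \<phi>F: "\<phi> m k \<in> borel_measurable (F (tt m k))" for m k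
  proof -
    have le: "s \<le> tt m k" using tt_mono[of 0 k m] tt0 by simp
    have 1: "G \<in> sets (F (tt m k))" using G(1) F_mono[OF st(1) le] by blast
    have "{\<omega> \<in> space (F (tt m k)). in_region m j \<omega>} \<in> sets (F (tt m k))" if "j \<le> k" for j
    proof -
      have [measurable]: "f (tt m j) \<in> borel_measurable (F (tt m k))"
        by (rule measurable_F_mono[OF tt_nonneg tt_mono[OF that] fF[OF tt_nonneg]])
      have [measurable]: "x i (tt m j) \<in> borel_measurable (F (tt m k))" if "i \<in> \<Lambda>" for i
        by (rule measurable_F_mono[OF tt_nonneg tt_mono[OF \<open>j \<le> k\<close>] xF[OF that tt_nonneg]])
      show ?thesis
        unfolding in_region_def
        by (intro sets.sets_Collect_conj sets.sets_Collect_finite_All fin) auto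
    qed
    then have "{\<omega> \<in> space (F (tt m k)). \<forall>j\<in>{..k}. in_region m j \<omega>} \<in> sets (F (tt m k))"
      by (intro sets.sets_Collect_finite_All) auto
    then have 2: "G \<inter> {\<omega> \<in> space (F (tt m k)). \<forall>j\<in>{..k}. in_region m j \<omega>} \<in> sets (F (tt m k))"
      using 1 by blast
    have "\<phi> m k \<omega> = indicator (G \<inter> {\<omega> \<in> space (F (tt m k)). \<forall>j\<in>{..k}. in_region m j \<omega>}) \<omega>"
      if "\<omega> \<in> space (F (tt m k))" for \<omega>
      using that by (auto simp: \<phi>_def indicator_def)
    then show ?thesis using 2 by (subst measurable_cong) auto
  qed
  have region: "x i u \<omega> \<le> R + 1"
    if "\<omega> \<in> A m" "k < m" "\<phi> m k \<omega> = 1" "u \<in> {tt m k..tt m (Suc k)}" "i \<in> \<Lambda>" for \<omega> m k u i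
  proof -
    have "in_region m k \<omega>" using that(3) by (auto simp: \<phi>_def)
    then have "x i (tt m k) \<omega> \<le> R" using that(5) by (auto simp: in_region_def)
    moreover have "x i u \<omega> - x i (tt m k) \<omega> \<le> 1"
      using that unfolding A_def by blast
    ultimately show "x i u \<omega> \<le> R + 1" by simp
  qed
  define \<kappa> where "\<kappa> = (real (card \<Lambda>))\<^sup>2 * (2 * K * (t - s) + 2)"
  have \<kappa>: "0 \<le> \<kappa>" using K st by (simp add: \<kappa>_def)
  \<comment> \<open>\<open>c \<le> L\<close> keeps the lower clamp inactive: almost surely
    \<open>D \<ge> - c\<close> on \<open>A m\<close>.\<close>
  have main: "l * prob E \<le> c * prob G + \<kappa> / L + (L + l) * prob (space M - A m)"
    if m: "0 < m" and L: "0 < L" "c \<le> L" for m L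
  proof -
    define D where "D \<omega> = (\<Sum>i\<in>\<Lambda>. \<Sum>k<m. \<phi> m k \<omega> * (I i (tt m (Suc k)) \<omega> - I i (tt m k) \<omega>))" for \<omega>
    have K': "(\<sigma> (x i u \<omega>))\<^sup>2 \<le> K"
      if "i \<in> \<Lambda>" "\<omega> \<in> A m" "k < m" "u \<in> {tt m k..tt m (Suc k)}" "\<phi> m k \<omega> = 1" for i \<omega> k u
    proof (rule K(2))
      have "0 \<le> u" using that(4) tt_nonneg[of m k] by auto
      then show "0 \<le> x i u \<omega>" using x_nonneg[OF that(1)] that(2) by (auto simp: A_def)
      show "x i u \<omega> \<le> R + 1" by (rule region[OF that(2,3,5,4,1)])
    qed
    have "\<exists>Z. \<forall>n. integrable M (Z n) \<and> expectation (Z n) = 0 \<and> integrable M (\<lambda>\<omega>. (Z n \<omega>)\<^sup>2) \<and>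
      expectation (\<lambda>\<omega>. (Z n \<omega>)\<^sup>2) \<le> (real (card \<Lambda>))\<^sup>2 * (2 * K * (tt m m - tt m 0) + 2) \<and>
      (\<forall>r>0. (\<lambda>n. prob (A m \<inter> {\<omega> \<in> space M. r < \<bar>Z n \<omega> - D \<omega>\<bar>})) \<longlonglongrightarrow> 0)"
      unfolding D_def
      by (rule ito_integral_sum_step_approx[OF fin W ito])
        (use tt_nonneg tt_mono \<phi>F \<phi>01 AM K(1) K' in auto)
    then obtain Z where Z: "\<And>n. integrable M (Z n)" "\<And>n. expectation (Z n) = 0"
      "\<And>n. integrable M (\<lambda>\<omega>. (Z n \<omega>)\<^sup>2)" "\<And>n. expectation (\<lambda>\<omega>. (Z n \<omega>)\<^sup>2) \<le> \<kappa>"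
      and lim: "\<And>r. 0 < r \<Longrightarrow> (\<lambda>n. prob (A m \<inter> {\<omega> \<in> space M. r < \<bar>Z n \<omega> - D \<omega>\<bar>})) \<longlonglongrightarrow> 0"
      using tt0[of m] ttm[OF m] unfolding \<kappa>_def by auto
    have DM[measurable]: "D \<in> borel_measurable M"
      unfolding D_def
    proof (intro borel_measurable_sum borel_measurable_times borel_measurable_diff)
      fix i k assume "i \<in> \<Lambda>"
      show "\<phi> m k \<in> borel_measurable M" by (rule measurable_F_imp[OF tt_nonneg \<phi>F])
      show "I i (tt m (Suc k)) \<in> borel_measurable M" "I i (tt m k) \<in> borel_measurable M"
        using ito[OF \<open>i \<in> \<Lambda>\<close>] tt_nonneg by (auto simp: ito_integral_def)
    qed
    let ?g = "\<lambda>z. max (- L) (min l z)"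
    have clamp: "expectation (\<lambda>\<omega>. indicator (A m) \<omega> * ?g (D \<omega>)) \<le> \<kappa> / L + L * prob (space M - A m)"
      using expectation_clamp_limit_le[OF AM DM Z lim L(1), of l] pos by simp
    \<comment> \<open>On \<open>A m\<close> and \<open>G\<close>, \<open>c + D\<close> dominates the
      stopped mass. That mass is nonnegative, and on \<open>E\<close> no stopping occurs, so it is
      the final mass, which exceeds \<open>l\<close>. Off \<open>G\<close> the sum \<open>D\<close>
      is 0.\<close>
    have pointwise: "AE \<omega> in M. l * indicator (A m \<inter> E) \<omega> \<le> c * indicator G \<omega> + indicator (A m) \<omega> * ?g (D \<omega>)"
      using drift
    proof (rule AE_mp, intro AE_I2 impI)
      fix \<omega> assume \<omega>: "\<omega> \<in> space M" and dr: "\<forall>a b c. 0 \<le> a \<longrightarrow> a \<le> b \<longrightarrow> (\<forall>u\<in>{a..b}. f u \<omega> \<le> c) \<longrightarrow>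
        (\<Sum>i\<in>\<Lambda>. x i b \<omega>) - (\<Sum>i\<in>\<Lambda>. x i a \<omega>) \<le> c * (b - a) + (\<Sum>i\<in>\<Lambda>. I i b \<omega> - I i a \<omega>)"
      show "l * indicator (A m \<inter> E) \<omega> \<le> c * indicator G \<omega> + indicator (A m) \<omega> * ?g (D \<omega>)"
      proof (cases "\<omega> \<in> A m")
        case inA: True
        show ?thesis
        proof (cases "\<omega> \<in> G")
          case False
          then have "D \<omega> = 0" by (simp add: D_def \<phi>_def)
          then show ?thesis using False L pos by (auto simp: E_def)
        next
          case inG: True
          let ?V = "Y (tt m 0) \<omega> + (\<Sum>k<m. \<phi> m k \<omega> * (Y (tt m (Suc k)) \<omega> - Y (tt m k) \<omega>))"
          have V: "0 \<le> ?V" "\<phi> m m \<omega> = 1 \<Longrightarrow> ?V = Y (tt m m) \<omega>"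
          proof -
            have Y_nonneg: "0 \<le> Y (tt m k) \<omega>" for k
              unfolding Y_def using x_nonneg[OF _ tt_nonneg \<omega>] by (intro sum_nonneg)
            have decr: "\<phi> m (Suc k) \<omega> = 0" if "\<phi> m k \<omega> = 0" for k
              using that unfolding \<phi>_def of_bool_def by (metis le_SucI one_neq_zero)
            show "0 \<le> ?V" "\<phi> m m \<omega> = 1 \<Longrightarrow> ?V = Y (tt m m) \<omega>"
              using stopped_sum_nonneg[of "\<lambda>k. Y (tt m k) \<omega>" "\<lambda>k. \<phi> m k \<omega>" m, OF Y_nonneg \<phi>01 decr] by blast+
          qed
          have "(\<Sum>k<m. \<phi> m k \<omega> * (Y (tt m (Suc k)) \<omega> - Y (tt m k) \<omega>)) \<le>
              (\<Sum>k<m. 2 * \<delta> * (tt m (Suc k) - tt m k) + \<phi> m k \<omega> * (\<Sum>i\<in>\<Lambda>. I i (tt m (Suc k)) \<omega> - I i (tt m k) \<omega>))"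
          proof (rule sum_mono)
            fix k assume k: "k \<in> {..<m}"
            show "\<phi> m k \<omega> * (Y (tt m (Suc k)) \<omega> - Y (tt m k) \<omega>) \<le>
              2 * \<delta> * (tt m (Suc k) - tt m k) + \<phi> m k \<omega> * (\<Sum>i\<in>\<Lambda>. I i (tt m (Suc k)) \<omega> - I i (tt m k) \<omega>)"
            proof (cases "\<phi> m k \<omega> = 1")
              case True
              \<comment> \<open>At most \<delta> at the grid point and at most \<delta> more within
                the cell: the source of the factor 2 in \<open>c\<close>.\<close>
              have "\<forall>u\<in>{tt m k..tt m (Suc k)}. f u \<omega> \<le> 2 * \<delta>"
              proof
                fix u assume u: "u \<in> {tt m k..tt m (Suc k)}"
                have "in_region m k \<omega>" using True by (auto simp: \<phi>_def)
                then have "f (tt m k) \<omega> \<le> \<delta>" by (simp add: in_region_def)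
                moreover have "f u \<omega> - f (tt m k) \<omega> \<le> \<delta>" using inA u k unfolding A_def by blast
                ultimately show "f u \<omega> \<le> 2 * \<delta>" by simp
              qed
              then show ?thesis
                using dr tt_nonneg[of m k] tt_mono[of k "Suc k" m] True unfolding Y_def by simp
            next
              case False
              \<comment> \<open>A stopped cell contributes 0 on the left. Charging it the
                nonnegative drift bound anyway lets the time steps telescope to
                \<open>t - s\<close>.\<close>
              then have "\<phi> m k \<omega> = 0" using \<phi>01[of m k \<omega>] by simp
              then show ?thesis using pos tt_mono[of k "Suc k" m] by simp
            qed
          qed
          also have "\<dots> = 2 * \<delta> * (\<Sum>k<m. tt m (Suc k) - tt m k) + (\<Sum>k<m. \<phi> m k \<omega> * (\<Sum>i\<in>\<Lambda>. I i (tt m (Suc k)) \<omega> - I i (tt m k) \<omega>))"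
            by (simp add: sum.distrib sum_distrib_left)
          also have "(\<Sum>k<m. tt m (Suc k) - tt m k) = t - s"
            using sum_lessThan_telescope[of "tt m" m] tt0[of m] ttm[OF m] by simp
          also have "(\<Sum>k<m. \<phi> m k \<omega> * (\<Sum>i\<in>\<Lambda>. I i (tt m (Suc k)) \<omega> - I i (tt m k) \<omega>)) = D \<omega>"
            unfolding D_def sum_distrib_left by (rule sum.swap)
          finally have V_le: "?V \<le> c + D \<omega>"
            using G(2)[OF inG] unfolding tt0 Y_def c_def by simp
          then have D_ge: "- c \<le> D \<omega>" using V(1) by linarith
          show ?thesis
          proof (cases "\<omega> \<in> E")
            case True
            have "in_region m j \<omega>" if "j \<le> m" for j
            proof -
              have "tt m j \<in> {s..t}"
                using tt_mono[of 0 j m] tt_mono[OF that, of m] tt0[of m] ttm[OF m] by simp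
              then show ?thesis
                using True S(2,3) unfolding in_region_def E_def by blast
            qed
            then have "\<phi> m m \<omega> = 1" using inG by (simp add: \<phi>_def)
            then have "l < c + D \<omega>"
              using V(2) V_le True ttm[OF m] by (simp add: E_def)
            then have "l \<le> c + ?g (D \<omega>)" using D_ge L c by linarith
            then show ?thesis using True inA inG by simp
          next
            case False
            have "0 \<le> c + ?g (D \<omega>)" using D_ge L c pos by linarith
            then show ?thesis using False inA inG by simp
          qed
        qed
      qed (use c in auto)
    qed
    have iind: "integrable M (indicator C :: 'a \<Rightarrow> real)" if "C \<in> events" for C
      using that by (intro integrable_real_indicator) (auto simp: emeasure_eq_measure)
    have ig: "integrable M (\<lambda>\<omega>. indicator (A m) \<omega> * ?g (D \<omega>))"
    proof (rule integrable_const_bound[where B = "L + l"])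
      show "AE \<omega> in M. norm (indicator (A m) \<omega> * ?g (D \<omega>)) \<le> L + l"
        using L pos by (auto simp: indicator_def)
      show "(\<lambda>\<omega>. indicator (A m) \<omega> * ?g (D \<omega>)) \<in> borel_measurable M" using AM by measurable
    qed
    have "expectation (\<lambda>\<omega>. l * indicator (A m \<inter> E) \<omega>) \<le>
        expectation (\<lambda>\<omega>. c * indicator G \<omega> + indicator (A m) \<omega> * ?g (D \<omega>))"
      using AM EM GM ig pointwise
      by (intro integral_mono_AE Bochner_Integration.integrable_add integrable_mult_right iind) auto
    also have "\<dots> = c * prob G + expectation (\<lambda>\<omega>. indicator (A m) \<omega> * ?g (D \<omega>))"
      using ig iind[OF GM] GM sets.sets_into_space[OF GM] by (simp add: inf_absorb1)
    finally have 1: "l * prob (A m \<inter> E) \<le> c * prob G + \<kappa> / L + L * prob (space M - A m)"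
      using clamp AM EM sets.sets_into_space[OF EM] by (simp add: inf_absorb1 inf.assoc)
    have "prob E \<le> prob ((A m \<inter> E) \<union> (space M - A m))"
      using AM EM sets.sets_into_space[OF EM] by (intro finite_measure_mono) auto
    also have "\<dots> \<le> prob (A m \<inter> E) + prob (space M - A m)"
      using AM EM by (intro measure_Un_le) auto
    finally have "l * prob E \<le> l * (prob (A m \<inter> E) + prob (space M - A m))"
      using pos by (intro mult_left_mono) auto
    then show ?thesis using 1 by (simp add: algebra_simps)
  qed
  \<comment> \<open>Finitely many paths are uniformly continuous on \<open>{s..t}\<close>, so their
    oscillations over all cells are small once the mesh is small.\<close>
  have A_ev: "\<forall>\<^sub>F n in sequentially. \<omega> \<in> A (Suc n)" if \<omega>: "\<omega> \<in> space M" for \<omega>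
  proof -
    have uc: "\<exists>d>0. \<forall>u\<in>{s..t}. \<forall>v\<in>{s..t}. dist v u < d \<longrightarrow> dist (h v) (h u) < e"
      if "continuous_on {s..t} h" "0 < e" for h :: "real \<Rightarrow> real" and e
      using compact_uniformly_continuous[OF that(1)] that(2) unfolding uniformly_continuous_on_def by blast
    have fine: "\<forall>\<^sub>F n in sequentially. \<forall>k<Suc n. \<forall>u\<in>{tt (Suc n) k..tt (Suc n) (Suc k)}. h u - h (tt (Suc n) k) \<le> e"
      if h: "continuous_on {s..t} h" "0 < e" for h :: "real \<Rightarrow> real" and e
    proof -
      obtain d where d: "0 < d" "\<And>u v. u \<in> {s..t} \<Longrightarrow> v \<in> {s..t} \<Longrightarrow> dist v u < d \<Longrightarrow> dist (h v) (h u) < e"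
        using uc[OF h] by blast
      have "(\<lambda>n. (t - s) * inverse (real (Suc n))) \<longlonglongrightarrow> (t - s) * 0"
        by (intro tendsto_intros LIMSEQ_inverse_real_of_nat)
      then have "\<forall>\<^sub>F n in sequentially. (t - s) * inverse (real (Suc n)) < d"
        using d(1) by (intro order_tendstoD) auto
      then show ?thesis
      proof eventually_elim
        case (elim n)
        show ?case
        proof (intro allI impI ballI)
          fix k u assume k: "k < Suc n" and u: "u \<in> {tt (Suc n) k..tt (Suc n) (Suc k)}"
          have "tt (Suc n) (Suc k) - tt (Suc n) k = (t - s) * inverse (real (Suc n))"
            unfolding tt_def by (simp add: divide_inverse algebra_simps)
          then have "dist u (tt (Suc n) k) < d" using u elim by (auto simp: dist_real_def)
          moreover have "u \<in> {s..t}" "tt (Suc n) k \<in> {s..t}"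
            using tt_in[OF k] u tt_mono[of k "Suc k" "Suc n"] by auto
          ultimately have "dist (h u) (h (tt (Suc n) k)) < e" using d(2) by blast
          then show "h u - h (tt (Suc n) k) \<le> e" by (auto simp: dist_real_def)
        qed
      qed
    qed
    have "\<forall>\<^sub>F n in sequentially. \<forall>i\<in>\<Lambda>. \<forall>k<Suc n. \<forall>u\<in>{tt (Suc n) k..tt (Suc n) (Suc k)}. x i u \<omega> - x i (tt (Suc n) k) \<omega> \<le> 1"
      using fin fine[OF cont_ab[OF st(1) _ \<omega>]] by (intro eventually_ball_finite) auto
    moreover have "\<forall>\<^sub>F n in sequentially. \<forall>k<Suc n. \<forall>u\<in>{tt (Suc n) k..tt (Suc n) (Suc k)}. f u \<omega> - f (tt (Suc n) k) \<omega> \<le> \<delta>"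
      by (rule fine[OF f_cont_ab[OF st(1) \<omega>] pos(1)])
    ultimately show ?thesis
      by eventually_elim (use \<omega> in \<open>auto simp: A_def\<close>)
  qed
  have lim0: "(\<lambda>n. prob (space M - A (Suc n))) \<longlonglongrightarrow> 0"
    using AM A_ev by (intro prob_diff_tendsto_0) auto
  have L_bound: "l * prob E \<le> c * prob G + \<kappa> / L" if L: "0 < L" "c \<le> L" for L
  proof -
    have "(\<lambda>n. c * prob G + \<kappa> / L + (L + l) * prob (space M - A (Suc n))) \<longlonglongrightarrow> c * prob G + \<kappa> / L + (L + l) * 0"
      by (intro tendsto_intros lim0)
    then show ?thesis
      using LIMSEQ_le_const[of _ _ "l * prob E"] main[OF _ L] by auto
  qed
  have "l * prob E \<le> c * prob G"
  proof (rule field_le_epsilon)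
    fix e :: real assume e: "0 < e"
    \<comment> \<open>\<open>\<kappa> / e\<close> brings the error down to \<open>e\<close>,
      \<open>c\<close> is the requirement of the clamp, and 1 gives positivity.\<close>
    define L where "L = max 1 (max c (\<kappa> / e))"
    have "\<kappa> / L \<le> e"
    proof -
      have "\<kappa> / e \<le> L" "0 < L" by (auto simp: L_def)
      then show ?thesis using e by (simp add: field_simps)
    qed
    moreover have "0 < L" "c \<le> L" by (auto simp: L_def)
    ultimately show "l * prob E \<le> c * prob G + e" using L_bound[of L] by linarith
  qed
  then show ?thesis by (simp add: E_def c_def Y_def)
qed

end

section \<open>The lattice and summable functions\<close>

lemma embed_diff: "embed (i - j) = embed i - embed j"
  by (simp add: embed_def vec_eq_iff)

lemma neighbours_iff: "j \<in> neighbours i \<longleftrightarrow> norm (embed (j - i)) = 1"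
  by (simp add: neighbours_def dist_norm embed_diff)

lemma norm_axis: "norm (axis k c :: real ^ 'n) = \<bar>c\<bar>"
  by (simp add: norm_eq_sqrt_inner inner_axis_axis)

lemma neighbours_commute: "j \<in> neighbours i \<longleftrightarrow> i \<in> neighbours j"
  by (simp add: neighbours_def dist_commute)

text \<open>Translation by \<open>- i\<close> maps the neighbours of \<open>i\<close> onto those of
  0. One constant thus bounds the inflow at all sites.\<close>

lemma card_neighbours: "card (neighbours (i :: int ^ 'd)) = card (neighbours (0 :: int ^ 'd))"
proof (rule bij_betw_same_card)
  show "bij_betw (\<lambda>j. j - i) (neighbours i) (neighbours 0)"
    by (rule bij_betw_byWitness[where f' = "\<lambda>j. j + i"]) (auto simp: neighbours_iff)
qed

lemma laplace_eq_0_imp_neighbours_0: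
  fixes g :: "int ^ 'd \<Rightarrow> real"
  assumes g: "\<And>j. 0 \<le> g j" and "g i = 0" "laplace g i = 0" "j \<in> neighbours i"
  shows "g j = 0"
proof -
  have "(\<Sum>j\<in>neighbours i. g j) = 0"
    using assms(2,3) by (simp add: laplace_def)
  then show ?thesis
    using g assms(4) sum_nonneg_eq_0_iff[OF finite_neighbours, of i g] by blast
qed

text \<open>From any site walk along one coordinate axis until the norm exceeds \<open>R\<close>.
  The far end is in \<open>Z\<close>, and closure under neighbours carries membership back step by
  step. Applied to the sites that stay empty, it says that emptiness outside a ball spreads to every
  site.\<close>

lemma neighbour_closed_imp_UNIV:
  fixes Z :: "(int ^ 'd) set"
  assumes step: "\<And>i j. i \<in> Z \<Longrightarrow> j \<in> neighbours i \<Longrightarrow> j \<in> Z"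
    and far: "\<And>i. R < norm (embed i) \<Longrightarrow> i \<in> Z"
  shows "i \<in> Z"
proof -
  obtain k :: 'd where True by simp
  define p where "p n = i + axis k (int n)" for n
  have emb: "embed (p n) = embed i + axis k (real n)" for n
    by (auto simp: p_def embed_def vec_eq_iff axis_def)
  have nb: "p n \<in> neighbours (p (Suc n))" for n
  proof -
    have "embed (p n) - embed (p (Suc n)) = axis k (- 1)"
      by (simp add: emb vec_eq_iff axis_def)
    then show ?thesis by (simp add: neighbours_def dist_norm norm_axis)
  qed
  obtain n where n: "R + norm (embed i) < real n" using reals_Archimedean2 by blast
  have "R < norm (embed (p n))"
    using norm_triangle_ineq2[of "axis k (real n)" "- embed i"] n by (simp add: emb norm_axis add.commute)
  then have "p n \<in> Z" by (rule far)
  then have "p 0 \<in> Z"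
    by (induction n) (use step nb in blast)+
  then show ?thesis by (simp add: p_def axis_def vec_eq_iff[symmetric] zero_vec_def[symmetric])
qed

section \<open>Nonnegative summable functions on the sites\<close>

lemma l1_plusD:
  assumes "x \<in> l1_plus"
  shows "0 \<le> x i" "x summable_on UNIV" "l1_norm x = infsum x UNIV"
  using assms by (auto simp: l1_plus_def l1_norm_def)

lemma sum_le_l1_norm: "x \<in> l1_plus \<Longrightarrow> finite \<Lambda> \<Longrightarrow> sum x \<Lambda> \<le> l1_norm x"
  using l1_plusD[of x] finite_sum_le_infsum[of x UNIV \<Lambda>] by simp

lemma l1_norm_eq_0_iff:
  assumes "x \<in> l1_plus"
  shows "l1_norm x = 0 \<longleftrightarrow> (\<forall>i. x i = 0)"
proof
  assume "l1_norm x = 0"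
  then have "x i \<le> 0" for i using sum_le_l1_norm[OF assms, of "{i}"] by simp
  then show "\<forall>i. x i = 0" using l1_plusD(1)[OF assms] by (simp add: antisym)
qed (simp add: l1_norm_def)

text \<open>On \<open>l1_plus\<close> the norm is the sum of the entries, so a difference of norms
  is a sum of differences. This carries \<open>l1_continuous_on\<close> over to the total
  mass.\<close>

lemma abs_l1_norm_diff_le:
  assumes x: "x \<in> l1_plus" and y: "y \<in> l1_plus"
  shows "\<bar>l1_norm x - l1_norm y\<bar> \<le> l1_norm (\<lambda>i. x i - y i)"
proof -
  have neg: "(\<lambda>i. - y i) summable_on UNIV"
    using l1_plusD(2)[OF y] by (simp add: summable_on_uminus)
  then have "(\<lambda>i. x i - y i) summable_on UNIV"
    using summable_on_add[OF l1_plusD(2)[OF x] neg] by simp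
  then have "(\<lambda>i. norm (x i - y i)) summable_on UNIV"
    by (rule summable_on_iff_abs_summable_on_real[THEN iffD1])
  then have "norm (infsum (\<lambda>i. x i - y i) UNIV) \<le> (\<Sum>\<^sub>\<infinity>i. norm (x i - y i))"
    by (rule norm_infsum_bound)
  moreover have "infsum (\<lambda>i. x i - y i) UNIV = l1_norm x - l1_norm y"
    using infsum_add[OF l1_plusD(2)[OF x] neg] l1_plusD(3)[OF x] l1_plusD(3)[OF y]
    by (simp add: infsum_uminus)
  ultimately show ?thesis by (simp add: l1_norm_def)
qed

lemma l1_norm_continuous_on:
  assumes "l1_continuous_on T f" "\<And>t. t \<in> T \<Longrightarrow> f t \<in> l1_plus"
  shows "continuous_on T (\<lambda>t. l1_norm (f t))"
  unfolding continuous_on_def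
proof
  fix t assume t: "t \<in> T"
  have "((\<lambda>s. l1_norm (\<lambda>i. f s i - f t i)) \<longlongrightarrow> 0) (at t within T)"
    using assms(1) t by (simp add: l1_continuous_on_def)
  then have "((\<lambda>s. l1_norm (f s) - l1_norm (f t)) \<longlongrightarrow> 0) (at t within T)"
  proof (rule Lim_null_comparison[rotated])
    show "\<forall>\<^sub>F s in at t within T. norm (l1_norm (f s) - l1_norm (f t)) \<le> l1_norm (\<lambda>i. f s i - f t i)"
      unfolding eventually_at_filter
      by (intro always_eventually) (simp add: abs_l1_norm_diff_le assms(2) t)
  qed
  then show "((\<lambda>t. l1_norm (f t)) \<longlongrightarrow> l1_norm (f t)) (at t within T)"
    by (subst Lim_null)
qed

text \<open>Finite sets exhausting the index type along a sequence: measurability of limits, Dini's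
  theorem and dominated convergence are used for sequences, not for the filter of all finite
  sets.\<close>

definition initial_set :: "nat \<Rightarrow> 'i::countable set"
  where "initial_set n = {i. to_nat i < n}"

lemma finite_initial_set: "finite (initial_set n)"
proof (rule finite_imageD)
  show "finite (to_nat ` (initial_set n :: 'a set))"
    by (rule finite_subset[of _ "{..<n}"]) (auto simp: initial_set_def)
qed simp

lemma initial_set_mono: "m \<le> n \<Longrightarrow> initial_set m \<subseteq> initial_set n"
  by (auto simp: initial_set_def)

lemma sum_initial_set_tendsto:
  fixes x :: "'i::countable \<Rightarrow> real"
  assumes "x \<in> l1_plus"
  shows "(\<lambda>n. sum x (initial_set n)) \<longlonglongrightarrow> l1_norm x"
proof -
  have "(sum x \<longlongrightarrow> l1_norm x) (finite_subsets_at_top UNIV)"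
    using has_sum_infsum[OF l1_plusD(2)[OF assms]] l1_plusD(3)[OF assms] by (simp add: has_sum_def)
  moreover have "filterlim initial_set (finite_subsets_at_top (UNIV :: 'i set)) sequentially"
    unfolding filterlim_finite_subsets_at_top
  proof (intro allI impI)
    fix A :: "'i set" assume A: "finite A \<and> A \<subseteq> UNIV"
    then obtain n where n: "\<forall>i\<in>to_nat ` A. i < n" using finite_nat_bounded[of "to_nat ` A"] by auto
    show "\<forall>\<^sub>F n in sequentially. finite (initial_set n) \<and> A \<subseteq> initial_set n \<and> initial_set n \<subseteq> (UNIV :: 'i set)"
      unfolding eventually_sequentially using n finite_initial_set
      by (intro exI[of _ n]) (force simp: initial_set_def)
  qed
  ultimately show ?thesis by (rule filterlim_compose)
qed

text \<open>Inside \<open>\<Lambda>\<close> the flux cancels by antisymmetry; only the mass flowing in from outside remains.\<close>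

lemma sum_laplace_le:
  fixes x :: "int ^ 'd \<Rightarrow> real"
  assumes x: "x \<in> l1_plus" and fin: "finite \<Lambda>"
  shows "(\<Sum>i\<in>\<Lambda>. laplace x i) \<le> card (neighbours (0 :: int ^ 'd)) / (2 * real CARD('d)) * (l1_norm x - sum x \<Lambda>)"
proof -
  \<comment> \<open>\<open>N - \<Lambda>\<close> is the outer boundary, the sites from which mass
    can enter \<Lambda>.\<close>
  define N where "N = (\<Union>i\<in>\<Lambda>. neighbours i)"
  define c where "c = card (neighbours (0 :: int ^ 'd))"
  have finN: "finite N" using fin finite_neighbours by (auto simp: N_def)
  let ?a = "\<lambda>i j. of_bool (j \<in> neighbours i) * (x j - x i)"
  have "(\<Sum>i\<in>\<Lambda>. \<Sum>j\<in>neighbours i. x j - x i) = (\<Sum>i\<in>\<Lambda>. \<Sum>j\<in>\<Lambda> \<union> (N - \<Lambda>). ?a i j)"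
  proof (rule sum.cong[OF refl])
    fix i assume "i \<in> \<Lambda>"
    then have "neighbours i \<subseteq> \<Lambda> \<union> (N - \<Lambda>)" by (auto simp: N_def)
    then have "(\<Sum>j\<in>\<Lambda> \<union> (N - \<Lambda>). ?a i j) = (\<Sum>j\<in>neighbours i. ?a i j)"
      using fin finN by (intro sum.mono_neutral_right) auto
    then show "(\<Sum>j\<in>neighbours i. x j - x i) = (\<Sum>j\<in>\<Lambda> \<union> (N - \<Lambda>). ?a i j)" by simp
  qed
  also have "\<dots> = (\<Sum>i\<in>\<Lambda>. \<Sum>j\<in>\<Lambda>. ?a i j) + (\<Sum>i\<in>\<Lambda>. \<Sum>j\<in>N - \<Lambda>. ?a i j)"
    unfolding sum.distrib[symmetric] using fin finN
    by (intro sum.cong refl sum.union_disjoint) auto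
  also have "(\<Sum>i\<in>\<Lambda>. \<Sum>j\<in>\<Lambda>. ?a i j) = 0"
  proof -
    have "(\<Sum>i\<in>\<Lambda>. \<Sum>j\<in>\<Lambda>. ?a i j) = (\<Sum>j\<in>\<Lambda>. \<Sum>i\<in>\<Lambda>. ?a i j)" by (rule sum.swap)
    also have "\<dots> = (\<Sum>j\<in>\<Lambda>. \<Sum>i\<in>\<Lambda>. - ?a j i)"
      by (intro sum.cong refl) (simp add: neighbours_commute)
    finally show ?thesis by (simp add: sum_negf)
  qed
  also have "(\<Sum>i\<in>\<Lambda>. \<Sum>j\<in>N - \<Lambda>. ?a i j) = (\<Sum>j\<in>N - \<Lambda>. \<Sum>i\<in>\<Lambda>. ?a i j)" by (rule sum.swap)
  also have "\<dots> \<le> (\<Sum>j\<in>N - \<Lambda>. c * x j)"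
  proof (rule sum_mono)
    fix j
    \<comment> \<open>Dropping the outflow \<open>- x i\<close> keeps an upper bound because
      \<open>x\<close> is nonnegative; then \<open>x j\<close> is counted once for each neighbour of
      \<open>j\<close> in \<Lambda>.\<close>
    have "(\<Sum>i\<in>\<Lambda>. ?a i j) \<le> (\<Sum>i\<in>\<Lambda>. of_bool (i \<in> neighbours j) * x j)"
      using l1_plusD(1)[OF x] by (intro sum_mono) (auto simp: neighbours_commute[of j])
    also have "\<dots> = card (\<Lambda> \<inter> neighbours j) * x j"
      using fin by (simp add: sum_distrib_right[symmetric] of_bool_def sum.If_cases)
    also have "card (\<Lambda> \<inter> neighbours j) \<le> c"
      unfolding c_def card_neighbours[of j, symmetric] by (intro card_mono finite_neighbours) auto
    then have "card (\<Lambda> \<inter> neighbours j) * x j \<le> c * x j"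
      using l1_plusD(1)[OF x] by (intro mult_right_mono) auto
    finally show "(\<Sum>i\<in>\<Lambda>. ?a i j) \<le> c * x j" .
  qed
  also have "\<dots> = c * (sum x (\<Lambda> \<union> (N - \<Lambda>)) - sum x \<Lambda>)"
    using fin finN by (subst sum.union_disjoint) (auto simp: sum_distrib_left)
  also have "\<dots> \<le> c * (l1_norm x - sum x \<Lambda>)"
    using fin finN sum_le_l1_norm[OF x, of "\<Lambda> \<union> (N - \<Lambda>)"] by (intro mult_left_mono) auto
  finally have "(\<Sum>i\<in>\<Lambda>. \<Sum>j\<in>neighbours i. x j - x i) \<le> c * (l1_norm x - sum x \<Lambda>)" by simp
  then show ?thesis
    unfolding laplace_def c_def sum_divide_distrib[symmetric] by (simp add: divide_right_mono)
qed

text \<open>The sets where the gap is at least \<open>e\<close> are compact and decreasing, and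
  pointwise convergence makes their intersection empty, so one of them is empty. This makes the mass
  outside a large finite set small at all times of an interval at once.\<close>

lemma Dini_increasing:
  fixes g :: "nat \<Rightarrow> real \<Rightarrow> real"
  assumes g: "\<And>n. continuous_on {a..b} (g n)" and h: "continuous_on {a..b} h"
    and mono: "\<And>m n u. m \<le> n \<Longrightarrow> u \<in> {a..b} \<Longrightarrow> g m u \<le> g n u"
    and lim: "\<And>u. u \<in> {a..b} \<Longrightarrow> (\<lambda>n. g n u) \<longlonglongrightarrow> h u" and e: "0 < e"
  shows "\<forall>\<^sub>F n in sequentially. \<forall>u\<in>{a..b}. h u - g n u < e"
proof -
  define K where "K n = {a..b} \<inter> {u \<in> {a..b}. e \<le> h u - g n u}" for n
  have K: "compact (K n)" for n
    unfolding K_def using g h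
    by (intro compact_Int_closed continuous_on_closed_Collect_le continuous_intros) auto
  have "\<exists>n. K n = {}"
  proof (rule ccontr)
    assume "\<not> (\<exists>n. K n = {})"
    then have "\<Inter> (range K) \<noteq> {}"
      using mono by (intro compact_nest K) (auto simp: K_def, smt (verit) atLeastAtMost_iff)
    then obtain u where u: "\<And>n. u \<in> K n" by blast
    then have "u \<in> {a..b}" by (auto simp: K_def)
    then have "(\<lambda>n. h u - g n u) \<longlonglongrightarrow> h u - h u" by (intro tendsto_diff tendsto_const lim)
    then have "\<forall>\<^sub>F n in sequentially. h u - g n u < e" using e by (intro order_tendstoD) auto
    then show False using u by (auto simp: K_def eventually_sequentially not_less[symmetric])
  qed
  then obtain n where n: "K n = {}" by blast
  show ?thesis
    unfolding eventually_sequentially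
  proof (intro exI[of _ n] allI impI ballI)
    fix m u assume "n \<le> m" "u \<in> {a..b}"
    then show "h u - g m u < e" using n mono[of n m u] by (force simp: K_def not_le)
  qed
qed

section \<open>Properties of solutions\<close>

lemma set_lebesgue_integral_diff:
  fixes g :: "real \<Rightarrow> real"
  assumes g: "continuous_on {0..} g" and ab: "0 \<le> a" "a \<le> b"
  shows "(LINT s:{0..b}|lborel. g s) - (LINT s:{0..a}|lborel. g s) = integral {a..b} g"
proof -
  have *: "(LINT s:{0..c}|lborel. g s) = integral {0..c} g" if "0 \<le> c" for c
    using that g by (intro set_borel_integral_eq_integral(2) borel_integrable_atLeastAtMost')
      (auto elim: continuous_on_subset)
  have "integral {0..a} g + integral {a..b} g = integral {0..b} g"
    using ab g by (intro Henstock_Kurzweil_Integration.integral_combine integrable_continuous_real)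
      (auto elim: continuous_on_subset)
  then show ?thesis using * ab by simp
qed

lemma continuous_on_laplace:
  assumes "\<And>i. continuous_on T (\<lambda>u. x u i)"
  shows "continuous_on T (\<lambda>u. laplace (x u) i)"
  unfolding laplace_def by (intro continuous_intros assms) auto

context filtered_prob_space
begin

lemma adapted_measurable: "adapted F Y \<Longrightarrow> 0 \<le> u \<Longrightarrow> Y u \<in> borel_measurable M"
  by (rule measurable_F_imp[of u]) (simp_all add: adapted_def)

lemma solution_l1_plus:
  "continuous_l1_solution M F B \<sigma> X \<Longrightarrow> 0 \<le> t \<Longrightarrow> \<omega> \<in> space M \<Longrightarrow> X t \<omega> \<in> l1_plus"
  by (simp add: continuous_l1_solution_def)

lemma solution_continuous:
  "continuous_l1_solution M F B \<sigma> X \<Longrightarrow> \<omega> \<in> space M \<Longrightarrow> continuous_on {0..} (\<lambda>t. X t \<omega> i)"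
  by (simp add: continuous_l1_solution_def)

lemma solution_continuous_Icc:
  "continuous_l1_solution M F B \<sigma> X \<Longrightarrow> \<omega> \<in> space M \<Longrightarrow> 0 \<le> a \<Longrightarrow> continuous_on {a..b} (\<lambda>t. X t \<omega> i)"
  by (rule continuous_on_subset[OF solution_continuous]) auto

lemma solution_adapted:
  "continuous_l1_solution M F B \<sigma> X \<Longrightarrow> adapted F (\<lambda>t \<omega>. X t \<omega> i)"
  by (simp add: continuous_l1_solution_def)

lemma solution_norm_continuous:
  assumes "continuous_l1_solution M F B \<sigma> X"
  shows "AE \<omega> in M. continuous_on {0..} (\<lambda>t. l1_norm (X t \<omega>))"
proof -
  have "AE \<omega> in M. l1_continuous_on {0..} (\<lambda>t. X t \<omega>)"
    using assms by (simp add: continuous_l1_solution_def)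
  then show ?thesis
    by (rule AE_mp) (intro AE_I2 impI l1_norm_continuous_on, auto intro: solution_l1_plus[OF assms])
qed

text \<open>There are countably many sites and each equation holds for all times off one null set,
  so a single null set serves all \<open>i\<close>, \<open>a\<close> and \<open>b\<close>.\<close>

lemma solution_equation:
  fixes B :: "int ^ 'd \<Rightarrow> real \<Rightarrow> 'a \<Rightarrow> real"
  assumes sol: "continuous_l1_solution M F B \<sigma> X"
  obtains I where "\<And>i. ito_integral M F (B i) (\<lambda>s \<omega>. \<sigma> (X s \<omega> i)) (I i)"
    "AE \<omega> in M. \<forall>i a b. 0 \<le> a \<longrightarrow> a \<le> b \<longrightarrow>
      X b \<omega> i - X a \<omega> i = integral {a..b} (\<lambda>u. laplace (X u \<omega>) i) + (I i b \<omega> - I i a \<omega>)"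
proof -
  have "\<forall>i. \<exists>I. ito_integral M F (B i) (\<lambda>s \<omega>. \<sigma> (X s \<omega> i)) I \<and>
      (AE \<omega> in M. \<forall>t\<ge>0. X t \<omega> i = X 0 \<omega> i + (LINT s:{0..t}|lborel. laplace (X s \<omega>) i) + I t \<omega>)"
    using sol unfolding continuous_l1_solution_def by blast
  from choice[OF this] obtain I where I: "\<And>i. ito_integral M F (B i) (\<lambda>s \<omega>. \<sigma> (X s \<omega> i)) (I i)"
    and eq: "\<And>i. AE \<omega> in M. \<forall>t\<ge>0. X t \<omega> i = X 0 \<omega> i + (LINT s:{0..t}|lborel. laplace (X s \<omega>) i) + I i t \<omega>"
    by blast
  have "AE \<omega> in M. \<forall>i. \<forall>t\<ge>0. X t \<omega> i = X 0 \<omega> i + (LINT s:{0..t}|lborel. laplace (X s \<omega>) i) + I i t \<omega>"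
    unfolding AE_all_countable using eq by blast
  then have "AE \<omega> in M. \<forall>i a b. 0 \<le> a \<longrightarrow> a \<le> b \<longrightarrow>
      X b \<omega> i - X a \<omega> i = integral {a..b} (\<lambda>u. laplace (X u \<omega>) i) + (I i b \<omega> - I i a \<omega>)"
  proof (rule AE_mp, intro AE_I2 impI allI)
    fix \<omega> i and a b :: real
    assume \<omega>: "\<omega> \<in> space M" and ab: "0 \<le> a" "a \<le> b"
      and eq: "\<forall>i. \<forall>t\<ge>0. X t \<omega> i = X 0 \<omega> i + (LINT s:{0..t}|lborel. laplace (X s \<omega>) i) + I i t \<omega>"
    have "continuous_on {0..} (\<lambda>u. laplace (X u \<omega>) i)"
      by (intro continuous_on_laplace solution_continuous[OF sol \<omega>])
    from set_lebesgue_integral_diff[OF this ab]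
    show "X b \<omega> i - X a \<omega> i = integral {a..b} (\<lambda>u. laplace (X u \<omega>) i) + (I i b \<omega> - I i a \<omega>)"
      using eq[rule_format, of a i] eq[rule_format, of b i] ab by simp
  qed
  with I show thesis by (rule that)
qed

lemma solution_zero_spreads:
  fixes B :: "int ^ 'd \<Rightarrow> real \<Rightarrow> 'a \<Rightarrow> real"
  assumes W: "\<And>i. brownian_motion M F (B i)" and \<sigma>0: "\<sigma> 0 = 0"
    and sol: "continuous_l1_solution M F B \<sigma> X" and ab: "0 \<le> a" "a < b"
  shows "AE \<omega> in M. \<forall>i. (\<forall>u\<in>{a..b}. X u \<omega> i = 0) \<longrightarrow> (\<forall>j\<in>neighbours i. \<forall>u\<in>{a..b}. X u \<omega> j = 0)"
proof -
  obtain I where I: "\<And>i. ito_integral M F (B i) (\<lambda>s \<omega>. \<sigma> (X s \<omega> i)) (I i)"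
    and eq: "AE \<omega> in M. \<forall>i a b. 0 \<le> a \<longrightarrow> a \<le> b \<longrightarrow>
      X b \<omega> i - X a \<omega> i = integral {a..b} (\<lambda>u. laplace (X u \<omega>) i) + (I i b \<omega> - I i a \<omega>)"
    by (rule solution_equation[OF sol]) blast
  have X_nonneg: "0 \<le> X u \<omega> i" if "0 \<le> u" "\<omega> \<in> space M" for u \<omega> i
    using l1_plusD(1)[OF solution_l1_plus[OF sol that]] .
  \<comment> \<open>By nonnegativity \<open>\<le> 0\<close> means \<open>= 0\<close>; the inequality
    is the form covered by \<open>sets_path_bounded\<close>.\<close>
  have "AE \<omega> in M. \<forall>i. \<omega> \<in> {\<omega> \<in> space M. \<forall>u\<in>{a..b}. X u \<omega> i \<le> 0} \<longrightarrow> I i b \<omega> = I i a \<omega>"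
    unfolding AE_all_countable
  proof
    fix i
    show "AE \<omega> in M. \<omega> \<in> {\<omega> \<in> space M. \<forall>u\<in>{a..b}. X u \<omega> i \<le> 0} \<longrightarrow> I i b \<omega> = I i a \<omega>"
    proof (rule ito_integral_locality[OF W I ab(1) less_imp_le[OF ab(2)]])
      show "{\<omega> \<in> space M. \<forall>u\<in>{a..b}. X u \<omega> i \<le> 0} \<in> events"
      proof (rule sets_path_bounded[OF ab])
        fix u assume "a \<le> u" "u \<le> b"
        then show "(\<lambda>\<omega>. X u \<omega> i) \<in> borel_measurable M"
          using adapted_measurable[OF solution_adapted[OF sol, of i], of u] ab by simp
      next
        fix \<omega> assume "\<omega> \<in> space M"
        then show "continuous_on {a..b} (\<lambda>u. X u \<omega> i)"
          by (rule solution_continuous_Icc[OF sol _ ab(1)])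
      qed
      fix \<omega> u assume "\<omega> \<in> {\<omega> \<in> space M. \<forall>u\<in>{a..b}. X u \<omega> i \<le> 0}" "u \<in> {a..b}"
      then have "X u \<omega> i = 0" using X_nonneg[of u \<omega> i] ab by force
      then show "\<sigma> (X u \<omega> i) = 0" using \<sigma>0 by simp
    qed
  qed
  with eq show ?thesis
  proof (rule AE_mp[OF _ AE_mp], intro AE_I2 impI allI ballI)
    fix \<omega> i j u
    assume \<omega>: "\<omega> \<in> space M" and zero: "\<forall>u\<in>{a..b}. X u \<omega> i = 0" and j: "j \<in> neighbours i" and u: "u \<in> {a..b}"
      and loc: "\<forall>i. \<omega> \<in> {\<omega> \<in> space M. \<forall>u\<in>{a..b}. X u \<omega> i \<le> 0} \<longrightarrow> I i b \<omega> = I i a \<omega>"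
      and eq: "\<forall>i a b. 0 \<le> a \<longrightarrow> a \<le> b \<longrightarrow>
        X b \<omega> i - X a \<omega> i = integral {a..b} (\<lambda>u. laplace (X u \<omega>) i) + (I i b \<omega> - I i a \<omega>)"
    have "I i b \<omega> = I i a \<omega>" using loc zero \<omega> by simp
    then have int0: "integral {a..b} (\<lambda>u. laplace (X u \<omega>) i) = 0"
      using eq[rule_format, of a b i] zero ab by simp
    have "continuous_on {a..b} (\<lambda>u. laplace (X u \<omega>) i)"
      by (rule continuous_on_laplace[OF solution_continuous_Icc[OF sol \<omega> ab(1)]])
    \<comment> \<open>At an empty site the Laplacian only collects nonnegative values, so the zero
      integral of this continuous function makes it vanish at every time.\<close>
    moreover have "0 \<le> laplace (X v \<omega>) i" if "v \<in> {a..b}" for v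
      using X_nonneg[OF _ \<omega>, of v] zero that ab by (auto simp: laplace_def intro!: divide_nonneg_nonneg sum_nonneg)
    ultimately have "laplace (X u \<omega>) i = 0"
      using integral_eq_0_iff[of a b "\<lambda>u. laplace (X u \<omega>) i"] ab int0 u by blast
    then show "X u \<omega> j = 0"
      using laplace_eq_0_imp_neighbours_0[of "X u \<omega>" i j] X_nonneg[OF _ \<omega>, of u] zero u ab j by simp
  qed
qed

text \<open>Markov's inequality for a nonnegative supermartingale, localized to an event
  \<open>G\<close> known at time \<open>s\<close> so that the estimates can later be summed over
  disjoint cases. \<open>stopped_sum_estimate\<close> treats the finite sets
  \<open>initial_set n\<close>; their inflow is at most \<delta> for large \<open>n\<close> by
  \<open>sum_laplace_le\<close> and Dini's theorem.\<close>

lemma solution_mass_estimate: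
  fixes B :: "int ^ 'd \<Rightarrow> real \<Rightarrow> 'a \<Rightarrow> real"
  assumes W: "\<And>i. brownian_motion M F (B i)" and \<sigma>: "continuous_on {0..} \<sigma>"
    and sol: "continuous_l1_solution M F B \<sigma> X"
    and st: "0 \<le> s" "s < t" and G: "G \<in> sets (F s)" "\<And>\<omega>. \<omega> \<in> G \<Longrightarrow> l1_norm (X s \<omega>) \<le> \<epsilon>"
    and pos: "0 \<le> \<epsilon>" "0 < l"
  shows "l * prob (G \<inter> {\<omega> \<in> space M. l < l1_norm (X t \<omega>)}) \<le> \<epsilon> * prob G"
proof -
  obtain I where I: "\<And>i. ito_integral M F (B i) (\<lambda>s \<omega>. \<sigma> (X s \<omega> i)) (I i)"
    and eq: "AE \<omega> in M. \<forall>i a b. 0 \<le> a \<longrightarrow> a \<le> b \<longrightarrow>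
      X b \<omega> i - X a \<omega> i = integral {a..b} (\<lambda>u. laplace (X u \<omega>) i) + (I i b \<omega> - I i a \<omega>)"
    by (rule solution_equation[OF sol]) blast
  note plus = solution_l1_plus[OF sol]
  have X_nonneg: "0 \<le> X u \<omega> i" if "0 \<le> u" "\<omega> \<in> space M" for u \<omega> i
    using l1_plusD(1)[OF plus[OF that]] .
  have XF: "(\<lambda>\<omega>. X u \<omega> i) \<in> borel_measurable (F u)" if "0 \<le> u" for u i
    using solution_adapted[OF sol, of i] that by (simp add: adapted_def)
  have XM: "(\<lambda>\<omega>. X u \<omega> i) \<in> borel_measurable M" if "0 \<le> u" for u i
    using adapted_measurable[OF solution_adapted[OF sol, of i] that] .
  define f where "f n u \<omega> = (\<Sum>i\<in>initial_set n. laplace (X u \<omega>) i)" for n u \<omega>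
  have f_adapted: "adapted F (f n)" for n
    unfolding adapted_def f_def laplace_def
    by (intro allI impI borel_measurable_sum borel_measurable_divide borel_measurable_diff XF borel_measurable_const)
  have fM: "f n u \<in> borel_measurable M" if "0 \<le> u" for n u
    by (rule adapted_measurable[OF f_adapted that])
  have f_cont: "continuous_on {0..} (\<lambda>u. f n u \<omega>)" if "\<omega> \<in> space M" for n \<omega>
    unfolding f_def by (intro continuous_on_sum continuous_on_laplace solution_continuous[OF sol that])
  have drift: "AE \<omega> in M. \<forall>a b c. 0 \<le> a \<longrightarrow> a \<le> b \<longrightarrow> (\<forall>u\<in>{a..b}. f n u \<omega> \<le> c) \<longrightarrow>
      (\<Sum>i\<in>initial_set n. X b \<omega> i) - (\<Sum>i\<in>initial_set n. X a \<omega> i) \<le>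
        c * (b - a) + (\<Sum>i\<in>initial_set n. I i b \<omega> - I i a \<omega>)" for n
    using eq
  proof (rule AE_mp, intro AE_I2 impI allI)
    fix \<omega> and a b c :: real
    assume \<omega>: "\<omega> \<in> space M" and ab: "0 \<le> a" "a \<le> b" and le: "\<forall>u\<in>{a..b}. f n u \<omega> \<le> c"
      and eq: "\<forall>i a b. 0 \<le> a \<longrightarrow> a \<le> b \<longrightarrow>
        X b \<omega> i - X a \<omega> i = integral {a..b} (\<lambda>u. laplace (X u \<omega>) i) + (I i b \<omega> - I i a \<omega>)"
    have cont: "continuous_on {a..b} (\<lambda>u. laplace (X u \<omega>) i)" for i
      by (rule continuous_on_laplace[OF solution_continuous_Icc[OF sol \<omega> ab(1)]])
    have "(\<Sum>i\<in>initial_set n. integral {a..b} (\<lambda>u. laplace (X u \<omega>) i)) = integral {a..b} (\<lambda>u. f n u \<omega>)"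
      unfolding f_def using cont
      by (intro Henstock_Kurzweil_Integration.integral_sum[symmetric] integrable_continuous_real finite_initial_set)
    also have "\<dots> \<le> integral {a..b} (\<lambda>_. c)"
    proof (rule integral_le)
      show "(\<lambda>u. f n u \<omega>) integrable_on {a..b}"
        using ab by (intro integrable_continuous_real continuous_on_subset[OF f_cont[OF \<omega>]]) auto
    qed (use le in auto)
    also have "\<dots> = c * (b - a)" using ab by simp
    finally have "(\<Sum>i\<in>initial_set n. integral {a..b} (\<lambda>u. laplace (X u \<omega>) i)) \<le> c * (b - a)" .
    moreover have "(\<Sum>i\<in>initial_set n. X b \<omega> i) - (\<Sum>i\<in>initial_set n. X a \<omega> i) =
        (\<Sum>i\<in>initial_set n. integral {a..b} (\<lambda>u. laplace (X u \<omega>) i) + (I i b \<omega> - I i a \<omega>))"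
      unfolding sum_subtractf[symmetric] using eq ab by (intro sum.cong) auto
    ultimately show "(\<Sum>i\<in>initial_set n. X b \<omega> i) - (\<Sum>i\<in>initial_set n. X a \<omega> i) \<le>
        c * (b - a) + (\<Sum>i\<in>initial_set n. I i b \<omega> - I i a \<omega>)"
      by (simp add: sum.distrib)
  qed
  have normM: "(\<lambda>\<omega>. l1_norm (X u \<omega>)) \<in> borel_measurable M" if "0 \<le> u" for u
  proof (rule borel_measurable_LIMSEQ_real)
    show "(\<lambda>n. \<Sum>i\<in>initial_set n. X u \<omega> i) \<longlonglongrightarrow> l1_norm (X u \<omega>)" if "\<omega> \<in> space M" for \<omega>
      by (rule sum_initial_set_tendsto[OF plus[OF \<open>0 \<le> u\<close> that]])
    show "(\<lambda>\<omega>. \<Sum>i\<in>initial_set n. X u \<omega> i) \<in> borel_measurable M" for n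
      by (rule borel_measurable_sum[OF XM[OF that]])
  qed
  have GM: "G \<in> events" using sets_F_subset[OF st(1) G(1)] .
  define E where "E = G \<inter> {\<omega> \<in> space M. l < l1_norm (X t \<omega>)}"
  have t: "0 \<le> t" using st by simp
  note [measurable] = normM[OF t] GM
  have EM: "E \<in> events" unfolding E_def by measurable
  have approx: "l * prob E \<le> (\<epsilon> + 2 * \<delta> * (t - s)) * prob G" if \<delta>: "0 < \<delta>" for \<delta>
  proof -
    \<comment> \<open>The cap on the values grows with the set of sites, so each path with
      continuous mass satisfies it for large \<open>n\<close>.\<close>
    define S where "S n = {\<omega> \<in> space M. (\<forall>i\<in>initial_set n. \<forall>u\<in>{s..t}. X u \<omega> i \<le> real n) \<and> (\<forall>u\<in>{s..t}. f n u \<omega> \<le> \<delta>)}" for n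
    have SM: "S n \<in> events" for n
    proof -
      have "{\<omega> \<in> space M. \<forall>u\<in>{s..t}. X u \<omega> i \<le> real n} \<in> events" for i
        using st by (intro sets_path_bounded XM solution_continuous_Icc[OF sol]) auto
      moreover have "{\<omega> \<in> space M. \<forall>u\<in>{s..t}. f n u \<omega> \<le> \<delta>} \<in> events"
        using st by (intro sets_path_bounded fM continuous_on_subset[OF f_cont]) auto
      ultimately show ?thesis
        unfolding S_def
        by (intro sets.sets_Collect_conj sets.sets_Collect_finite_All[OF _ finite_initial_set])
    qed
    define T where "T n = S n \<inter> {\<omega> \<in> space M. l < (\<Sum>i\<in>initial_set n. X t \<omega> i)}" for n
    have TM: "T n \<in> events" for n
    proof -
      have [measurable]: "(\<lambda>\<omega>. \<Sum>i\<in>initial_set n. X t \<omega> i) \<in> borel_measurable M"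
        by (intro borel_measurable_sum XM t)
      note [measurable] = SM[of n]
      show ?thesis unfolding T_def by measurable
    qed
    have bound: "l * prob (G \<inter> T n) \<le> (\<epsilon> + 2 * \<delta> * (t - s)) * prob G" for n
    proof -
      have "l * prob (G \<inter> S n \<inter> {\<omega> \<in> space M. l < (\<Sum>i\<in>initial_set n. X t \<omega> i)}) \<le> (\<epsilon> + 2 * \<delta> * (t - s)) * prob G"
      proof (rule stopped_sum_estimate[where x = "\<lambda>i u \<omega>. X u \<omega> i" and W = B and I = I and \<sigma> = \<sigma> and f = "f n" and R = n])
        show "(\<Sum>i\<in>initial_set n. X s \<omega> i) \<le> \<epsilon>" if "\<omega> \<in> G" for \<omega>
        proof -
          have "\<omega> \<in> space M" using that sets.sets_into_space[OF GM] by blast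
          then show ?thesis
            using sum_le_l1_norm[OF plus[OF st(1)] finite_initial_set, of \<omega> n] G(2)[OF that] by simp
        qed
      qed (use finite_initial_set X_nonneg solution_adapted[OF sol] solution_continuous[OF sol] W I \<sigma> f_adapted f_cont
          drift st G SM \<delta> pos in \<open>auto simp: S_def\<close>)
      then show ?thesis by (simp add: T_def Int_assoc)
    qed
    have "AE \<omega> in M. \<omega> \<in> E \<longrightarrow> (\<forall>\<^sub>F n in sequentially. \<omega> \<in> T n)"
      using solution_norm_continuous[OF sol]
    proof (rule AE_mp, intro AE_I2 impI)
      fix \<omega> assume \<omega>: "\<omega> \<in> space M" and cont: "continuous_on {0..} (\<lambda>t. l1_norm (X t \<omega>))" and E: "\<omega> \<in> E"
      have cont': "continuous_on {s..t} (\<lambda>u. l1_norm (X u \<omega>))"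
        by (rule continuous_on_subset[OF cont]) (use st in auto)
      obtain R where R: "\<And>u. u \<in> {s..t} \<Longrightarrow> l1_norm (X u \<omega>) \<le> R"
        using continuous_attains_sup[OF _ _ cont'] st by force
      \<comment> \<open>The factor in \<open>sum_laplace_le\<close>. A gap below
        \<open>\<delta> / (c + 1)\<close> brings the inflow to at most \<delta>, also for
        \<open>c = 0\<close>.\<close>
      define c where "c = card (neighbours (0 :: int ^ 'd)) / (2 * real CARD('d))"
      have c: "0 \<le> c" by (simp add: c_def)
      have "\<forall>\<^sub>F n in sequentially. \<forall>u\<in>{s..t}. l1_norm (X u \<omega>) - (\<Sum>i\<in>initial_set n. X u \<omega> i) < \<delta> / (c + 1)"
      proof (rule Dini_increasing)
        show "continuous_on {s..t} (\<lambda>u. \<Sum>i\<in>initial_set n. X u \<omega> i)" for n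
          by (intro continuous_on_sum solution_continuous_Icc[OF sol \<omega> st(1)])
        show "(\<Sum>i\<in>initial_set m. X u \<omega> i) \<le> (\<Sum>i\<in>initial_set n. X u \<omega> i)" if "m \<le> n" "u \<in> {s..t}" for m n u
          using that st X_nonneg[OF _ \<omega>] by (intro sum_mono2 finite_initial_set initial_set_mono) auto
        show "(\<lambda>n. \<Sum>i\<in>initial_set n. X u \<omega> i) \<longlonglongrightarrow> l1_norm (X u \<omega>)" if "u \<in> {s..t}" for u
          using that st by (intro sum_initial_set_tendsto plus \<omega>) auto
      qed (use cont' \<delta> c in auto)
      moreover have "\<forall>\<^sub>F n in sequentially. l < (\<Sum>i\<in>initial_set n. X t \<omega> i)"
        using E by (intro order_tendstoD(1)[OF sum_initial_set_tendsto[OF plus[OF t \<omega>]]]) (simp add: E_def)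
      moreover have "\<forall>\<^sub>F n in sequentially. R \<le> real n"
        using filterlim_real_sequentially by (simp add: filterlim_at_top)
      ultimately show "\<forall>\<^sub>F n in sequentially. \<omega> \<in> T n"
      proof eventually_elim
        case (elim n)
        have "X u \<omega> i \<le> real n" if "u \<in> {s..t}" for i u
          using sum_le_l1_norm[OF plus[OF _ \<omega>, of u], of "{i}"] R[OF that] elim(3) that st by simp
        moreover have "f n u \<omega> \<le> \<delta>" if u: "u \<in> {s..t}" for u
        proof -
          have "f n u \<omega> \<le> c * (l1_norm (X u \<omega>) - (\<Sum>i\<in>initial_set n. X u \<omega> i))"
            unfolding f_def c_def using u st by (intro sum_laplace_le plus finite_initial_set \<omega>) auto
          also have "\<dots> \<le> c * (\<delta> / (c + 1))"
            using elim(1) u by (intro mult_left_mono[OF less_imp_le c]) blast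
          also have "\<dots> \<le> \<delta>" using c \<delta> by (simp add: field_simps)
          finally show ?thesis .
        qed
        ultimately show ?case using \<omega> elim(2) by (simp add: T_def S_def)
      qed
    qed
    then have lim: "(\<lambda>n. prob (E - T n)) \<longlonglongrightarrow> 0"
      by (rule prob_diff_tendsto_0[OF EM TM])
    have "l * prob E \<le> (\<epsilon> + 2 * \<delta> * (t - s)) * prob G + l * prob (E - T n)" for n
    proof -
      have "prob E \<le> prob ((G \<inter> T n) \<union> (E - T n))"
        using GM TM[of n] EM by (intro finite_measure_mono) (auto simp: E_def)
      also have "\<dots> \<le> prob (G \<inter> T n) + prob (E - T n)"
        using GM TM[of n] EM by (intro measure_Un_le) auto
      finally have "l * prob E \<le> l * (prob (G \<inter> T n) + prob (E - T n))"
        using pos by (intro mult_left_mono) auto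
      then show ?thesis using bound[of n] by (simp add: distrib_left)
    qed
    moreover have "(\<lambda>n. (\<epsilon> + 2 * \<delta> * (t - s)) * prob G + l * prob (E - T n)) \<longlonglongrightarrow> (\<epsilon> + 2 * \<delta> * (t - s)) * prob G + l * 0"
      by (intro tendsto_intros lim)
    ultimately show ?thesis
      using LIMSEQ_le_const[of _ _ "l * prob E"] by auto
  qed
  have "l * prob E \<le> \<epsilon> * prob G"
  proof (rule field_le_epsilon)
    fix e :: real assume e: "0 < e"
    define \<delta> where "\<delta> = e / (2 * (t - s))"
    have \<delta>: "0 < \<delta>" "2 * \<delta> * (t - s) = e" using e st by (simp_all add: \<delta>_def field_simps)
    have "l * prob E \<le> (\<epsilon> + e) * prob G" using approx[OF \<delta>(1)] \<delta>(2) by simp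
    also have "\<dots> \<le> \<epsilon> * prob G + e"
      using e by (simp add: distrib_right mult_left_le)
    finally show "l * prob E \<le> \<epsilon> * prob G + e" .
  qed
  then show ?thesis by (simp add: E_def)
qed


text \<open>Absorption concerns a random real time \<open>s\<close>, but estimates exist for fixed
  times only. If the mass is 0 at \<open>s\<close>, it is at most any given \<epsilon> > 0 at
  rational times shortly after. Conditioning on the first such time in a finite set, as in Doob's
  maximal inequality, bounds by \<open>\<epsilon> / l\<close> the probability of a mass above
  \<open>l\<close> at a later fixed time. The finite sets then exhaust the rationals before
  \<epsilon> tends to 0.\<close>

lemma solution_absorbed_at_0:
  fixes B :: "int ^ 'd \<Rightarrow> real \<Rightarrow> 'a \<Rightarrow> real"
  assumes W: "\<And>i. brownian_motion M F (B i)" and \<sigma>: "continuous_on {0..} \<sigma>"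
    and sol: "continuous_l1_solution M F B \<sigma> X"
  shows "AE \<omega> in M. \<forall>s t. 0 \<le> s \<longrightarrow> s \<le> t \<longrightarrow> (\<forall>i. X s \<omega> i = 0) \<longrightarrow> (\<forall>i. X t \<omega> i = 0)"
proof -
  let ?N = "\<lambda>t \<omega>. l1_norm (X t \<omega>)"
  note plus = solution_l1_plus[OF sol]
  have NF: "?N u \<in> borel_measurable (F u)" if u: "0 \<le> u" for u
  proof (rule borel_measurable_LIMSEQ_real)
    show "(\<lambda>n. \<Sum>i\<in>initial_set n. X u \<omega> i) \<longlonglongrightarrow> l1_norm (X u \<omega>)" if "\<omega> \<in> space (F u)" for \<omega>
      using that u by (intro sum_initial_set_tendsto plus) (auto simp: space_F)
    show "(\<lambda>\<omega>. \<Sum>i\<in>initial_set n. X u \<omega> i) \<in> borel_measurable (F u)" for n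
      using solution_adapted[OF sol] u by (intro borel_measurable_sum) (simp add: adapted_def)
  qed
  have NM: "?N u \<in> borel_measurable M" if "0 \<le> u" for u
    by (rule measurable_F_imp[OF that NF[OF that]])
  have small_then_large: "l * prob {\<omega> \<in> space M. (\<exists>q\<in>D. ?N q \<omega> \<le> \<epsilon>) \<and> l < ?N t \<omega>} \<le> \<epsilon>"
    if D: "finite D" "D \<subseteq> {0..<t}" and pos: "0 \<le> \<epsilon>" "0 < l" for D t \<epsilon> l
  proof (cases "D = {}")
    case False
    then have t: "0 \<le> t" using D by force
    \<comment> \<open>\<open>q\<close> is the first time in \<open>D\<close> with small mass. These
      events are disjoint and known at \<open>q\<close>, so the estimates add up to at most
      \<epsilon>.\<close>
    define G where "G q = {\<omega> \<in> space M. ?N q \<omega> \<le> \<epsilon> \<and> (\<forall>p\<in>{p \<in> D. p < q}. \<epsilon> < ?N p \<omega>)}" for q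
    have GF: "G q \<in> sets (F q)" if q: "q \<in> D" for q
    proof -
      have q0: "0 \<le> q" using q D by auto
      have "{\<omega> \<in> space (F q). ?N q \<omega> \<le> \<epsilon>} \<in> sets (F q)"
        using NF[OF q0] by measurable
      moreover have "{\<omega> \<in> space (F q). \<epsilon> < ?N p \<omega>} \<in> sets (F q)" if "p \<in> {p \<in> D. p < q}" for p
      proof -
        have [measurable]: "?N p \<in> borel_measurable (F q)"
          using that D q0 by (intro measurable_F_mono[OF _ _ NF]) auto
        show ?thesis by measurable
      qed
      ultimately have "{\<omega> \<in> space (F q). ?N q \<omega> \<le> \<epsilon> \<and> (\<forall>p\<in>{p \<in> D. p < q}. \<epsilon> < ?N p \<omega>)} \<in> sets (F q)"
        using D(1) by (intro sets.sets_Collect_conj sets.sets_Collect_finite_All) auto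
      then show ?thesis by (simp add: G_def space_F[OF q0])
    qed
    have GM: "G q \<in> events" if "q \<in> D" for q
      using sets_F_subset[OF _ GF[OF that]] that D by auto
    define L where "L = {\<omega> \<in> space M. l < ?N t \<omega>}"
    have LM: "L \<in> events" unfolding L_def using NM[OF t] by measurable
    have disj: "disjoint_family_on G D"
      unfolding disjoint_family_on_def
    proof (intro ballI impI)
      fix p q assume "p \<in> D" "q \<in> D" "p \<noteq> q"
      then show "G p \<inter> G q = {}"
        by (cases p q rule: linorder_cases) (force simp: G_def not_le[symmetric])+
    qed
    have "{\<omega> \<in> space M. (\<exists>q\<in>D. ?N q \<omega> \<le> \<epsilon>) \<and> l < ?N t \<omega>} \<subseteq> (\<Union>q\<in>D. G q \<inter> L)"
    proof
      fix \<omega> assume \<omega>: "\<omega> \<in> {\<omega> \<in> space M. (\<exists>q\<in>D. ?N q \<omega> \<le> \<epsilon>) \<and> l < ?N t \<omega>}"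
      define C where "C = {q \<in> D. ?N q \<omega> \<le> \<epsilon>}"
      have C: "finite C" "C \<noteq> {}" using \<omega> D(1) by (auto simp: C_def)
      then have "Min C \<in> D" "?N (Min C) \<omega> \<le> \<epsilon>" using Min_in[OF C] by (auto simp: C_def)
      moreover have "\<epsilon> < ?N p \<omega>" if "p \<in> D" "p < Min C" for p
        using that C(1) by (force simp: C_def not_le[symmetric])
      ultimately show "\<omega> \<in> (\<Union>q\<in>D. G q \<inter> L)" using \<omega> by (auto simp: G_def L_def)
    qed
    then have "prob {\<omega> \<in> space M. (\<exists>q\<in>D. ?N q \<omega> \<le> \<epsilon>) \<and> l < ?N t \<omega>} \<le> prob (\<Union>q\<in>D. G q \<inter> L)"
      by (rule finite_measure_mono[OF _ sets.finite_UN[OF D(1) sets.Int[OF GM LM]]])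
    also have "\<dots> \<le> (\<Sum>q\<in>D. prob (G q \<inter> L))"
      using GM LM D(1) by (intro finite_measure_subadditive_finite) auto
    finally have "l * prob {\<omega> \<in> space M. (\<exists>q\<in>D. ?N q \<omega> \<le> \<epsilon>) \<and> l < ?N t \<omega>} \<le> (\<Sum>q\<in>D. l * prob (G q \<inter> L))"
      using pos by (simp add: sum_distrib_left[symmetric])
    also have "\<dots> \<le> (\<Sum>q\<in>D. \<epsilon> * prob (G q))"
    proof (rule sum_mono)
      fix q assume q: "q \<in> D"
      show "l * prob (G q \<inter> L) \<le> \<epsilon> * prob (G q)"
        unfolding L_def
        by (rule solution_mass_estimate[OF W \<sigma> sol _ _ GF[OF q] _ pos]) (use q D in \<open>auto simp: G_def\<close>)
    qed
    also have "\<dots> = \<epsilon> * prob (\<Union>q\<in>D. G q)"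
      using GM D(1) disj by (subst finite_measure_finite_Union) (auto simp: sum_distrib_left)
    also have "\<dots> \<le> \<epsilon>" using pos by (simp add: mult_left_le)
    finally show ?thesis .
  qed (use that in simp)
  define Q where "Q t = \<rat> \<inter> {0..<t}" for t :: real
  have Q_countable: "countable (Q t)" for t unfolding Q_def using countable_rat by auto
  define E where "E t \<epsilon> l = {\<omega> \<in> space M. (\<exists>q\<in>Q t. ?N q \<omega> \<le> \<epsilon>) \<and> l < ?N t \<omega>}" for t \<epsilon> l
  have E_events: "E t \<epsilon> l \<in> events" and E_prob: "l * prob (E t \<epsilon> l) \<le> \<epsilon>"
    if t: "0 < t" and pos: "0 \<le> \<epsilon>" "0 < l" for t \<epsilon> l
  proof -
    have Q_ne: "Q t \<noteq> {}" using t by (auto simp: Q_def)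
    \<comment> \<open>Initial segments of an enumeration of \<open>Q t\<close> are finite and
      increasing, so continuity of the measure from below applies.\<close>
    define D where "D n = from_nat_into (Q t) ` {..<n}" for n
    have D: "finite (D n)" "D n \<subseteq> {0..<t}" for n
      using from_nat_into[OF Q_ne] by (auto simp: D_def Q_def)
    define A where "A n = {\<omega> \<in> space M. (\<exists>q\<in>D n. ?N q \<omega> \<le> \<epsilon>) \<and> l < ?N t \<omega>}" for n
    have AM: "A n \<in> events" for n
    proof -
      have "{\<omega> \<in> space M. ?N q \<omega> \<le> \<epsilon>} \<in> events" if "q \<in> D n" for q
        using NM[of q] D(2)[of n] that by (auto intro!: borel_measurable_le)
      moreover have "{\<omega> \<in> space M. l < ?N t \<omega>} \<in> events"
        using NM[of t] t by (auto intro!: borel_measurable_less)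
      ultimately show ?thesis
        unfolding A_def by (intro sets.sets_Collect_conj sets.sets_Collect_finite_Ex D(1))
    qed
    have "Q t = (\<Union>n. D n)"
    proof -
      have "range (from_nat_into (Q t)) = Q t" by (rule range_from_nat_into[OF Q_ne Q_countable])
      then show ?thesis by (auto simp: D_def)
    qed
    then have E_eq: "E t \<epsilon> l = (\<Union>n. A n)" by (auto simp: E_def A_def)
    then show "E t \<epsilon> l \<in> events" using AM by auto
    have "incseq A" by (auto simp: incseq_def A_def D_def)
    then have "(\<lambda>n. prob (A n)) \<longlonglongrightarrow> prob (E t \<epsilon> l)"
      unfolding E_eq using AM by (intro finite_Lim_measure_incseq) auto
    then have "(\<lambda>n. l * prob (A n)) \<longlonglongrightarrow> l * prob (E t \<epsilon> l)" by (intro tendsto_intros)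
    then show "l * prob (E t \<epsilon> l) \<le> \<epsilon>"
      using small_then_large[OF D pos] by (intro LIMSEQ_le_const2) (auto simp: A_def)
  qed
  define inv where "inv k = inverse (real (Suc k))" for k
  have inv: "0 < inv k" for k by (simp add: inv_def)
  have null: "AE \<omega> in M. \<exists>k. \<omega> \<notin> E t (inv k) (inv m)" if t: "0 < t" for t m
  proof -
    let ?B = "\<Inter>k. E t (inv k) (inv m)"
    have B: "?B \<in> events"
      by (intro sets.countable_INT') (use E_events[OF t less_imp_le[OF inv] inv] in auto)
    have "inv m * prob ?B \<le> inv k" for k
    proof -
      have "prob ?B \<le> prob (E t (inv k) (inv m))"
        using E_events[OF t less_imp_le[OF inv] inv] by (intro finite_measure_mono) auto
      then have "inv m * prob ?B \<le> inv m * prob (E t (inv k) (inv m))"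
        using inv by (intro mult_left_mono) (auto intro: less_imp_le)
      also have "\<dots> \<le> inv k" by (rule E_prob[OF t less_imp_le[OF inv] inv])
      finally show ?thesis .
    qed
    moreover have "inv \<longlonglongrightarrow> 0" unfolding inv_def by (rule LIMSEQ_inverse_real_of_nat)
    ultimately have "inv m * prob ?B \<le> 0" by (intro LIMSEQ_le_const) auto
    then have "prob ?B = 0" using inv[of m] by (simp add: mult_le_0_iff antisym)
    then have "?B \<in> null_sets M" using B by (intro null_setsI) (auto simp: emeasure_eq_measure)
    then have "AE \<omega> in M. \<omega> \<notin> ?B" by (rule AE_not_in)
    then show ?thesis by simp
  qed
  have "AE \<omega> in M. \<forall>t\<in>\<rat> \<inter> {0<..}. \<forall>m. \<exists>k. \<omega> \<notin> E t (inv k) (inv m)"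
    using countable_rat null by (subst AE_ball_countable) (auto simp: AE_all_countable)
  then show ?thesis
    using solution_norm_continuous[OF sol]
  proof (rule AE_mp[OF _ AE_mp], intro AE_I2 impI allI)
    fix \<omega> s t i
    assume \<omega>: "\<omega> \<in> space M" and st: "0 \<le> s" "s \<le> t" and zero: "\<forall>i. X s \<omega> i = 0"
      and cont: "continuous_on {0..} (\<lambda>t. ?N t \<omega>)"
      and *: "\<forall>t\<in>\<rat> \<inter> {0<..}. \<forall>m. \<exists>k. \<omega> \<notin> E t (inv k) (inv m)"
    have Ns: "?N s \<omega> = 0" using zero by (simp add: l1_norm_def)
    have near: "\<exists>d>0. \<forall>v\<ge>0. \<bar>v - u\<bar> < d \<longrightarrow> \<bar>?N v \<omega> - ?N u \<omega>\<bar> < e" if "0 \<le> u" "0 < e" for u e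
      using cont that unfolding continuous_on_iff dist_real_def by (metis atLeast_iff)
    \<comment> \<open>Continuity replaces \<open>t\<close> by a rational \<open>r\<close> shortly
      before it with positive mass, and \<open>s\<close> by a rational \<open>q\<close> between
      \<open>s\<close> and \<open>r\<close>. The level \<open>inv m\<close> is fixed by
      \<open>r\<close>; it determines \<open>k\<close>, and only then is \<open>q\<close> chosen
      with mass at most \<open>inv k\<close>.\<close>
    have "?N t \<omega> \<le> 0"
    proof (rule ccontr)
      assume "\<not> ?N t \<omega> \<le> 0"
      then have Nt: "0 < ?N t \<omega>" by simp
      then have "s < t" using Ns st by (cases "s = t") auto
      obtain d where d: "0 < d" "\<And>v. 0 \<le> v \<Longrightarrow> \<bar>v - t\<bar> < d \<Longrightarrow> \<bar>?N v \<omega> - ?N t \<omega>\<bar> < ?N t \<omega>"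
        using near[OF order_trans[OF st] Nt] by blast
      have "max s (t - d) < t" using \<open>s < t\<close> d by simp
      then obtain r where r: "r \<in> \<rat>" "max s (t - d) < r" "r < t" using Rats_dense_in_real by blast
      then have "0 < ?N r \<omega>" using d(2)[of r] st by auto
      then obtain m where m: "inv m < ?N r \<omega>" unfolding inv_def using reals_Archimedean by blast
      have "r \<in> \<rat> \<inter> {0<..}" using r st by auto
      then obtain k where k: "\<omega> \<notin> E r (inv k) (inv m)" using * by blast
      obtain d' where d': "0 < d'" "\<And>v. 0 \<le> v \<Longrightarrow> \<bar>v - s\<bar> < d' \<Longrightarrow> \<bar>?N v \<omega> - ?N s \<omega>\<bar> < inv k"
        using near[OF st(1) inv] by blast
      have "s < min r (s + d')" using r d' by auto
      then obtain q where q: "q \<in> \<rat>" "s < q" "q < min r (s + d')" using Rats_dense_in_real by blast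
      then have "?N q \<omega> \<le> inv k" using d'(2)[of q] Ns st by auto
      then show False using k q st \<omega> m by (auto simp: E_def Q_def)
    qed
    moreover have "0 \<le> ?N t \<omega>" by (simp add: l1_norm_def infsum_nonneg)
    ultimately have "?N t \<omega> = 0" by simp
    then show "X t \<omega> i = 0" using l1_norm_eq_0_iff[OF plus, of t \<omega>] st \<omega> by simp
  qed
qed

end

section \<open>Times of unbounded support\<close>

text \<open>Baire's theorem is applied to \<open>J\<close> twice. If \<open>S\<close> were
  countable, the sets \<open>J - {t}\<close> for \<open>t\<close> in \<open>S\<close> could be added
  to the family: each is relatively open, and dense because \<open>J\<close> has no isolated point.
  The enlarged intersection would be empty, yet dense in the nonempty set \<open>J\<close>.\<close>

lemma superset_dense_Gdelta_uncountable:
  fixes J :: "real set" and U :: "nat \<Rightarrow> real set"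
  assumes J: "closed J" "J \<noteq> {}" and no_isolated: "\<And>t. t \<in> J \<Longrightarrow> t islimpt J"
    and U: "\<And>n. openin (top_of_set J) (U n)" and dense: "\<And>n. J \<subseteq> closure (U n)"
    and S: "(\<Inter>n. U n) \<subseteq> S"
  shows "J \<subseteq> closure S" and "uncountable S"
proof -
  have "J \<subseteq> closure (\<Inter>(range U))"
    using U dense by (intro Baire[OF J(1)]) auto
  also have "\<dots> \<subseteq> closure S" using S by (intro closure_mono) auto
  finally show "J \<subseteq> closure S" .
  show "uncountable S"
  proof
    assume S_countable: "countable S"
    let ?G = "range U \<union> (\<lambda>t. J - {t}) ` S"
    have "J \<subseteq> closure (\<Inter>?G)"
    proof (rule Baire[OF J(1)])
      show "countable ?G" using S_countable by auto
      fix T assume "T \<in> ?G"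
      then show "openin (top_of_set J) T \<and> J \<subseteq> closure T"
      proof
        assume "T \<in> range U"
        then show ?thesis using U dense by auto
      next
        assume "T \<in> (\<lambda>t. J - {t}) ` S"
        then obtain t where T: "T = J - {t}" by blast
        have "J \<subseteq> closure (J - {t})"
        proof
          fix u assume u: "u \<in> J"
          show "u \<in> closure (J - {t})"
          proof (cases "u = t")
            case True
            then show ?thesis using islimpt_in_closure[of u J] no_isolated[OF u] by simp
          next
            case False
            then show ?thesis using u closure_subset[of "J - {t}"] by auto
          qed
        qed
        moreover have "openin (top_of_set J) T"
          unfolding T openin_open by (intro exI[of _ "- {t}"]) auto
        ultimately show ?thesis unfolding T by blast
      qed
    qed
    moreover have "\<Inter>?G = {}"
    proof -
      have "t \<notin> \<Inter>?G" for t
      proof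
        assume t: "t \<in> \<Inter>?G"
        then have "t \<in> S" using S by blast
        then have "t \<in> J - {t}" using t by blast
        then show False by simp
      qed
      then show ?thesis by blast
    qed
    ultimately show False using J(2) by simp
  qed
qed

text \<open>Only rational endpoints occur in the hypothesis on \<open>spread\<close>, because it holds almost surely for
  one pair of endpoints at a time.\<close>

lemma unbounded_support_times:
  fixes x :: "real \<Rightarrow> int ^ 'd \<Rightarrow> real"
  assumes cont: "\<And>i. continuous_on {0..} (\<lambda>t. x t i)"
    and start: "x 0 i0 \<noteq> 0"
    and spread: "\<And>a b i j u. a \<in> \<rat> \<Longrightarrow> b \<in> \<rat> \<Longrightarrow> 0 \<le> a \<Longrightarrow> a < b \<Longrightarrow>
      (\<And>u. u \<in> {a..b} \<Longrightarrow> x u i = 0) \<Longrightarrow> j \<in> neighbours i \<Longrightarrow> u \<in> {a..b} \<Longrightarrow> x u j = 0"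
    and absorb: "\<And>s t i. 0 \<le> s \<Longrightarrow> s \<le> t \<Longrightarrow> (\<And>i. x s i = 0) \<Longrightarrow> x t i = 0"
    and \<eta>: "\<eta> = Inf (ereal ` {t. 0 \<le> t \<and> (\<forall>i. x t i = 0)})"
    and J: "J = {t. 0 \<le> t \<and> ereal t \<le> \<eta>}"
    and S: "S = {t. 0 \<le> t \<and> \<not> lattice_bounded (supp (x t))}"
  shows "0 < \<eta>" "S \<subseteq> J" "J \<subseteq> closure S" "uncountable S"
proof -
  \<comment> \<open>By continuity the site \<open>i0\<close> stays occupied before time
    \<open>d\<close>, hence \<open>\<eta> \<ge> d\<close>.\<close>
  obtain d where d: "0 < d" "\<And>t. 0 \<le> t \<Longrightarrow> t < d \<Longrightarrow> x t i0 \<noteq> 0"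
  proof -
    obtain d where "0 < d" "\<forall>t\<in>{0..}. dist t 0 < d \<longrightarrow> dist (x t i0) (x 0 i0) < \<bar>x 0 i0\<bar>"
      using cont[of i0] start unfolding continuous_on_iff by (metis atLeast_iff order_refl zero_less_abs_iff)
    then show thesis by (intro that[of d]) (auto simp: dist_real_def)
  qed
  have \<eta>_ge: "ereal d \<le> \<eta>"
    unfolding \<eta>
  proof (rule Inf_greatest)
    fix y assume "y \<in> ereal ` {t. 0 \<le> t \<and> (\<forall>i. x t i = 0)}"
    then obtain t where "y = ereal t" "0 \<le> t" "\<forall>i. x t i = 0" by blast
    then show "ereal d \<le> y" using d(2)[of t] by (force simp: not_less[symmetric])
  qed
  have "0 < ereal d" using d by simp
  then show \<eta>_pos: "0 < \<eta>" using \<eta>_ge by (rule order_less_le_trans)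
  show "S \<subseteq> J"
  proof
    fix t assume t: "t \<in> S"
    have "ereal t \<le> \<eta>"
    proof (rule ccontr)
      assume "\<not> ereal t \<le> \<eta>"
      then obtain s where s: "0 \<le> s" "\<forall>i. x s i = 0" "s < t"
        unfolding \<eta> by (auto simp: not_le Inf_less_iff)
      then have "x t i = 0" for i using absorb[of s t i] by simp
      then show False using t by (simp add: S supp_def lattice_bounded_def)
    qed
    then show "t \<in> J" using t by (simp add: S J)
  qed
  have alive: "\<exists>i. x t i \<noteq> 0" if "0 \<le> t" "ereal t < \<eta>" for t
  proof (rule ccontr)
    assume "\<not> (\<exists>i. x t i \<noteq> 0)"
    then have "\<eta> \<le> ereal t" unfolding \<eta> using that(1) by (intro Inf_lower) auto
    then show False using that(2) by simp
  qed
  define U where "U n = {t \<in> J. \<exists>i. real n < norm (embed i) \<and> x t i \<noteq> 0}" for n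
  have J_nonneg: "J \<subseteq> {0..}" by (auto simp: J)
  have U_open: "openin (top_of_set J) (U n)" for n
  proof -
    have "U n = (\<Union>i\<in>{i. real n < norm (embed i)}. J \<inter> (\<lambda>t. x t i) -` (- {0}))"
      by (auto simp: U_def)
    also have "openin (top_of_set J) \<dots>"
      by (intro openin_Union ballI) (auto intro!: continuous_openin_preimage_gen continuous_on_subset[OF cont J_nonneg])
    finally show ?thesis .
  qed
  have U_hits: "\<exists>t\<in>U n. a < t \<and> t < b" if ab: "0 \<le> a" "a < b" "ereal b \<le> \<eta>" for a b n
  proof (rule ccontr)
    assume none: "\<not> (\<exists>t\<in>U n. a < t \<and> t < b)"
    \<comment> \<open>\<open>spread\<close> needs rational endpoints, so the interval is shrunk to
      \<open>{p..q}\<close>; since \<open>p < \<eta>\<close>, the solution is nonzero at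
      \<open>p\<close>.\<close>
    obtain p where p: "p \<in> \<rat>" "a < p" "p < b" using Rats_dense_in_real[OF ab(2)] by blast
    obtain q where q: "q \<in> \<rat>" "p < q" "q < b" using Rats_dense_in_real[OF p(3)] by blast
    have p_less: "ereal p < \<eta>" using p(3) ab(3) by (meson ereal_less_eq(3) less_ereal.simps(1) order_less_le_trans)
    have in_J: "u \<in> J" if "u \<in> {p..q}" for u
      using that ab p q order_trans[of "ereal u" "ereal b" \<eta>] by (auto simp: J)
    define Z where "Z = {i. \<forall>u\<in>{p..q}. x u i = 0}"
    have "i \<in> Z" for i
    proof (rule neighbour_closed_imp_UNIV[where R = n])
      show "j \<in> Z" if "i \<in> Z" "j \<in> neighbours i" for i j
        using that spread[OF p(1) q(1) _ q(2), of i j] ab p by (auto simp: Z_def)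
      show "i \<in> Z" if "real n < norm (embed i)" for i
        unfolding Z_def
      proof (intro CollectI ballI, rule ccontr)
        fix u assume u: "u \<in> {p..q}" "x u i \<noteq> 0"
        then have "u \<in> U n" using in_J that by (auto simp: U_def)
        then show False using none u p q by auto
      qed
    qed
    then have "x p i = 0" for i using q(2) by (auto simp: Z_def)
    then show False using alive[OF _ p_less] ab p by auto
  qed
  \<comment> \<open>An interval inside \<open>J\<close> that avoids \<open>t\<close>: to the right
    if \<open>t = 0\<close>, to the left otherwise, as \<open>t\<close> may equal \<eta>. Avoiding
    \<open>t\<close> also shows that \<open>J\<close> has no isolated point.\<close>
  have near: "\<exists>a b. 0 \<le> a \<and> a < b \<and> ereal b \<le> \<eta> \<and> {a<..<b} \<subseteq> {t - e<..<t + e} - {t}"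
    if t: "t \<in> J" and e: "0 < e" for t e
  proof (cases "t = 0")
    case True
    then show ?thesis
      using e d \<eta>_ge order_trans[of "ereal (min d e)" "ereal d" \<eta>] by (intro exI[of _ 0] exI[of _ "min d e"]) auto
  next
    case False
    then show ?thesis
      using t e by (intro exI[of _ "max 0 (t - e)"] exI[of _ t]) (auto simp: J)
  qed
  have U_dense: "\<exists>u\<in>U n. u \<noteq> t \<and> dist u t < e" if te: "t \<in> J" "0 < e" for t e n
  proof -
    obtain a b where ab: "0 \<le> a" "a < b" "ereal b \<le> \<eta>" "{a<..<b} \<subseteq> {t - e<..<t + e} - {t}"
      using near[OF te] by blast
    obtain u where u: "u \<in> U n" "a < u" "u < b" using U_hits[OF ab(1-3)] by blast
    then have "u \<in> {t - e<..<t + e} - {t}" using ab(4) by auto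
    then show ?thesis using u(1) by (intro bexI[of _ u]) (auto simp: dist_real_def)
  qed
  have "closed J"
  proof -
    have "J = {0..} \<inter> ereal -` {..\<eta>}" by (auto simp: J)
    then show ?thesis by (simp add: closed_Int closed_vimage continuous_on_ereal)
  qed
  moreover have "J \<noteq> {}" using \<eta>_pos by (auto simp: J zero_ereal_def intro!: exI[of _ 0] less_imp_le)
  moreover have "t islimpt J" if "t \<in> J" for t
    unfolding islimpt_approachable using U_dense[OF that, of _ 0] by (fastforce simp: U_def)
  moreover have "J \<subseteq> closure (U n)" for n
    using U_dense by (meson closure_approachable subsetI)
  moreover have "(\<Inter>n. U n) \<subseteq> S"
  proof
    fix t assume t: "t \<in> (\<Inter>n. U n)"
    have "\<not> bounded (embed ` supp (x t))"
    proof
      assume "bounded (embed ` supp (x t))"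
      then obtain R where R: "\<And>i. x t i \<noteq> 0 \<Longrightarrow> norm (embed i) \<le> R"
        unfolding bounded_iff supp_def by blast
      obtain n :: nat where "R < real n" using reals_Archimedean2 by blast
      moreover have "t \<in> U n" using t by blast
      ultimately show False using R by (force simp: U_def)
    qed
    moreover have "0 \<le> t" using t by (auto simp: U_def J)
    ultimately show "t \<in> S" by (simp add: S lattice_bounded_def)
  qed
  ultimately show "J \<subseteq> closure S" "uncountable S"
    using superset_dense_Gdelta_uncountable[of J U S] U_open by blast+
qed

theorem theorem2p3:
  fixes M :: "'a measure"
    and F :: "real \<Rightarrow> 'a measure"
    and B :: "int ^ 'd \<Rightarrow> real \<Rightarrow> 'a \<Rightarrow> real"
    and \<sigma> :: "real \<Rightarrow> real"
    and C \<theta> :: real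
    and X :: "real \<Rightarrow> 'a \<Rightarrow> int ^ 'd \<Rightarrow> real"
  assumes "filtered_prob_space M F"
    and "independent_brownian_motions M F B"
    and "continuous_on {0..} \<sigma>"
    and "\<sigma> 0 = 0"
    and "\<And>x. 0 < x \<Longrightarrow> 0 < \<sigma> x"
    and "1 \<le> C" and "0 < \<theta>" and "\<theta> < 1"
    and "\<And>x. 0 \<le> x \<Longrightarrow> \<sigma> x \<le> C * (x powr \<theta> + x)"
    and "continuous_l1_solution M F B \<sigma> X"
    and "AE \<omega> in M. \<exists>i. X 0 \<omega> i \<noteq> 0"
  shows "AE \<omega> in M.
    let \<eta> = extinction_time X \<omega>;
        J = {t :: real. 0 \<le> t \<and> ereal t \<le> \<eta>};
        S = {t :: real. 0 \<le> t \<and> \<not> lattice_bounded (supp (X t \<omega>))}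
    in 0 < \<eta> \<and> S \<subseteq> J \<and> J \<subseteq> closure S \<and> uncountable S"
proof -
  interpret filtered_prob_space M F by (rule assms(1))
  have W: "\<And>i. brownian_motion M F (B i)"
    using assms(2) by (simp add: independent_brownian_motions_def)
  note sol = assms(10)
  let ?R = "(\<rat> \<inter> {0..}) \<times> (\<rat> \<inter> {0..}) \<inter> {(a, b). a < b} :: (real \<times> real) set"
  \<comment> \<open>Each pair of endpoints has its own null set in
    \<open>solution_zero_spreads\<close>; countably many rational pairs leave a single one.\<close>
  have "AE \<omega> in M. \<forall>(a, b)\<in>?R. \<forall>i. (\<forall>u\<in>{a..b}. X u \<omega> i = 0) \<longrightarrow>
      (\<forall>j\<in>neighbours i. \<forall>u\<in>{a..b}. X u \<omega> j = 0)"
  proof (subst AE_ball_countable)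
    show "countable ?R" by (intro countable_Int1 countable_SIGMA) (auto intro: countable_Int1 countable_rat)
    show "\<forall>p\<in>?R. AE \<omega> in M. case p of (a, b) \<Rightarrow> \<forall>i. (\<forall>u\<in>{a..b}. X u \<omega> i = 0) \<longrightarrow>
        (\<forall>j\<in>neighbours i. \<forall>u\<in>{a..b}. X u \<omega> j = 0)"
      using solution_zero_spreads[OF W assms(4) sol] by auto
  qed
  then show ?thesis
    using solution_absorbed_at_0[OF W assms(3) sol] assms(11) AE_space
  proof eventually_elim
    case (elim \<omega>)
    then obtain i0 where i0: "X 0 \<omega> i0 \<noteq> 0" by blast
    have spread: "X u \<omega> j = 0"
      if "a \<in> \<rat>" "b \<in> \<rat>" "0 \<le> a" "a < b" "\<And>u. u \<in> {a..b} \<Longrightarrow> X u \<omega> i = 0" "j \<in> neighbours i" "u \<in> {a..b}"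
      for a b i j u
    proof -
      have "(a, b) \<in> ?R" using that(1-4) by auto
      then show ?thesis using elim(1) that(5-7) by blast
    qed
    have absorb: "X t \<omega> i = 0" if "0 \<le> s" "s \<le> t" "\<And>i. X s \<omega> i = 0" for s t i
      using elim(2) that by blast
    note * = unbounded_support_times[where x = "\<lambda>t. X t \<omega>" and \<eta> = "extinction_time X \<omega>",
        OF solution_continuous[OF sol elim(4)] i0 spread absorb extinction_time_def refl refl]
    show ?case unfolding Let_def by (intro conjI *)
  qed
qed

end
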